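(* Let $S_{g,b}$ be a compact orientable hyperbolic surface with geodesic boundary, of genus $g$ with $b\ge 1$ boundary components (no cusps), and let $G_{g,b}\subset \mathrm{SO}^o(2,1)$ be its Fuchsian group. Decompose $S_{g,b}$ into $g$ once-holed tori $T_1,\dots,T_g$ and $g+b-2$ pairs of pants as described in the context, with loops $\gamma^i$ ($1\le i\le b$), $g^j$, $w_1^j$, $w_2^j$ ($1\le j\le g$), $f_k$ ($1\le k\le b+g-3$). Assume that $\theta_{w_1^j}^{w_2^j}\neq \pi/2$ for every $j=1,\dots,g$. Then the affine deformation space $\mathrm{H}^1(G_{g,b},\mathbb{R}_1^2)$ is linearly parametrized by the Margulis invariants and the affine twist parameters of this decomposition. That is, for a suitable normalization (choice of reference cocycles, see context) there is a linear isomorphism $\mathbb{R}^{6g+3b-6}\to \mathrm{H}^1(G_{g,b},\mathbb{R}_1^2)$ sending $$\big((\alpha^i)_{i},(\kappa^j)_j,(\beta_k)_k,(\zeta_1^j)_j,(\zeta_2^j)_j,(\tau^j)_j,(\epsilon_k)_k\big)$$ to the unique class $[\mathbf{u}]$ with $$\mathrm{Mar}_{\mathbf u}(\gamma^i)=\alpha^i,\quad \mathrm{Mar}_{\mathbf u}(g^j)=\kappa^j,\quad \mathrm{Mar}_{\mathbf u}(f_k)=\beta_k,\quad \mathrm{Mar}_{\mathbf u}(w_1^j)=\zeta_1^j,\quad \mathrm{Mar}_{\mathbf u}(w_2^j)=\zeta_2^j,$$ $$\mathrm{AfT}_{\mathbf u}(g^j)=\tau^j,\quad \mathrm{AfT}_{\mathbf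 u}(f_k)=\epsilon_k .$$
   Context: Lorentzian space: $\mathbb{R}_1^2$ is $\mathbb{R}^3$ with $B(x,y)=x_1y_1+x_2y_2-x_3y_3$; $\mathrm{SO}^o(2,1)\cong \mathrm{PSL}(2,\mathbb{R})$ is the identity component of its linear isometry group, and $\mathbb{H}^2$ is the set of future-pointing timelike rays. A hyperbolic $h\in \mathrm{SO}^o(2,1)$ has eigenvalues $\lambda<1<\lambda^{-1}$. Its null frame $\{\mathbf X_h^0,\mathbf X_h^-,\mathbf X_h^+\}$ consists of future-pointing null eigenvectors $\mathbf X_h^-$ (smallest eigenvalue) and $\mathbf X_h^+$ (largest eigenvalue) of Euclidean norm $1$, and the unit spacelike eigenvector $\mathbf X_h^0$ of eigenvalue $1$ with $\det(\mathbf X_h^0,\mathbf X_h^-,\mathbf X_h^+)>0$. Cocycles: all nontrivial elements of $G=G_{g,b}$ are hyperbolic. A cocycle is a map $\mathbf u:G\to\mathbb{R}_1^2$ with $\mathbf u(h_1h_2)=h_1\mathbf u(h_2)+\mathbf u(h_1)$; for $\mathbf v\in\mathbb{R}_1^2$ the coboundary is $\delta_{\mathbf v}(h)=\mathbf v-h\mathbf v$. $\mathrm{H}^1(G,\mathbb{R}_1^2)=\mathrm{Z}^1/\mathrm{B}^1$ (cocycles modulo coboundaries). The Margulis invariant is $\mathrm{Mar}_{\mathbf u}(h)=B(\mathbf u(h),\mathbf X_h^0)$; it depends only on $[\mathbf u]$ and on the conjugacy class of $h$, and $\mathrm{Mar}_{\mathbf u}(h^{-1})=\mathrm{Mar}_{\mathbf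 u}(h)$. Angle: for oriented geodesics $h_1,h_2$ crossing at $p$, $(\theta_{h_1}^{h_2})_p\in(0,\pi)$ is the angle at $p$ between the forward direction of $h_1$ and the part of $h_2$ (orientation forgotten) lying to the left of $h_1$. Decomposition: the separating simple closed geodesics $g^1,\dots,g^g$ cut off once-holed tori $T_1,\dots,T_g$ with $\partial T_j=g^j$. On $T_j$, $w_1^j$ and $w_2^j$ are simple closed geodesics (longitude and meridian) meeting once and generating $\pi_1(T_j)$, with $[w_1^j,w_2^j]$ representing $g^j$. The complement of the tori, a sphere with $g+b$ holes, is cut by disjoint simple closed geodesics $f_1,\dots,f_{b+g-3}$ into a chain of pairs of pants $P_1,\dots,P_{g+b-2}$, with $P_k$ and $P_{k+1}$ sharing exactly the curve $f_k$. The remaining boundary curves of the pants, listed along the chain, are $\gamma^b,\gamma^1,\dots,\gamma^{b-1},g^1,\dots,g^g$, where $\gamma^1,\dots,\gamma^b$ are the boundary components of $S_{g,b}$. (If $(g,b)=(1,1)$ there are no pants and no twist parameters, $\gamma^1=g^1$, and the coordinates are just $(\kappa^1,\zeta_1^1,\zeta_2^1)$.) Affine twist: each $c\in\{g^j,f_k\}$ is separating, so $G=\Sigma_1 *_{\langle c\rangle}\Sigma_2$ with $\Sigma_1,\Sigma_2$ the fundamental groups of the two sides of $c$. The affine twist cocycle $\mathbf{AT}_c$ is the cocycle on $G$ with $\mathbf{AT}_c(h)=\mathbf 0$ for $h\in\Sigma_1$, $\mathbf{AT}_c(h)=\mathbf X_c^0-h\mathbf X_c^0$ for $h\in\Sigma_2$,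 extended by the cocycle condition. Affine twist parameters: a normalization is a linear map $s$ assigning to each vector $m$ of prescribed values of the Margulis invariants of all loops $\gamma^i,g^j,f_k,w_1^j,w_2^j$ a reference cocycle $s(m)\in \mathrm{Z}^1(G,\mathbb{R}_1^2)$ having these Margulis invariants. (In the paper $s(m)$ is obtained by gluing cocycles on the pieces: given cocycles $\mathbf u^1,\mathbf u^2$ on the two sides of $c$ with $\mathrm{Mar}_{\mathbf u^1}(c)=\mathrm{Mar}_{\mathbf u^2}(c)$, their combination $\mathbf u^1\#_c\mathbf u^2$ is $\mathbf u^1$ on $\Sigma_1$ and $\mathbf u^2+\delta_{\mathbf{trans}}$ on $\Sigma_2$, with a fixed choice of $\mathbf{trans}$ such that the two agree on $c$.) Given $s$, the affine twist parameters of $\mathbf u$ with Margulis invariants $m$ are the coefficients $\mathrm{AfT}_{\mathbf u}(c)$ in $[\mathbf u]=[s(m)+\sum_{c}\mathrm{AfT}_{\mathbf u}(c)\,\mathbf{AT}_c]$, the sum being over $c\in\{g^j,f_k\}$. *)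

theory Defs
  imports "HOL-Analysis.Analysis" "HOL-Algebra.Generated_Groups"
begin

section \<open>Lorentzian space and hyperbolic isometries\<close>

type_synonym vec3 = "real^3"
type_synonym mat3 = "real^3^3"

definition lorentz :: "vec3 \<Rightarrow> vec3 \<Rightarrow> real" where
  "lorentz x y = x$1 * y$1 + x$2 * y$2 - x$3 * y$3"

definition lorentz_isometries :: "mat3 set" where
  "lorentz_isometries = {A. \<forall>x y. lorentz (A *v x) (A *v y) = lorentz x y}"

definition SOo21 :: "mat3 set" where
  "SOo21 = connected_component_set lorentz_isometries (mat 1)"

definition GL3 :: "mat3 monoid" where
  "GL3 = \<lparr>carrier = {A. invertible A}, mult = (**), one = mat 1\<rparr>"

lemma group_GL3: "group GL3"
proof (rule groupI)
  fix x assume "x \<in> carrier GL3"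
  then obtain y where "x ** y = mat 1" "y ** x = mat 1"
    by (auto simp: GL3_def invertible_def)
  then show "\<exists>y\<in>carrier GL3. y \<otimes>\<^bsub>GL3\<^esub> x = \<one>\<^bsub>GL3\<^esub>"
    by (auto simp: GL3_def invertible_def)
qed (auto simp: GL3_def invertible_mult matrix_mul_assoc invertible_def[of "mat 1"] intro: exI[of _ "mat 1"])

text \<open>A future-pointing timelike ray is represented by the unique unit timelike vector on it.\<close>

definition H2 :: "vec3 set" where
  "H2 = {p. lorentz p p = -1 \<and> p$3 > 0}"

definition eigenval :: "mat3 \<Rightarrow> real \<Rightarrow> bool" where
  "eigenval A a \<longleftrightarrow> (\<exists>x. x \<noteq> 0 \<and> A *v x = a *\<^sub>R x)"

definition hyperbolic :: "mat3 \<Rightarrow> bool" where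
  "hyperbolic h \<longleftrightarrow> h \<in> SOo21 \<and>
     (\<exists>a. 0 < a \<and> a < 1 \<and> eigenval h a \<and> eigenval h 1 \<and> eigenval h (1 / a))"

definition future_null :: "vec3 \<Rightarrow> bool" where
  "future_null x \<longleftrightarrow> lorentz x x = 0 \<and> x$3 > 0"

definition X_minus :: "mat3 \<Rightarrow> vec3" where
  "X_minus h = (THE x. future_null x \<and> norm x = 1 \<and> (\<exists>a. 0 < a \<and> a < 1 \<and> h *v x = a *\<^sub>R x))"

definition X_plus :: "mat3 \<Rightarrow> vec3" where
  "X_plus h = (THE x. future_null x \<and> norm x = 1 \<and> (\<exists>a. 1 < a \<and> h *v x = a *\<^sub>R x))"

definition X_zero :: "mat3 \<Rightarrow> vec3" where
  "X_zero h = (THE x. lorentz x x = 1 \<and> h *v x = x \<and>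
                      det (vector [x, X_minus h, X_plus h] :: mat3) > 0)"


section \<open>Geodesics\<close>

text \<open>The geodesic of a hyperbolic element is oriented from its repelling endpoint
  \<^term>\<open>X_minus h\<close> to its attracting endpoint \<^term>\<open>X_plus h\<close>.\<close>

definition geod_axis :: "mat3 \<Rightarrow> vec3 set" where
  "geod_axis h = H2 \<inter> span {X_minus h, X_plus h}"

definition direction :: "mat3 \<Rightarrow> vec3 \<Rightarrow> vec3" where
  "direction h p = (let t = X_plus h + lorentz (X_plus h) p *\<^sub>R p
                    in (1 / sqrt (lorentz t t)) *\<^sub>R t)"

text \<open>Seen in the projective disc with its standard orientation, the points \<open>x\<close> to the left of
  the geodesic of \<open>h\<close> are those with \<open>det (X_minus h, X_plus h, x) > 0\<close>. By the normalisation of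
  \<^term>\<open>X_zero h\<close> this means \<open>lorentz x (X_zero h) > 0\<close>.\<close>

definition left_direction :: "mat3 \<Rightarrow> mat3 \<Rightarrow> vec3 \<Rightarrow> vec3" where
  "left_direction h1 h2 p =
     (if lorentz (direction h2 p) (X_zero h1) > 0 then direction h2 p else - direction h2 p)"

definition crossing_angle :: "mat3 \<Rightarrow> mat3 \<Rightarrow> vec3 \<Rightarrow> real" where
  "crossing_angle h1 h2 p = arccos (lorentz (direction h1 p) (left_direction h1 h2 p))"

definition geod_convex :: "vec3 set \<Rightarrow> bool" where
  "geod_convex C \<longleftrightarrow> convex {r *\<^sub>R p | r p. r > 0 \<and> p \<in> C}"

definition fuchsian_group :: "mat3 set \<Rightarrow> bool" where
  "fuchsian_group G \<longleftrightarrow> subgroup G GL3 \<and> G \<subseteq> SOo21 \<and> discrete G"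

text \<open>The universal cover, inside \<^term>\<open>H2\<close>, of the hyperbolic surface with geodesic boundary
  whose Fuchsian group is \<open>G\<close>; the surface itself is \<open>convex_core G / G\<close>.\<close>

definition convex_core :: "mat3 set \<Rightarrow> vec3 set" where
  "convex_core G = \<Inter>{C. C \<noteq> {} \<and> C \<subseteq> H2 \<and> closed C \<and> geod_convex C \<and> (\<forall>h\<in>G. (*v) h ` C = C)}"

definition translates :: "mat3 set \<Rightarrow> vec3 set \<Rightarrow> vec3 set" where
  "translates G A = (\<Union>h\<in>G. (*v) h ` A)"

definition cocompact :: "mat3 set \<Rightarrow> bool" where
  "cocompact G \<longleftrightarrow> (\<exists>D. compact D \<and> D \<subseteq> convex_core G \<and> convex_core G = translates G D)"

text \<open>The boundary of the surface of \<open>G\<close> consists of the closed geodesics of the elements of \<open>E\<close>.\<close>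

definition has_geodesic_boundary :: "mat3 set \<Rightarrow> mat3 set \<Rightarrow> bool" where
  "has_geodesic_boundary G E \<longleftrightarrow>
     top_of_set H2 frontier_of convex_core G = (\<Union>h\<in>E. translates G (geod_axis h))"

text \<open>The closed curve \<open>geod_axis h / \<langle>h\<rangle> \<rightarrow> H2 / G\<close> is injective.\<close>

definition simple_closed_geodesic :: "mat3 set \<Rightarrow> mat3 \<Rightarrow> bool" where
  "simple_closed_geodesic G h \<longleftrightarrow> h \<in> G \<and> hyperbolic h \<and>
     (\<forall>k\<in>G. geod_axis h \<inter> (*v) k ` geod_axis h \<noteq> {} \<longrightarrow> k \<in> generate GL3 {h})"

definition disjoint_geodesics :: "mat3 set \<Rightarrow> mat3 \<Rightarrow> mat3 \<Rightarrow> bool" where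
  "disjoint_geodesics G h1 h2 \<longleftrightarrow> geod_axis h1 \<inter> translates G (geod_axis h2) = {}"

text \<open>The lifts \<open>geod_axis h1\<close> and \<open>geod_axis h2\<close> cross, and all intersection points of the two closed
  geodesics are one point of the surface.\<close>

definition meet_once :: "mat3 set \<Rightarrow> mat3 \<Rightarrow> mat3 \<Rightarrow> bool" where
  "meet_once G h1 h2 \<longleftrightarrow> geod_axis h1 \<noteq> geod_axis h2 \<and>
     (\<exists>p \<in> geod_axis h1 \<inter> geod_axis h2. geod_axis h1 \<inter> translates G (geod_axis h2) \<subseteq> translates G {p})"


section \<open>Free generation\<close>

text \<open>A letter \<open>(i, True)\<close> stands for the generator \<open>c i\<close>, and \<open>(i, False)\<close> for its inverse.\<close>

fun word_value :: "('i \<Rightarrow> mat3) \<Rightarrow> ('i \<times> bool) list \<Rightarrow> mat3" where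
  "word_value c [] = mat 1"
| "word_value c ((i, e) # w) = (if e then c i else inv\<^bsub>GL3\<^esub> (c i)) ** word_value c w"

definition reduced_word :: "('i \<times> bool) list \<Rightarrow> bool" where
  "reduced_word w \<longleftrightarrow> successively (\<lambda>x y. \<not> (fst x = fst y \<and> snd x \<noteq> snd y)) w"

definition freely_generated :: "mat3 set \<Rightarrow> 'i set \<Rightarrow> ('i \<Rightarrow> mat3) \<Rightarrow> bool" where
  "freely_generated G I c \<longleftrightarrow> G = generate GL3 (c ` I) \<and>
     (\<forall>w. w \<noteq> [] \<and> fst ` set w \<subseteq> I \<and> reduced_word w \<longrightarrow> word_value c w \<noteq> mat 1)"


section \<open>The surface and its decomposition\<close>

text \<open>Names of the loops: \<open>Boundary i\<close> is \<open>\<gamma>\<^sup>i\<close>, \<open>Sep j\<close> is \<open>g\<^sup>j\<close>, \<open>Cut k\<close> is \<open>f\<^sub>k\<close>, and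
  \<open>Longitude j\<close>, \<open>Meridian j\<close> are the curves \<open>w\<^sub>1\<close>, \<open>w\<^sub>2\<close> of the \<open>j\<close>-th once-holed torus.\<close>

datatype loop = Boundary nat | Sep nat | Cut nat | Longitude nat | Meridian nat

definition cutting_loops :: "nat \<Rightarrow> nat \<Rightarrow> loop set" where
  "cutting_loops g b =
     (if g = 1 \<and> b = 1 then {} else Sep ` {1..g} \<union> Cut ` {1..b + g - 3})"

text \<open>For the once-holed torus \<open>\<gamma>\<^sup>1\<close> and \<open>g\<^sup>1\<close> are the same curve, which is listed only once.\<close>

definition loops :: "nat \<Rightarrow> nat \<Rightarrow> loop set" where
  "loops g b =
     (if g = 1 \<and> b = 1 then {Sep 1, Longitude 1, Meridian 1}
      else Boundary ` {1..b} \<union> Sep ` {1..g} \<union> Cut ` {1..b + g - 3}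
             \<union> Longitude ` {1..g} \<union> Meridian ` {1..g})"

text \<open>Removing the tori leaves a sphere with \<open>g + b\<close> holes. Along the chain of pants the holes are
  numbered \<open>0, \<dots>, g + b - 1\<close>, with boundary curves
  \<open>\<gamma>\<^sup>b, \<gamma>\<^sup>1, \<dots>, \<gamma>\<^sup>b\<^sup>-\<^sup>1, g\<^sup>1, \<dots>, g\<^sup>g\<close>.\<close>

definition hole :: "nat \<Rightarrow> nat \<Rightarrow> loop" where
  "hole b i = (if i = 0 then Boundary b else if i < b then Boundary i else Sep (i + 1 - b))"

text \<open>Generators of the fundamental group of what is attached at hole \<open>i\<close>: the boundary circle
  itself or a once-holed torus.\<close>

definition hole_generators :: "nat \<Rightarrow> nat \<Rightarrow> loop set" where
  "hole_generators b i =
     (if i < b then {hole b i} else {Longitude (i + 1 - b), Meridian (i + 1 - b)})"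

primrec hole_product :: "nat \<Rightarrow> (loop \<Rightarrow> mat3) \<Rightarrow> nat \<Rightarrow> mat3" where
  "hole_product b c 0 = c (hole b 0)"
| "hole_product b c (Suc k) = hole_product b c k ** c (hole b (Suc k))"

definition commutator :: "mat3 \<Rightarrow> mat3 \<Rightarrow> mat3" where
  "commutator x y = x ** y ** inv\<^bsub>GL3\<^esub> x ** inv\<^bsub>GL3\<^esub> y"

definition simple_disjoint_system :: "mat3 set \<Rightarrow> (loop \<Rightarrow> mat3) \<Rightarrow> loop set \<Rightarrow> bool" where
  "simple_disjoint_system G c L \<longleftrightarrow>
     (\<forall>l\<in>L. simple_closed_geodesic G (c l)) \<and>
     (\<forall>l\<in>L. \<forall>m\<in>L. l \<noteq> m \<longrightarrow> disjoint_geodesics G (c l) (c m))"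

text \<open>The compact orientable hyperbolic surface of genus \<open>g\<close> with \<open>b\<close> geodesic boundary components:
  \<open>convex_core G / G\<close> is compact, its boundary consists of \<open>b\<close> disjoint closed geodesics
  \<open>\<gamma>\<^sup>1, \<dots>, \<gamma>\<^sup>b\<close>, and \<open>G\<close> is marked by the standard presentation of the fundamental group
  relative to the boundary: generators \<open>w\<close> and \<open>\<gamma>\<close>, and one relation
  \<open>\<gamma>\<^sup>b \<gamma>\<^sup>1 \<dots> \<gamma>\<^sup>b\<^sup>-\<^sup>1 [w\<^sub>1, w\<^sub>2]\<^sup>1 \<dots> [w\<^sub>1, w\<^sub>2]\<^sup>g = 1\<close>, which eliminates \<open>\<gamma>\<^sup>b\<close>.
  The map \<open>c\<close> sends every loop to an element of \<open>G\<close> representing it. The representatives are chosen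
  coherently, reversing a curve if necessary; this changes neither Margulis invariants nor
  \<^term>\<open>crossing_angle\<close>.\<close>

definition marked_surface :: "nat \<Rightarrow> nat \<Rightarrow> mat3 set \<Rightarrow> (loop \<Rightarrow> mat3) \<Rightarrow> bool" where
  "marked_surface g b G c \<longleftrightarrow>
     2 * g + b > 2 \<and>
     fuchsian_group G \<and> (\<forall>h\<in>G. h \<noteq> mat 1 \<longrightarrow> hyperbolic h) \<and> cocompact G \<and>
     has_geodesic_boundary G (c ` Boundary ` {1..b}) \<and>
     simple_disjoint_system G c (Boundary ` {1..b}) \<and>
     freely_generated G (Boundary ` {1..<b} \<union> Longitude ` {1..g} \<union> Meridian ` {1..g}) c \<and>
     (\<forall>j\<in>{1..g}. c (Sep j) = commutator (c (Longitude j)) (c (Meridian j))) \<and>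
     hole_product b c (g + b - 1) = mat 1"

datatype piece = Torus nat | Pants nat

definition pieces :: "nat \<Rightarrow> nat \<Rightarrow> piece set" where
  "pieces g b = Torus ` {1..g} \<union> Pants ` {1..g + b - 2}"

text \<open>The pair of pants \<open>P\<^sub>k\<close> is bounded by \<open>f\<^sub>k\<^sub>-\<^sub>1\<close>, hole \<open>k\<close> and \<open>f\<^sub>k\<close>, where \<open>f\<^sub>k\<close> is the product of
  the holes \<open>0, \<dots>, k\<close>. At the two ends of the chain these products are hole \<open>0\<close> and the inverse
  of hole \<open>g + b - 1\<close>.\<close>

fun piece_group :: "nat \<Rightarrow> (loop \<Rightarrow> mat3) \<Rightarrow> piece \<Rightarrow> mat3 set" where
  "piece_group b c (Torus j) = generate GL3 {c (Longitude j), c (Meridian j)}"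
| "piece_group b c (Pants k) = generate GL3 {hole_product b c (k - 1), c (hole b k)}"

fun piece_boundary :: "nat \<Rightarrow> (loop \<Rightarrow> mat3) \<Rightarrow> piece \<Rightarrow> mat3 set" where
  "piece_boundary b c (Torus j) = {c (Sep j)}"
| "piece_boundary b c (Pants k) = {hole_product b c (k - 1), c (hole b k), hole_product b c k}"

definition core_interior :: "mat3 set \<Rightarrow> vec3 set" where
  "core_interior G = top_of_set H2 interior_of convex_core G"

text \<open>The surface is the union of the pieces: their universal covers cover the universal cover of
  the surface, and two translates overlap only if they coincide.\<close>

definition decomposes_into :: "mat3 set \<Rightarrow> 'p set \<Rightarrow> ('p \<Rightarrow> mat3 set) \<Rightarrow> bool" where
  "decomposes_into G Q \<Gamma> \<longleftrightarrow>
     convex_core G = (\<Union>q\<in>Q. translates G (convex_core (\<Gamma> q))) \<and>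
     (\<forall>q\<in>Q. \<forall>r\<in>Q. \<forall>h\<in>G. core_interior (\<Gamma> q) \<inter> (*v) h ` core_interior (\<Gamma> r) \<noteq> {}
        \<longrightarrow> q = r \<and> h \<in> \<Gamma> q)"

definition decomposed_surface :: "nat \<Rightarrow> nat \<Rightarrow> mat3 set \<Rightarrow> (loop \<Rightarrow> mat3) \<Rightarrow> bool" where
  "decomposed_surface g b G c \<longleftrightarrow>
     marked_surface g b G c \<and>
     (\<forall>k\<in>{1..b + g - 3}. c (Cut k) = hole_product b c k) \<and>
     simple_disjoint_system G c (Boundary ` {1..b} \<union> cutting_loops g b) \<and>
     (\<forall>j\<in>{1..g}. simple_closed_geodesic G (c (Longitude j)) \<and>
                 simple_closed_geodesic G (c (Meridian j)) \<and>
                 meet_once G (c (Longitude j)) (c (Meridian j))) \<and>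
     (\<forall>q\<in>pieces g b. has_geodesic_boundary (piece_group b c q) (piece_boundary b c q)) \<and>
     decomposes_into G (pieces g b) (piece_group b c)"

text \<open>The holes on one side of a cutting curve, and the fundamental groups of both sides.\<close>

fun holes_beyond :: "nat \<Rightarrow> nat \<Rightarrow> loop \<Rightarrow> nat set" where
  "holes_beyond g b (Sep j) = {b + j - 1}"
| "holes_beyond g b (Cut k) = {k<..<g + b}"
| "holes_beyond g b _ = {}"

definition holes_group :: "nat \<Rightarrow> (loop \<Rightarrow> mat3) \<Rightarrow> nat set \<Rightarrow> mat3 set" where
  "holes_group b c I = generate GL3 (c ` (\<Union>i\<in>I. hole_generators b i))"

definition side_groups :: "nat \<Rightarrow> nat \<Rightarrow> (loop \<Rightarrow> mat3) \<Rightarrow> loop \<Rightarrow> mat3 set set" where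
  "side_groups g b c l =
     {holes_group b c (holes_beyond g b l), holes_group b c ({..<g + b} - holes_beyond g b l)}"


section \<open>Cocycles and cohomology\<close>

text \<open>Maps on \<open>G\<close> are extended by \<open>0\<close> outside \<open>G\<close>.\<close>

definition Z1 :: "mat3 set \<Rightarrow> (mat3 \<Rightarrow> vec3) set" where
  "Z1 G = {u. (\<forall>h1\<in>G. \<forall>h2\<in>G. u (h1 ** h2) = h1 *v u h2 + u h1) \<and> (\<forall>h. h \<notin> G \<longrightarrow> u h = 0)}"

definition coboundary :: "mat3 set \<Rightarrow> vec3 \<Rightarrow> mat3 \<Rightarrow> vec3" where
  "coboundary G v h = (if h \<in> G then v - h *v v else 0)"

definition cohomologous :: "mat3 set \<Rightarrow> ((mat3 \<Rightarrow> vec3) \<times> (mat3 \<Rightarrow> vec3)) set" where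
  "cohomologous G =
     {(u, u'). u \<in> Z1 G \<and> u' \<in> Z1 G \<and> (\<exists>v. \<forall>h. u' h - u h = coboundary G v h)}"

definition H1 :: "mat3 set \<Rightarrow> (mat3 \<Rightarrow> vec3) set set" where
  "H1 G = Z1 G // cohomologous G"

definition coh_class :: "mat3 set \<Rightarrow> (mat3 \<Rightarrow> vec3) \<Rightarrow> (mat3 \<Rightarrow> vec3) set" where
  "coh_class G u = cohomologous G `` {u}"

definition H1_add ::
  "mat3 set \<Rightarrow> (mat3 \<Rightarrow> vec3) set \<Rightarrow> (mat3 \<Rightarrow> vec3) set \<Rightarrow> (mat3 \<Rightarrow> vec3) set" where
  "H1_add G X Y = (\<Union>x\<in>X. \<Union>y\<in>Y. coh_class G (\<lambda>h. x h + y h))"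

definition H1_scale :: "mat3 set \<Rightarrow> real \<Rightarrow> (mat3 \<Rightarrow> vec3) set \<Rightarrow> (mat3 \<Rightarrow> vec3) set" where
  "H1_scale G a X = (\<Union>x\<in>X. coh_class G (\<lambda>h. a *\<^sub>R x h))"

definition margulis :: "(mat3 \<Rightarrow> vec3) \<Rightarrow> mat3 \<Rightarrow> real" where
  "margulis u h = lorentz (u h) (X_zero h)"

text \<open>The coordinate space of real vectors indexed by \<open>I\<close>.\<close>

definition coord_space :: "'i set \<Rightarrow> ('i \<Rightarrow> real) set" where
  "coord_space I = {x. \<forall>i. i \<notin> I \<longrightarrow> x i = 0}"

definition linear_iso_H1 ::
  "mat3 set \<Rightarrow> 'i set \<Rightarrow> (('i \<Rightarrow> real) \<Rightarrow> (mat3 \<Rightarrow> vec3) set) \<Rightarrow> bool" where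
  "linear_iso_H1 G I \<Phi> \<longleftrightarrow>
     bij_betw \<Phi> (coord_space I) (H1 G) \<and>
     (\<forall>x\<in>coord_space I. \<forall>y\<in>coord_space I. \<Phi> (\<lambda>i. x i + y i) = H1_add G (\<Phi> x) (\<Phi> y)) \<and>
     (\<forall>a. \<forall>x\<in>coord_space I. \<Phi> (\<lambda>i. a * x i) = H1_scale G a (\<Phi> x))"


section \<open>Affine twists\<close>

definition affine_twist :: "mat3 set \<Rightarrow> mat3 set \<Rightarrow> mat3 set \<Rightarrow> mat3 \<Rightarrow> mat3 \<Rightarrow> vec3" where
  "affine_twist G \<Sigma>1 \<Sigma>2 k =
     (THE u. u \<in> Z1 G \<and> (\<forall>h\<in>\<Sigma>1. u h = 0) \<and> (\<forall>h\<in>\<Sigma>2. u h = X_zero k - h *v X_zero k))"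

definition normalization ::
  "nat \<Rightarrow> nat \<Rightarrow> mat3 set \<Rightarrow> (loop \<Rightarrow> mat3) \<Rightarrow> ((loop \<Rightarrow> real) \<Rightarrow> mat3 \<Rightarrow> vec3) \<Rightarrow> bool" where
  "normalization g b G c s \<longleftrightarrow>
     (\<forall>m\<in>coord_space (loops g b). s m \<in> Z1 G \<and> (\<forall>l\<in>loops g b. margulis (s m) (c l) = m l)) \<and>
     (\<forall>m\<in>coord_space (loops g b). \<forall>m'\<in>coord_space (loops g b).
        s (\<lambda>l. m l + m' l) = (\<lambda>h. s m h + s m' h)) \<and>
     (\<forall>a. \<forall>m\<in>coord_space (loops g b). s (\<lambda>l. a * m l) = (\<lambda>h. a *\<^sub>R s m h))"

definition margulis_vector ::
  "nat \<Rightarrow> nat \<Rightarrow> (loop \<Rightarrow> mat3) \<Rightarrow> (mat3 \<Rightarrow> vec3) \<Rightarrow> loop \<Rightarrow> real" where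
  "margulis_vector g b c u l = (if l \<in> loops g b then margulis u (c l) else 0)"

definition has_twist_params ::
  "nat \<Rightarrow> nat \<Rightarrow> mat3 set \<Rightarrow> (loop \<Rightarrow> mat3) \<Rightarrow> (loop \<Rightarrow> mat3 set) \<Rightarrow> (loop \<Rightarrow> mat3 set) \<Rightarrow>
   ((loop \<Rightarrow> real) \<Rightarrow> mat3 \<Rightarrow> vec3) \<Rightarrow> (mat3 \<Rightarrow> vec3) \<Rightarrow> (loop \<Rightarrow> real) \<Rightarrow> bool" where
  "has_twist_params g b G c \<Sigma>1 \<Sigma>2 s u t \<longleftrightarrow>
     t \<in> coord_space (cutting_loops g b) \<and>
     coh_class G u = coh_class G (\<lambda>h. s (margulis_vector g b c u) h +
        (\<Sum>l\<in>cutting_loops g b. t l *\<^sub>R affine_twist G (\<Sigma>1 l) (\<Sigma>2 l) (c l) h))"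

definition AfT ::
  "nat \<Rightarrow> nat \<Rightarrow> mat3 set \<Rightarrow> (loop \<Rightarrow> mat3) \<Rightarrow> (loop \<Rightarrow> mat3 set) \<Rightarrow> (loop \<Rightarrow> mat3 set) \<Rightarrow>
   ((loop \<Rightarrow> real) \<Rightarrow> mat3 \<Rightarrow> vec3) \<Rightarrow> (mat3 \<Rightarrow> vec3) \<Rightarrow> loop \<Rightarrow> real" where
  "AfT g b G c \<Sigma>1 \<Sigma>2 s u = (THE t. has_twist_params g b G c \<Sigma>1 \<Sigma>2 s u t)"

text \<open>\<open>MarC\<close> of the loops \<open>\<gamma>\<^sup>i, g\<^sup>j, f\<^sub>k, w\<^sub>1, w\<^sub>2\<close> are the coordinates \<open>\<alpha>, \<kappa>, \<beta>, \<zeta>\<^sub>1, \<zeta>\<^sub>2\<close>;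
  \<open>TwistC\<close> of \<open>g\<^sup>j, f\<^sub>k\<close> are \<open>\<tau>, \<epsilon>\<close>.\<close>

datatype coord = MarC loop | TwistC loop

definition coords :: "nat \<Rightarrow> nat \<Rightarrow> coord set" where
  "coords g b = MarC ` loops g b \<union> TwistC ` cutting_loops g b"

lemma card_coords:
  assumes "b \<ge> 1" "2 * g + b > 2"
  shows "card (coords g b) = 6 * g + 3 * b - 6"
proof (cases "g = 1 \<and> b = 1")
  case True
  then show ?thesis
    by (simp add: coords_def loops_def cutting_loops_def)
next
  case False
  then have le: "b + g \<ge> 3" using assms by linarith
  have cut: "card (cutting_loops g b) = g + (b + g - 3)"
    using False unfolding cutting_loops_def
    by (subst if_not_P, simp, subst card_Un_disjoint) (auto simp: card_image inj_on_def)
  have cl: "card (loops g b) = b + g + (b + g - 3) + g + g"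
    using False unfolding loops_def
    by (subst if_not_P, simp, (subst card_Un_disjoint; (fastforce)?)+) (auto simp: card_image inj_on_def)
  have fin: "finite (loops g b)" "finite (cutting_loops g b)"
    by (auto simp: loops_def cutting_loops_def)
  have "card (coords g b) = card (loops g b) + card (cutting_loops g b)"
    unfolding coords_def using fin
    by (subst card_Un_disjoint) (auto simp: card_image inj_on_def)
  then show ?thesis using cut cl le by simp
qed

end

(*
Only the marking of the group enters: G is free on the boundary loops and the handle loops, and its
nontrivial elements are hyperbolic. For hyperbolic h, Mar_u(h) = 0 says exactly that u(h) = v - h v
for some v, and v is determined up to multiples of X_h^0. Two noncommuting hyperbolic elements have
no common nonzero fixed vector. Hence a cocycle on a pair of pants whose three boundary invariants
vanish is a coboundary, and so is a cocycle on a once-holed torus whose invariants at w_1, w_2 and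
[w_1, w_2] vanish, the latter because B(X_{w_1}^0, X_{w_2}^0) is nonzero, which is what the angle
condition says.

If all prescribed invariants of u vanish, u is therefore the coboundary of a vector on every piece.
The vectors of adjacent pieces differ by a multiple of X_c^0 for the common curve c, and these
multiples are the coefficients of the affine twists. The same comparison shows that the twists are
independent modulo coboundaries. Cocycles with arbitrary invariants are built along the chain of
pants: a value of u on the next hole can be chosen so that two further invariants are as prescribed,
and any value on a separating curve extends over its torus.
*)
theory Submission
  imports Defs
begin

section \<open>Hyperbolic isometries\<close>

text \<open>Hole 0, carrying the curve gamma^b, is not a free generator, so nothing can be
  prescribed on it directly. It is reached through the relation: \<open>hole_product b c k\<close>
  is the inverse of the product of the holes after k, a word in generators only. Hence values at
  partial products are propagated downwards from the last one, which is the identity, and freeness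
  shows that the two boundary elements generating a pair of pants do not commute. Both rigidity
  statements rest on one count: vectors v1, v2 realising the cocycle on two generators are ambiguous
  along two independent axes, and the third invariant is a nonzero linear functional of v2 - v1 that
  kills both axes. Its kernel is therefore exactly their plane. On the torus the same nonvanishing
  also yields existence. The order of the two sides of a cutting curve is left open, so an affine
  twist is comparable to a fixed model only up to sign and a coboundary. The linear algebra is done
  with models that vanish on the side of hole 0.\<close>

lemma lorentz_bilinear:
  "lorentz (x + y) z = lorentz x z + lorentz y z"
  "lorentz x (y + z) = lorentz x y + lorentz x z"
  "lorentz (x - y) z = lorentz x z - lorentz y z"
  "lorentz x (y - z) = lorentz x y - lorentz x z"
  "lorentz (r *\<^sub>R x) z = r * lorentz x z"
  "lorentz x (r *\<^sub>R z) = r * lorentz x z"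
  "lorentz (- x) z = - lorentz x z"
  "lorentz x (- z) = - lorentz x z"
  "lorentz 0 z = 0"
  "lorentz x 0 = 0"
  by (simp_all add: lorentz_def algebra_simps)

lemma lorentz_commute: "lorentz x y = lorentz y x"
  by (simp add: lorentz_def)

lemma lorentz_sum_left: "lorentz (\<Sum>i\<in>I. f i) z = (\<Sum>i\<in>I. lorentz (f i) z)"
  by (induction I rule: infinite_finite_induct) (simp_all add: lorentz_bilinear)

lemma lorentz_nondegenerate:
  assumes "\<And>y. lorentz x y = 0"
  shows "x = 0"
proof -
  have "x$1 = 0" "x$2 = 0" "x$3 = 0"
    using assms[of "axis 1 1"] assms[of "axis 2 1"] assms[of "axis 3 1"]
    by (simp_all add: lorentz_def axis_def)
  then show ?thesis by (simp add: vec_eq_iff forall_3)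
qed

lemma lorentz_isometry: "A \<in> lorentz_isometries \<Longrightarrow> lorentz (A *v x) (A *v y) = lorentz x y"
  by (simp add: lorentz_isometries_def)

lemma lorentz_isometry_kernel:
  assumes "A \<in> lorentz_isometries" "A *v v = 0"
  shows "v = 0"
proof (rule lorentz_nondegenerate)
  show "lorentz v w = 0" for w
    using lorentz_isometry[OF assms(1), of v w] assms(2) by (simp add: lorentz_bilinear)
qed

lemma SOo21_isometry: "A \<in> SOo21 \<Longrightarrow> A \<in> lorentz_isometries"
  unfolding SOo21_def using connected_component_subset by blast

lemmas matvec = matrix_vector_right_distrib matrix_vector_mult_diff_distrib matrix_vector_mult_scaleR

lemma matvec_neg: "A *v (- x) = - (A *v (x :: vec3))" for A :: mat3
  using matrix_vector_mult_diff_distrib[of A 0 x] by simp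

text \<open>An injective linear endomorphism of R^3 is surjective. Independence is phrased with
  explicit coefficients because pairing with B delivers it in this form.\<close>

lemma independent_spans:
  fixes p q r :: vec3
  assumes "\<And>\<alpha> \<beta> \<gamma>. \<alpha> *\<^sub>R p + \<beta> *\<^sub>R q + \<gamma> *\<^sub>R r = 0 \<Longrightarrow> \<alpha> = 0 \<and> \<beta> = 0 \<and> \<gamma> = 0"
  obtains \<alpha> \<beta> \<gamma> where "w = \<alpha> *\<^sub>R p + \<beta> *\<^sub>R q + \<gamma> *\<^sub>R r"
proof -
  let ?f = "\<lambda>c :: vec3. c$1 *\<^sub>R p + c$2 *\<^sub>R q + c$3 *\<^sub>R r"
  have lin: "linear ?f" by (auto simp: linear_iff scaleR_add_left scaleR_add_right)
  have "inj ?f"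
    unfolding linear_injective_0[OF lin]
  proof (intro allI impI)
    fix c assume "?f c = 0"
    then have "c$1 = 0 \<and> c$2 = 0 \<and> c$3 = 0" by (rule assms)
    then show "c = 0" by (simp add: vec_eq_iff forall_3)
  qed
  then have "surj ?f" using lin linear_injective_imp_surjective by blast
  then obtain c where "w = ?f c" using surjD[of ?f w] by blast
  then show thesis using that by blast
qed

lemma null_nonzero:
  assumes "lorentz x x = 0" "x \<noteq> 0"
  shows "x$3 \<noteq> 0"
proof
  assume "x$3 = 0"
  then have "x$1 * x$1 + x$2 * x$2 = 0" using assms by (simp add: lorentz_def)
  then have "x$1 = 0 \<and> x$2 = 0" by (simp add: sum_squares_eq_zero_iff)
  then show False using assms \<open>x$3 = 0\<close> by (simp add: vec_eq_iff forall_3)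
qed

text \<open>The Lagrange identity in the first two coordinates bounds (x3 y3)^2 by the product of
  the squared lengths of the planar parts. A vector \<open>x\<close> that is not spacelike would
  violate this bound against a timelike \<open>y\<close>.\<close>

lemma spacelike_if_orthogonal_timelike:
  assumes "lorentz y y < 0" "lorentz x y = 0" "x \<noteq> 0"
  shows "lorentz x x > 0"
proof (rule ccontr)
  assume "\<not> ?thesis"
  then have x: "(x$1)\<^sup>2 + (x$2)\<^sup>2 \<le> (x$3)\<^sup>2" by (simp add: lorentz_def power2_eq_square)
  have y: "(y$1)\<^sup>2 + (y$2)\<^sup>2 < (y$3)\<^sup>2" using assms by (simp add: lorentz_def power2_eq_square)
  have eq: "x$1 * y$1 + x$2 * y$2 = x$3 * y$3" using assms by (simp add: lorentz_def)
  have x3: "x$3 \<noteq> 0"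
  proof
    assume "x$3 = 0"
    then have "x$1 = 0 \<and> x$2 = 0" using x by (simp add: sum_power2_le_zero_iff)
    then show False using assms \<open>x$3 = 0\<close> by (simp add: vec_eq_iff forall_3)
  qed
  have "(x$3 * y$3)\<^sup>2 + (x$1 * y$2 - x$2 * y$1)\<^sup>2 = ((x$1)\<^sup>2 + (x$2)\<^sup>2) * ((y$1)\<^sup>2 + (y$2)\<^sup>2)"
    unfolding eq[symmetric] by (simp add: power2_eq_square algebra_simps)
  then have "(x$3 * y$3)\<^sup>2 \<le> ((x$1)\<^sup>2 + (x$2)\<^sup>2) * ((y$1)\<^sup>2 + (y$2)\<^sup>2)"
    by (smt (verit) zero_le_power2)
  also have "\<dots> \<le> (x$3)\<^sup>2 * ((y$1)\<^sup>2 + (y$2)\<^sup>2)" using x by (intro mult_right_mono) auto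
  also have "\<dots> < (x$3)\<^sup>2 * (y$3)\<^sup>2" using y x3 by simp
  finally show False by (simp add: power_mult_distrib)
qed

text \<open>Subtracting the multiple of \<open>y\<close> with the same third coordinate leaves a
  null vector of third coordinate 0, which must vanish.\<close>

lemma null_orthogonal_parallel:
  assumes "lorentz x x = 0" "lorentz y y = 0" "lorentz x y = 0" "y \<noteq> 0"
  obtains r where "x = r *\<^sub>R y"
proof -
  have y3: "y$3 \<noteq> 0" using assms null_nonzero by blast
  define d where "d = x - (x$3 / y$3) *\<^sub>R y"
  have "lorentz d d = 0"
    unfolding d_def using assms by (simp add: lorentz_bilinear lorentz_commute[of y x])
  moreover have "d$3 = 0" using y3 by (simp add: d_def)
  ultimately have "d = 0" using null_nonzero by blast
  then show thesis using that by (simp add: d_def)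
qed

text \<open>An isometry multiplies B of two eigenvectors by the product of their eigenvalues, so B
  vanishes unless that product is 1. Only B(f,f) and B(e,k) survive, and pairing with the frame
  reads off coefficients.\<close>

lemma eigen_frame:
  assumes h: "h \<in> lorentz_isometries" and a: "0 < a" "a < 1"
    and e: "h *v e = a *\<^sub>R e" "e \<noteq> 0"
    and k: "h *v k = (1 / a) *\<^sub>R k" "k \<noteq> 0"
    and f: "h *v f = f" "f \<noteq> 0"
  shows "lorentz e e = 0" "lorentz k k = 0" "lorentz f e = 0" "lorentz f k = 0"
    "lorentz e k \<noteq> 0" "lorentz f f > 0"
    "\<And>\<alpha> \<beta> \<gamma>. \<alpha> *\<^sub>R f + \<beta> *\<^sub>R e + \<gamma> *\<^sub>R k = 0 \<Longrightarrow> \<alpha> = 0 \<and> \<beta> = 0 \<and> \<gamma> = 0"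
proof -
  have a': "1 / a > 1" "a * a < 1" using a mult_strict_mono'[of a 1 a 1] by simp_all
  have "lorentz e e = a * a * lorentz e e"
    using lorentz_isometry[OF h, of e e] by (simp add: e lorentz_bilinear)
  then show ee: "lorentz e e = 0" using a' by simp
  have "lorentz k k = 1 / a * (1 / a) * lorentz k k"
    using lorentz_isometry[OF h, of k k] by (simp add: k lorentz_bilinear)
  then show kk: "lorentz k k = 0" using a a' by (auto simp: field_simps)
  have "lorentz f e = a * lorentz f e"
    using lorentz_isometry[OF h, of f e] by (simp add: e f lorentz_bilinear)
  then show fe: "lorentz f e = 0" using a' a by simp
  have "lorentz f k = 1 / a * lorentz f k"
    using lorentz_isometry[OF h, of f k] by (simp add: k f lorentz_bilinear)
  then show fk: "lorentz f k = 0" using a' by (metis less_irrefl mult_cancel_right1)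
  show ek: "lorentz e k \<noteq> 0"
  proof
    assume "lorentz e k = 0"
    then obtain r where r: "e = r *\<^sub>R k" using null_orthogonal_parallel ee kk k by blast
    then have "a *\<^sub>R e = (1 / a) *\<^sub>R e" using e k by (metis matrix_vector_mult_scaleR scaleR_left_commute)
    then show False using e a a' by simp
  qed
  \<comment> \<open>\<open>y\<close> is chosen with B(y,y) = -2 and B(f,y) = 0, which forces
    \<open>f\<close> to be spacelike.\<close>
  define y where "y = e - (1 / lorentz e k) *\<^sub>R k"
  have "lorentz y y < 0" "lorentz f y = 0"
    unfolding y_def using ek by (simp_all add: lorentz_bilinear ee kk fe fk lorentz_commute[of k e])
  then show ff: "lorentz f f > 0" using spacelike_if_orthogonal_timelike f by blast
  fix \<alpha> \<beta> \<gamma> assume z: "\<alpha> *\<^sub>R f + \<beta> *\<^sub>R e + \<gamma> *\<^sub>R k = 0"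
  have "lorentz (\<alpha> *\<^sub>R f + \<beta> *\<^sub>R e + \<gamma> *\<^sub>R k) x = 0" for x unfolding z by (simp add: lorentz_bilinear)
  from this[of f] this[of k] this[of e] show "\<alpha> = 0 \<and> \<beta> = 0 \<and> \<gamma> = 0"
    using ff ek fe fk ee kk by (simp add: lorentz_bilinear lorentz_commute[of k e] lorentz_commute[of k f] lorentz_commute[of e f])
qed

lemma future_null_normalize:
  assumes "lorentz x x = 0" "x \<noteq> 0"
  obtains r where "r \<noteq> 0" "future_null (r *\<^sub>R x)" "norm (r *\<^sub>R x) = 1"
proof -
  have "x$3 \<noteq> 0" using null_nonzero assms by blast
  then consider "x$3 > 0" | "x$3 < 0" by linarith
  then show thesis
  proof cases
    case 1
    show thesis
      by (rule that[of "1 / norm x"]) (use 1 assms in \<open>auto simp: future_null_def lorentz_bilinear\<close>)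
  next
    case 2
    show thesis
      by (rule that[of "- 1 / norm x"])
        (use 2 assms in \<open>auto simp: future_null_def lorentz_bilinear divide_neg_pos\<close>)
  qed
qed

lemma future_null_parallel_unique:
  assumes "future_null x" "norm x = 1" "future_null y" "norm y = 1" "x = r *\<^sub>R y"
  shows "x = y"
proof -
  have "r * y$3 > 0" "y$3 > 0" using assms by (auto simp: future_null_def)
  then have "r > 0" using zero_less_mult_pos2 by blast
  then show ?thesis using assms by simp
qed

text \<open>At most one of the factors \<open>1 - \<mu>\<close>, \<open>a - \<mu>\<close>,
  \<open>1 / a - \<mu>\<close> vanishes. The cases refer to the position of \<mu> relative to 1
  because \<open>X_minus\<close> and \<open>X_plus\<close> are described without naming
  \<open>a\<close>.\<close>

lemma eigenvector_cases:
  assumes h: "h \<in> lorentz_isometries" and a: "0 < a" "a < 1"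
    and e: "h *v e = a *\<^sub>R e" "e \<noteq> 0"
    and k: "h *v k = (1 / a) *\<^sub>R k" "k \<noteq> 0"
    and f: "h *v f = f" "f \<noteq> 0"
    and x: "h *v x = \<mu> *\<^sub>R x"
  shows "\<mu> < 1 \<Longrightarrow> \<exists>r. x = r *\<^sub>R e" "\<mu> > 1 \<Longrightarrow> \<exists>r. x = r *\<^sub>R k" "\<mu> = 1 \<Longrightarrow> \<exists>r. x = r *\<^sub>R f"
proof -
  note fr = eigen_frame[OF h a e k f]
  obtain \<alpha> \<beta> \<gamma> where w: "x = \<alpha> *\<^sub>R f + \<beta> *\<^sub>R e + \<gamma> *\<^sub>R k"
    using independent_spans fr(7) by blast
  have "h *v x - \<mu> *\<^sub>R x = ((1 - \<mu>) * \<alpha>) *\<^sub>R f + ((a - \<mu>) * \<beta>) *\<^sub>R e + ((1 / a - \<mu>) * \<gamma>) *\<^sub>R k"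
    unfolding w by (simp add: matvec e f k algebra_simps)
  then have "(1 - \<mu>) * \<alpha> = 0 \<and> (a - \<mu>) * \<beta> = 0 \<and> (1 / a - \<mu>) * \<gamma> = 0"
    using x fr(7)[of "(1 - \<mu>) * \<alpha>" "(a - \<mu>) * \<beta>" "(1 / a - \<mu>) * \<gamma>"] by simp
  moreover have "1 / a > 1" using a by simp
  ultimately show "\<mu> < 1 \<Longrightarrow> \<exists>r. x = r *\<^sub>R e" "\<mu> > 1 \<Longrightarrow> \<exists>r. x = r *\<^sub>R k" "\<mu> = 1 \<Longrightarrow> \<exists>r. x = r *\<^sub>R f"
    using w a by auto
qed

lemma det_rows_nonzero:
  fixes p q r :: vec3
  assumes "\<And>\<alpha> \<beta> \<gamma>. \<alpha> *\<^sub>R p + \<beta> *\<^sub>R q + \<gamma> *\<^sub>R r = 0 \<Longrightarrow> \<alpha> = 0 \<and> \<beta> = 0 \<and> \<gamma> = 0"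
  shows "det (vector [p, q, r] :: mat3) \<noteq> 0"
proof -
  let ?A = "vector [p, q, r] :: mat3"
  have "row 1 ?A = p" "row 2 ?A = q" "row 3 ?A = r" by (simp_all add: row_def vec_eq_iff)
  then have "\<forall>d. sum (\<lambda>i. d i *s row i ?A) UNIV = 0 \<longrightarrow> (\<forall>i. d i = 0)"
    using assms by (simp add: sum_3 forall_3 scalar_mult_eq_scaleR)
  then have "\<exists>B. ?A ** B = mat 1" unfolding matrix_right_invertible_independent_rows .
  then show ?thesis by (metis invertible_det_nz invertible_right_inverse)
qed

lemma det_rows_neg:
  fixes p q r :: vec3
  shows "det (vector [- p, q, r] :: mat3) = - det (vector [p, q, r] :: mat3)"
  by (simp add: det_3 algebra_simps)

lemma det_rows_swap:
  fixes p q r :: vec3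
  shows "det (vector [- p, r, q] :: mat3) = det (vector [p, q, r] :: mat3)"
  by (simp add: det_3 algebra_simps)

lemma hyperbolic_isometry: "hyperbolic h \<Longrightarrow> h \<in> lorentz_isometries"
  by (simp add: hyperbolic_def SOo21_isometry)

text \<open>Shows that the three definite descriptions denote: arbitrary eigenvectors are rescaled,
  and uniqueness holds because the eigenlines are one-dimensional. The uniqueness clause for
  \<open>X_zero\<close> is kept for comparing the frames of an element and its inverse.\<close>

lemma null_frame:
  assumes "hyperbolic h"
  obtains a where "0 < a" "a < 1" "h *v X_minus h = a *\<^sub>R X_minus h" "h *v X_plus h = (1 / a) *\<^sub>R X_plus h"
    "X_minus h \<noteq> 0" "X_plus h \<noteq> 0" "h *v X_zero h = X_zero h" "lorentz (X_zero h) (X_zero h) = 1"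
    "\<And>x. lorentz x x = 1 \<Longrightarrow> h *v x = x \<Longrightarrow> det (vector [x, X_minus h, X_plus h] :: mat3) > 0 \<Longrightarrow> x = X_zero h"
    "det (vector [X_zero h, X_minus h, X_plus h] :: mat3) > 0"
proof -
  obtain a e f k where a: "0 < a" "a < 1" and e: "h *v e = a *\<^sub>R e" "e \<noteq> 0"
    and f: "h *v f = f" "f \<noteq> 0" and k: "h *v k = (1 / a) *\<^sub>R k" "k \<noteq> 0"
    using assms unfolding hyperbolic_def eigenval_def by auto
  have h: "h \<in> lorentz_isometries" using assms by (rule hyperbolic_isometry)
  note fr = eigen_frame[OF h a e k f] and ev = eigenvector_cases[OF h a e k f]
  obtain r where r: "r \<noteq> 0" "future_null (r *\<^sub>R e)" "norm (r *\<^sub>R e) = 1"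
    using future_null_normalize fr(1) e(2) by blast
  obtain s where s: "s \<noteq> 0" "future_null (s *\<^sub>R k)" "norm (s *\<^sub>R k) = 1"
    using future_null_normalize fr(2) k(2) by blast
  have m: "X_minus h = r *\<^sub>R e"
    unfolding X_minus_def
  proof (rule the_equality)
    show "future_null (r *\<^sub>R e) \<and> norm (r *\<^sub>R e) = 1 \<and> (\<exists>a>0. a < 1 \<and> h *v r *\<^sub>R e = a *\<^sub>R r *\<^sub>R e)"
      using r a e by (auto simp: matvec intro!: exI[of _ a])
  next
    fix x assume x: "future_null x \<and> norm x = 1 \<and> (\<exists>a>0. a < 1 \<and> h *v x = a *\<^sub>R x)"
    then obtain \<rho> where "x = \<rho> *\<^sub>R e" using ev(1) by blast
    then have "x = (\<rho> / r) *\<^sub>R (r *\<^sub>R e)" using r by simp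
    then show "x = r *\<^sub>R e" using x r future_null_parallel_unique by blast
  qed
  have p: "X_plus h = s *\<^sub>R k"
    unfolding X_plus_def
  proof (rule the_equality)
    show "future_null (s *\<^sub>R k) \<and> norm (s *\<^sub>R k) = 1 \<and> (\<exists>a>1. h *v s *\<^sub>R k = a *\<^sub>R s *\<^sub>R k)"
      using s a k by (auto simp: matvec intro!: exI[of _ "1 / a"])
  next
    fix x assume x: "future_null x \<and> norm x = 1 \<and> (\<exists>a>1. h *v x = a *\<^sub>R x)"
    then obtain \<rho> where "x = \<rho> *\<^sub>R k" using ev(2) by blast
    then have "x = (\<rho> / s) *\<^sub>R (s *\<^sub>R k)" using s by simp
    then show "x = s *\<^sub>R k" using x s future_null_parallel_unique by blast
  qed
  have me: "h *v X_minus h = a *\<^sub>R X_minus h" "X_minus h \<noteq> 0" using m r e by (auto simp: matvec)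
  have pe: "h *v X_plus h = (1 / a) *\<^sub>R X_plus h" "X_plus h \<noteq> 0" using p s k by (auto simp: matvec)
  let ?d = "\<lambda>x. det (vector [x, X_minus h, X_plus h] :: mat3)"
  define f1 where "f1 = (1 / sqrt (lorentz f f)) *\<^sub>R f"
  have f1: "lorentz f1 f1 = 1" "h *v f1 = f1" "f1 \<noteq> 0"
    using fr(6) f by (auto simp: f1_def lorentz_bilinear matvec)
  have d1: "?d f1 \<noteq> 0"
    using eigen_frame(7)[OF h a me pe f1(2,3)] by (rule det_rows_nonzero)
  define f2 where "f2 = (if ?d f1 > 0 then f1 else - f1)"
  have f2: "lorentz f2 f2 = 1" "h *v f2 = f2" "f2 \<noteq> 0" "?d f2 > 0"
    using f1 d1 by (auto simp: f2_def lorentz_bilinear matvec_neg det_rows_neg)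
  have uniq: "x = f2" if x: "lorentz x x = 1" "h *v x = x" "?d x > 0" for x
  proof -
    obtain \<rho> where \<rho>: "x = \<rho> *\<^sub>R f2"
      using eigenvector_cases(3)[OF h a me pe f2(2,3), of x 1] x by auto
    have "\<rho> * \<rho> = 1" using x f2 \<rho> by (simp add: lorentz_bilinear)
    then have "\<rho> = 1 \<or> \<rho> = -1" by (simp add: square_eq_1_iff)
    then show ?thesis using \<rho> x f2 det_rows_neg[of f2] by auto
  qed
  have z: "X_zero h = f2"
    unfolding X_zero_def
  proof (rule the_equality)
    show "lorentz f2 f2 = 1 \<and> h *v f2 = f2 \<and> ?d f2 > 0" using f2 by blast
  qed (use uniq in blast)
  show thesis
    using that[OF a me(1) pe(1) me(2) pe(2)] f2 uniq unfolding z by blast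
qed

lemma hyperbolic_X_zero:
  assumes "hyperbolic h"
  shows "h *v X_zero h = X_zero h" "lorentz (X_zero h) (X_zero h) = 1" "X_zero h \<noteq> 0"
    "lorentz (X_zero h) (X_minus h) = 0" "lorentz (X_zero h) (X_plus h) = 0"
proof -
  obtain a where fr: "0 < a" "a < 1" "h *v X_minus h = a *\<^sub>R X_minus h" "h *v X_plus h = (1 / a) *\<^sub>R X_plus h"
    "X_minus h \<noteq> 0" "X_plus h \<noteq> 0" "h *v X_zero h = X_zero h" "lorentz (X_zero h) (X_zero h) = 1"
    using null_frame[OF assms] by metis
  then show 1: "h *v X_zero h = X_zero h" "lorentz (X_zero h) (X_zero h) = 1" "X_zero h \<noteq> 0"
    by (auto simp: lorentz_bilinear)
  show "lorentz (X_zero h) (X_minus h) = 0" "lorentz (X_zero h) (X_plus h) = 0"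
    using eigen_frame[OF hyperbolic_isometry[OF assms] fr(1,2,3,5,4,6,7) 1(3)] by auto
qed

lemma hyperbolic_fixed:
  assumes "hyperbolic h" "h *v x = x"
  obtains r where "x = r *\<^sub>R X_zero h"
proof -
  obtain a where fr: "0 < a" "a < 1" "h *v X_minus h = a *\<^sub>R X_minus h" "h *v X_plus h = (1 / a) *\<^sub>R X_plus h"
    "X_minus h \<noteq> 0" "X_plus h \<noteq> 0" "h *v X_zero h = X_zero h"
    using null_frame[OF assms(1)] by metis
  show thesis
    using that eigenvector_cases(3)[OF hyperbolic_isometry[OF assms(1)] fr(1,2,3,5,4,6,7), of x 1]
      assms hyperbolic_X_zero by auto
qed

text \<open>\<open>h\<close> preserves B and fixes its axis vector X, so B(hv, X) = B(hv, hX) = B(v,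
  X). This makes the Margulis invariant a function of the cohomology class.\<close>

lemma lorentz_coboundary:
  assumes "hyperbolic h"
  shows "lorentz (v - h *v v) (X_zero h) = 0"
  using lorentz_isometry[OF hyperbolic_isometry[OF assms], of v "X_zero h"]
  by (simp add: lorentz_bilinear hyperbolic_X_zero assms)

text \<open>The complement of the axis vector is spanned by the null eigenvectors, on which 1 - h
  acts by the nonzero factors 1 - a and 1 - 1/a and can be inverted.\<close>

lemma orthogonal_X_zero_coboundary:
  assumes h: "hyperbolic h" and w: "lorentz w (X_zero h) = 0"
  obtains v where "w = v - h *v v"
proof -
  obtain a where fr: "0 < a" "a < 1" "h *v X_minus h = a *\<^sub>R X_minus h" "h *v X_plus h = (1 / a) *\<^sub>R X_plus h"
    "X_minus h \<noteq> 0" "X_plus h \<noteq> 0" "h *v X_zero h = X_zero h"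
    using null_frame[OF h] by metis
  note X = hyperbolic_X_zero[OF h]
  obtain \<alpha> \<beta> \<gamma> where \<alpha>: "w = \<alpha> *\<^sub>R X_zero h + \<beta> *\<^sub>R X_minus h + \<gamma> *\<^sub>R X_plus h"
    using independent_spans eigen_frame(7)[OF hyperbolic_isometry[OF h] fr(1,2,3,5,4,6,7) X(3)] by blast
  have "\<alpha> = 0"
    using w X unfolding \<alpha> by (simp add: lorentz_bilinear lorentz_commute[of "X_minus h" "X_zero h"] lorentz_commute[of "X_plus h" "X_zero h"])
  define \<beta>' where "\<beta>' = \<beta> / (1 - a)"
  define \<gamma>' where "\<gamma>' = \<gamma> / (1 - 1 / a)"
  have "1 / a > 1" using fr by simp
  then have c: "\<beta>' - \<beta>' * a = \<beta>" "\<gamma>' - \<gamma>' * (1 / a) = \<gamma>"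
    using fr right_diff_distrib[of \<beta>' 1 a] right_diff_distrib[of \<gamma>' 1 "1 / a"]
    by (simp_all add: \<beta>'_def \<gamma>'_def)
  let ?v = "\<beta>' *\<^sub>R X_minus h + \<gamma>' *\<^sub>R X_plus h"
  have "?v - h *v ?v = (\<beta>' - \<beta>' * a) *\<^sub>R X_minus h + (\<gamma>' - \<gamma>' * (1 / a)) *\<^sub>R X_plus h"
    by (simp only: matvec fr scaleR_scaleR scaleR_diff_left) simp
  then have "w = ?v - h *v ?v" unfolding c \<alpha> \<open>\<alpha> = 0\<close> by simp
  then show thesis using that by blast
qed

text \<open>Inversion exchanges the attracting and repelling lines. Swapping two rows reverses the
  sign of the determinant that orients the axis vector.\<close>

lemma X_zero_inverse:
  assumes h: "hyperbolic h" and k: "hyperbolic k" and hk: "k ** h = mat 1"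
  shows "X_zero k = - X_zero h"
proof -
  obtain a where fr: "0 < a" "a < 1" "h *v X_minus h = a *\<^sub>R X_minus h" "h *v X_plus h = (1 / a) *\<^sub>R X_plus h"
    "X_minus h \<noteq> 0" "X_plus h \<noteq> 0" "h *v X_zero h = X_zero h" "lorentz (X_zero h) (X_zero h) = 1"
    "det (vector [X_zero h, X_minus h, X_plus h] :: mat3) > 0"
    using null_frame[OF h] by metis
  have 1: "k *v (h *v x) = x" for x using hk by (simp add: matrix_vector_mul_assoc)
  have "h ** k = mat 1" using hk matrix_left_right_inverse by blast
  then have 2: "h *v (k *v x) = x" for x by (simp add: matrix_vector_mul_assoc)
  have to_h: "h *v x = (1 / r) *\<^sub>R x" if "r \<noteq> 0" "k *v x = r *\<^sub>R x" for x r
  proof -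
    have "x = r *\<^sub>R (h *v x)" using 2[of x] that(2) by (simp add: matvec)
    then have "(1 / r) *\<^sub>R x = (1 / r) *\<^sub>R r *\<^sub>R (h *v x)" by simp
    then show ?thesis using that by simp
  qed
  have to_k: "k *v x = (1 / r) *\<^sub>R x" if "r \<noteq> 0" "h *v x = r *\<^sub>R x" for x r
  proof -
    have "x = r *\<^sub>R (k *v x)" using 1[of x] that(2) by (simp add: matvec)
    then have "(1 / r) *\<^sub>R x = (1 / r) *\<^sub>R r *\<^sub>R (k *v x)" by simp
    then show ?thesis using that by simp
  qed
  have "(\<exists>a>0. a < 1 \<and> k *v x = a *\<^sub>R x) \<longleftrightarrow> (\<exists>a>1. h *v x = a *\<^sub>R x)" for x
  proof
    assume "\<exists>a>0. a < 1 \<and> k *v x = a *\<^sub>R x"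
    then obtain a where "0 < a" "a < 1" "k *v x = a *\<^sub>R x" by blast
    then show "\<exists>a>1. h *v x = a *\<^sub>R x" using to_h[of a x] by (intro exI[of _ "1 / a"]) simp
  next
    assume "\<exists>a>1. h *v x = a *\<^sub>R x"
    then obtain a where "1 < a" "h *v x = a *\<^sub>R x" by blast
    then show "\<exists>a>0. a < 1 \<and> k *v x = a *\<^sub>R x" using to_k[of a x] by (intro exI[of _ "1 / a"]) simp
  qed
  then have m: "X_minus k = X_plus h" by (simp add: X_minus_def X_plus_def)
  have "(\<exists>a>1. k *v x = a *\<^sub>R x) \<longleftrightarrow> (\<exists>a>0. a < 1 \<and> h *v x = a *\<^sub>R x)" for x
  proof
    assume "\<exists>a>1. k *v x = a *\<^sub>R x"
    then obtain a where "1 < a" "k *v x = a *\<^sub>R x" by blast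
    then show "\<exists>a>0. a < 1 \<and> h *v x = a *\<^sub>R x" using to_h[of a x] by (intro exI[of _ "1 / a"]) simp
  next
    assume "\<exists>a>0. a < 1 \<and> h *v x = a *\<^sub>R x"
    then obtain a where "0 < a" "a < 1" "h *v x = a *\<^sub>R x" by blast
    then show "\<exists>a>1. k *v x = a *\<^sub>R x" using to_k[of a x] by (intro exI[of _ "1 / a"]) simp
  qed
  then have p: "X_plus k = X_minus h" by (simp add: X_minus_def X_plus_def)
  have kX: "k *v X_zero h = X_zero h" using to_k[of 1 "X_zero h"] fr by simp
  have "- X_zero h = X_zero k"
  proof (rule null_frame[OF k])
    assume "\<And>x. lorentz x x = 1 \<Longrightarrow> k *v x = x \<Longrightarrow> det (vector [x, X_minus k, X_plus k] :: mat3) > 0 \<Longrightarrow> x = X_zero k"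
    then show ?thesis unfolding m p
      using fr kX by (simp add: lorentz_bilinear matvec_neg det_rows_swap)
  qed
  then show ?thesis by simp
qed

text \<open>Two hyperbolic elements fixing the same spacelike vector share their null lines, hence are
  diagonal in a common basis.\<close>

lemma hyperbolic_common_axis_commute:
  assumes h: "hyperbolic h" and k: "hyperbolic k" and fix0: "k *v X_zero h = X_zero h"
  shows "h ** k = k ** h"
proof -
  obtain a where fr: "0 < a" "a < 1" "h *v X_minus h = a *\<^sub>R X_minus h" "h *v X_plus h = (1 / a) *\<^sub>R X_plus h"
    "X_minus h \<noteq> 0" "X_plus h \<noteq> 0" "h *v X_zero h = X_zero h"
    using null_frame[OF h] by metis
  note X = hyperbolic_X_zero[OF h] and K = hyperbolic_isometry[OF k]
  note ef = eigen_frame[OF hyperbolic_isometry[OF h] fr(1,2,3,5,4,6,7) X(3)]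
  \<comment> \<open>Such a vector is
    \<open>\<beta> *\<^sub>R X_minus h + \<gamma> *\<^sub>R X_plus h\<close>, and B(x,x) is 2
    \<beta> \<gamma> times a nonzero number, so one coefficient vanishes.\<close>
  have null: "\<exists>r. x = r *\<^sub>R X_minus h \<or> x = r *\<^sub>R X_plus h"
    if x: "lorentz x x = 0" "lorentz (X_zero h) x = 0" for x
  proof -
    obtain \<alpha> \<beta> \<gamma> where \<alpha>: "x = \<alpha> *\<^sub>R X_zero h + \<beta> *\<^sub>R X_minus h + \<gamma> *\<^sub>R X_plus h"
      using independent_spans ef(7) by blast
    have "\<alpha> = 0" using x(2) X unfolding \<alpha> by (simp add: lorentz_bilinear)
    then have "2 * \<beta> * \<gamma> * lorentz (X_minus h) (X_plus h) = 0"
      using x(1) ef(1-4) unfolding \<alpha>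
      by (simp add: lorentz_bilinear lorentz_commute[of "X_plus h" "X_minus h"])
    then have "\<beta> = 0 \<or> \<gamma> = 0" using ef by simp
    then show ?thesis using \<alpha> \<open>\<alpha> = 0\<close> by auto
  qed
  obtain a' where fk: "0 < a'" "a' < 1" "k *v X_minus k = a' *\<^sub>R X_minus k" "k *v X_plus k = (1 / a') *\<^sub>R X_plus k"
    "X_minus k \<noteq> 0" "X_plus k \<noteq> 0" "k *v X_zero k = X_zero k"
    using null_frame[OF k] by metis
  note ek = eigen_frame[OF K fk(1,2,3,5,4,6,7) hyperbolic_X_zero(3)[OF k]]
  obtain r where r: "X_zero h = r *\<^sub>R X_zero k" using hyperbolic_fixed[OF k fix0] by blast
  \<comment> \<open>\<open>X_zero h\<close> is a multiple of \<open>X_zero k\<close>, hence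
    orthogonal to the null eigenvectors of \<open>k\<close>. These lie on the null lines of
    \<open>h\<close> and are eigenvectors of both.\<close>
  have comm: "h *v (k *v x) = k *v (h *v x)" if "x \<in> {X_zero k, X_minus k, X_plus k}" for x
  proof -
    have "\<exists>\<mu>. k *v x = \<mu> *\<^sub>R x"
      using that
    proof (elim insertE emptyE)
      assume "x = X_zero k"
      then show ?thesis using hyperbolic_X_zero(1)[OF k] by (intro exI[of _ 1]) simp
    qed (use fk(3,4) in blast)+
    then obtain \<mu> where \<mu>: "k *v x = \<mu> *\<^sub>R x" by blast
    have "\<exists>\<nu>. h *v x = \<nu> *\<^sub>R x"
    proof (cases "x = X_zero k")
      case True
      have "r \<noteq> 0" using r X by auto
      then have "x = (1 / r) *\<^sub>R X_zero h" using r True by simp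
      then show ?thesis using X by (metis matrix_vector_mult_scaleR scaleR_one)
    next
      case False
      then have "lorentz x x = 0" "lorentz (X_zero h) x = 0"
        using that ek hyperbolic_X_zero[OF k] by (auto simp: r lorentz_bilinear)
      then obtain s where "x = s *\<^sub>R X_minus h \<or> x = s *\<^sub>R X_plus h" using null by blast
      then show ?thesis using fr by (metis matrix_vector_mult_scaleR scaleR_left_commute)
    qed
    then show ?thesis using \<mu> by (auto simp: matvec)
  qed
  have "(h ** k) *v w = (k ** h) *v w" for w
  proof -
    obtain \<alpha> \<beta> \<gamma> where \<alpha>: "w = \<alpha> *\<^sub>R X_zero k + \<beta> *\<^sub>R X_minus k + \<gamma> *\<^sub>R X_plus k"
      using independent_spans ek(7) by blast
    show ?thesis unfolding \<alpha> by (simp add: matvec comm flip: matrix_vector_mul_assoc)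
  qed
  then show ?thesis using matrix_eq by blast
qed

lemma noncommuting_common_fixed:
  assumes "hyperbolic h" "hyperbolic k" "h ** k \<noteq> k ** h" "h *v x = x" "k *v x = x"
  shows "x = 0"
proof (rule ccontr)
  assume "x \<noteq> 0"
  obtain r where r: "x = r *\<^sub>R X_zero h" using hyperbolic_fixed assms by blast
  then have "X_zero h = (1 / r) *\<^sub>R x" using \<open>x \<noteq> 0\<close> by auto
  then have "k *v X_zero h = X_zero h" using assms(5) by (metis matrix_vector_mult_scaleR)
  then show False using hyperbolic_common_axis_commute assms by blast
qed

lemma noncommuting_X_zero_independent:
  assumes "hyperbolic h" "hyperbolic k" "h ** k \<noteq> k ** h" "\<alpha> *\<^sub>R X_zero h + \<beta> *\<^sub>R X_zero k = 0"
  shows "\<alpha> = 0 \<and> \<beta> = 0"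
proof -
  have "\<alpha> *\<^sub>R X_zero h = (- \<beta>) *\<^sub>R X_zero k" using assms(4) by (simp add: add_eq_0_iff2)
  then have "k *v (\<alpha> *\<^sub>R X_zero h) = \<alpha> *\<^sub>R X_zero h" "h *v (\<alpha> *\<^sub>R X_zero h) = \<alpha> *\<^sub>R X_zero h"
    using assms hyperbolic_X_zero by (metis matrix_vector_mult_scaleR)+
  then have "\<alpha> *\<^sub>R X_zero h = 0" using noncommuting_common_fixed assms by blast
  then show ?thesis using assms hyperbolic_X_zero by auto
qed

text \<open>\<open>p\<close>, \<open>q\<close> and \<open>z\<close> form a basis on which \<phi>
  reads off the coefficient of \<open>z\<close> up to a nonzero factor, so the kernel is the plane
  of \<open>p\<close> and \<open>q\<close>.\<close>

lemma linear_functional_kernel: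
  fixes p q w :: vec3 and \<phi> :: "vec3 \<Rightarrow> real"
  assumes ind: "\<And>\<alpha> \<beta>. \<alpha> *\<^sub>R p + \<beta> *\<^sub>R q = 0 \<Longrightarrow> \<alpha> = 0 \<and> \<beta> = 0"
    and \<phi>: "linear \<phi>" "\<phi> z \<noteq> 0" "\<phi> p = 0" "\<phi> q = 0" "\<phi> w = 0"
  obtains \<alpha> \<beta> where "w = \<alpha> *\<^sub>R p + \<beta> *\<^sub>R q"
proof -
  have lin: "\<phi> (\<alpha> *\<^sub>R p + \<beta> *\<^sub>R q + \<gamma> *\<^sub>R z) = \<gamma> * \<phi> z" for \<alpha> \<beta> \<gamma>
    by (simp add: linear_add[OF \<phi>(1)] linear_scale[OF \<phi>(1)] \<phi>)
  have "\<alpha> = 0 \<and> \<beta> = 0 \<and> \<gamma> = 0" if "\<alpha> *\<^sub>R p + \<beta> *\<^sub>R q + \<gamma> *\<^sub>R z = 0" for \<alpha> \<beta> \<gamma>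
  proof -
    have "\<gamma> = 0" using lin[of \<alpha> \<beta> \<gamma>] that \<phi> linear_0[OF \<phi>(1)] by simp
    then show ?thesis using ind[of \<alpha> \<beta>] that by simp
  qed
  then obtain \<alpha> \<beta> \<gamma> where w: "w = \<alpha> *\<^sub>R p + \<beta> *\<^sub>R q + \<gamma> *\<^sub>R z" using independent_spans by blast
  then have "\<gamma> = 0" using lin[of \<alpha> \<beta> \<gamma>] \<phi> by simp
  then show thesis using w that by simp
qed

text \<open>If the pair of functionals were not onto R^2, a vector normal to its image would give a
  nontrivial combination of \<open>p\<close> and \<open>q\<close> that is B-orthogonal to
  everything.\<close>

lemma independent_functionals:
  fixes p q :: vec3
  assumes "\<And>\<alpha> \<beta>. \<alpha> *\<^sub>R p + \<beta> *\<^sub>R q = 0 \<Longrightarrow> \<alpha> = 0 \<and> \<beta> = 0"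
  obtains w where "lorentz w p = s" "lorentz w q = t"
proof -
  let ?f = "\<lambda>w. (lorentz w p, lorentz w q)"
  have lin: "linear ?f" by (simp add: linear_iff lorentz_bilinear)
  have "range ?f = UNIV"
  proof (rule ccontr)
    assume "range ?f \<noteq> UNIV"
    moreover have "subspace (range ?f)" using lin linear_subspace_image subspace_UNIV by blast
    ultimately have "span (range ?f) \<noteq> UNIV" using span_eq_iff by metis
    then obtain z where z: "z \<noteq> 0" "\<forall>y\<in>span (range ?f). z \<bullet> y = 0"
      using span_not_univ_subset_hyperplane[of "range ?f"] by blast
    have "lorentz (fst z *\<^sub>R p + snd z *\<^sub>R q) w = 0" for w
    proof -
      have "z \<bullet> ?f w = 0" using z(2) span_base[of "?f w" "range ?f"] by blast
      then show ?thesis by (simp add: inner_prod_def lorentz_bilinear lorentz_commute[of w])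
    qed
    then have "fst z *\<^sub>R p + snd z *\<^sub>R q = 0" by (rule lorentz_nondegenerate)
    then show False using assms z(1) by (metis prod.collapse zero_prod_def)
  qed
  then have "(s, t) \<in> range ?f" by simp
  then show thesis using that by auto
qed

section \<open>Cocycles on pairs of pants and once-holed tori\<close>

text \<open>If \<open>y\<close> fixes the axis vector of \<open>x ** y\<close>, so does
  \<open>x\<close>; then \<open>x\<close> commutes with \<open>x ** y\<close>, and cancelling
  \<open>x\<close> contradicts noncommutativity.\<close>

lemma noncommuting_pants:
  assumes "hyperbolic x" "hyperbolic y" "hyperbolic (x ** y)" "x ** y \<noteq> y ** x"
  shows "x *v X_zero (x ** y) \<noteq> X_zero (x ** y)" "y *v X_zero (x ** y) \<noteq> X_zero (x ** y)"
proof -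
  have inj: "A = B" if "h ** A = h ** B" "hyperbolic h" for h A B :: mat3
  proof -
    have "A *v v = B *v v" for v
    proof -
      have "h *v (A *v v) = h *v (B *v v)" using that by (simp add: matrix_vector_mul_assoc)
      then have "h *v (A *v v - B *v v) = 0" by (simp add: matvec)
      then show ?thesis using lorentz_isometry_kernel[OF hyperbolic_isometry[OF that(2)]] by force
    qed
    then show ?thesis using matrix_eq by blast
  qed
  show "x *v X_zero (x ** y) \<noteq> X_zero (x ** y)"
  proof
    assume "x *v X_zero (x ** y) = X_zero (x ** y)"
    then have "(x ** y) ** x = x ** (x ** y)" using hyperbolic_common_axis_commute assms by blast
    then show False using assms inj by (metis matrix_mul_assoc)
  qed
  show "y *v X_zero (x ** y) \<noteq> X_zero (x ** y)"
  proof
    assume y: "y *v X_zero (x ** y) = X_zero (x ** y)"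
    then have "x *v X_zero (x ** y) = X_zero (x ** y)"
      using hyperbolic_X_zero(1)[OF assms(3)] by (metis matrix_vector_mul_assoc)
    then have "(x ** y) ** x = x ** (x ** y)" using hyperbolic_common_axis_commute assms by blast
    then show False using assms inj by (metis matrix_mul_assoc)
  qed
qed

text \<open>Writing \<open>q\<close> and \<open>p\<close> as coboundaries of \<open>v1\<close> and \<open>v2\<close>, the Margulis invariant of the product is
  a nonzero functional of \<open>v2 - v1\<close> that vanishes on the two fixed vectors.\<close>

lemma pants_rigid:
  assumes x: "hyperbolic x" and y: "hyperbolic y" and xy: "hyperbolic (x ** y)" and nc: "x ** y \<noteq> y ** x"
    and q: "lorentz q (X_zero x) = 0" and p: "lorentz p (X_zero y) = 0"
    and qp: "lorentz (q + x *v p) (X_zero (x ** y)) = 0"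
  obtains v where "q = v - x *v v" "p = v - y *v v"
proof -
  obtain v1 where v1: "q = v1 - x *v v1" using orthogonal_X_zero_coboundary x q by blast
  obtain v2 where v2: "p = v2 - y *v v2" using orthogonal_X_zero_coboundary y p by blast
  let ?X = "X_zero (x ** y)"
  define \<phi> where "\<phi> w = lorentz (x *v w - w) ?X" for w
  have lin: "linear \<phi>" by (simp add: linear_iff \<phi>_def lorentz_bilinear matvec algebra_simps)
  have X: "x *v (y *v ?X) = ?X" using hyperbolic_X_zero[OF xy] by (simp add: matrix_vector_mul_assoc)
  \<comment> \<open>The first bracket is a coboundary at the product and contributes nothing to its
    invariant. The second depends on \<open>v2 - v1\<close> only.\<close>
  have "q + x *v p = (v2 - (x ** y) *v v2) + (x *v (v2 - v1) - (v2 - v1))"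
    unfolding v1 v2 by (simp add: matvec algebra_simps matrix_vector_mul_assoc)
  then have w: "\<phi> (v2 - v1) = 0"
    using qp lorentz_coboundary[OF xy, of v2] by (simp add: lorentz_bilinear \<phi>_def matvec)
  have \<phi>x: "\<phi> (X_zero x) = 0" by (simp add: \<phi>_def hyperbolic_X_zero x lorentz_bilinear)
  \<comment> \<open>As \<open>y\<close> fixes its axis vector, \<open>x *v X_zero y\<close> is its
    image under \<open>x ** y\<close>, which preserves B and fixes \<open>?X\<close>.\<close>
  have "lorentz (x *v X_zero y) ?X = lorentz (x *v (y *v X_zero y)) (x *v (y *v ?X))"
    using hyperbolic_X_zero[OF y] X by simp
  then have \<phi>y: "\<phi> (X_zero y) = 0"
    by (simp add: \<phi>_def lorentz_bilinear lorentz_isometry[OF hyperbolic_isometry] x y)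
  have "\<exists>z. \<phi> z \<noteq> 0"
  proof (rule ccontr)
    assume "\<nexists>z. \<phi> z \<noteq> 0"
    \<comment> \<open>Writing B(w, X) as B(xw, xX) turns \<phi> into pairing with X - xX; its
      vanishing would make \<open>x\<close> fix the axis of the product.\<close>
    then have perp: "lorentz (x *v w) (?X - x *v ?X) = 0" for w
      by (simp add: \<phi>_def lorentz_bilinear lorentz_isometry[OF hyperbolic_isometry[OF x]])
    have "inj ((*v) x)"
      unfolding linear_injective_0[OF matrix_vector_mul_linear]
      using lorentz_isometry_kernel[OF hyperbolic_isometry[OF x]] by blast
    then have "surj ((*v) x)"
      using linear_injective_imp_surjective[of "(*v) x"] matrix_vector_mul_linear by blast
    then have "lorentz w (?X - x *v ?X) = 0" for w using perp by (metis surjD)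
    then have "?X - x *v ?X = 0" by (metis lorentz_commute lorentz_nondegenerate)
    then show False using noncommuting_pants(1)[OF x y xy nc] by simp
  qed
  then obtain z where z: "\<phi> z \<noteq> 0" by blast
  obtain \<alpha> \<beta> where ab: "v2 - v1 = \<alpha> *\<^sub>R X_zero x + \<beta> *\<^sub>R X_zero y"
    using linear_functional_kernel[OF noncommuting_X_zero_independent[OF x y nc] lin z \<phi>x \<phi>y w] by blast
  \<comment> \<open>Shifting \<open>v1\<close> along the axis of \<open>x\<close> and
    \<open>v2\<close> along the axis of \<open>y\<close> changes neither coboundary value, and the
    shifted vectors coincide.\<close>
  define v where "v = v1 + \<alpha> *\<^sub>R X_zero x"
  have v': "v = v2 - \<beta> *\<^sub>R X_zero y" using ab by (simp add: v_def algebra_simps)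
  have "q = v - x *v v" unfolding v_def v1 by (simp add: matvec hyperbolic_X_zero x)
  moreover have "p = v - y *v v" unfolding v' v2 by (simp add: matvec hyperbolic_X_zero y)
  ultimately show thesis using that by blast
qed

text \<open>The unknown \<open>p\<close> enters through B(p, X_zero y) and, moving \<open>x\<close>
  across B, through B(p, yX) with X the axis vector of the product. These functionals are
  independent because \<open>y\<close> does not fix X.\<close>

lemma pants_extend:
  assumes x: "hyperbolic x" and y: "hyperbolic y" and xy: "hyperbolic (x ** y)" and nc: "x ** y \<noteq> y ** x"
  obtains p where "lorentz p (X_zero y) = s" "lorentz (q + x *v p) (X_zero (x ** y)) = t"
proof -
  let ?X = "X_zero (x ** y)"
  have X: "x *v (y *v ?X) = ?X" using hyperbolic_X_zero[OF xy] by (simp add: matrix_vector_mul_assoc)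
  have ind: "\<alpha> = 0 \<and> \<beta> = 0" if eq: "\<alpha> *\<^sub>R X_zero y + \<beta> *\<^sub>R (y *v ?X) = 0" for \<alpha> \<beta>
  proof -
    have "\<beta> = 0"
    proof (rule ccontr)
      assume "\<beta> \<noteq> 0"
      have "y *v (\<alpha> *\<^sub>R X_zero y + \<beta> *\<^sub>R ?X) = 0"
        using eq by (simp add: matvec hyperbolic_X_zero y)
      then have "\<alpha> *\<^sub>R X_zero y + \<beta> *\<^sub>R ?X = 0"
        by (rule lorentz_isometry_kernel[OF hyperbolic_isometry[OF y]])
      then have "\<beta> *\<^sub>R ?X = - \<alpha> *\<^sub>R X_zero y" by (simp add: eq_neg_iff_add_eq_0 add.commute)
      then have "y *v (\<beta> *\<^sub>R ?X) = \<beta> *\<^sub>R ?X" by (simp add: matvec matvec_neg hyperbolic_X_zero y)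
      then have "y *v ?X = ?X" using \<open>\<beta> \<noteq> 0\<close> by (simp add: matvec)
      then show False using noncommuting_pants(2)[OF x y xy nc] by simp
    qed
    then show ?thesis using eq hyperbolic_X_zero[OF y] by simp
  qed
  obtain p where p: "lorentz p (X_zero y) = s" "lorentz p (y *v ?X) = t - lorentz q ?X"
    using independent_functionals ind by blast
  have "lorentz (x *v p) ?X = lorentz p (y *v ?X)"
    using lorentz_isometry[OF hyperbolic_isometry[OF x], of p "y *v ?X"] X by simp
  then show thesis using that p by (simp add: lorentz_bilinear)
qed

text \<open>The value of a cocycle on a commutator \<open>x y x' y'\<close>, where \<open>x'\<close> and \<open>y'\<close> are the inverses of \<open>x\<close>
  and \<open>y\<close>, in terms of its values \<open>q\<close> on \<open>x\<close> and \<open>p\<close> on \<open>y\<close>.\<close>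

definition comm_value :: "mat3 \<Rightarrow> mat3 \<Rightarrow> mat3 \<Rightarrow> mat3 \<Rightarrow> vec3 \<Rightarrow> vec3 \<Rightarrow> vec3" where
  "comm_value x y x' y' q p = q + x *v p - x *v (y *v (x' *v q)) - x *v (y *v (x' *v (y' *v p)))"

text \<open>The inverses are parameters tied by equations, so the computations need only
  cancellation. \<open>ncx\<close> serves to exclude that \<open>x\<close> fixes the axis of the
  commutator.\<close>

locale once_holed_torus =
  fixes x y x' y' :: mat3
  assumes x: "hyperbolic x" and y: "hyperbolic y" and hC: "hyperbolic (x ** y ** x' ** y')"
    and inverses: "x ** x' = mat 1" "y ** y' = mat 1"
    and nc: "x ** y \<noteq> y ** x" and ncx: "x ** (x ** y ** x' ** y') \<noteq> (x ** y ** x' ** y') ** x"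
    and angle: "lorentz (X_zero x) (X_zero y) \<noteq> 0"
begin

definition "C = x ** y ** x' ** y'"

text \<open>The change in the Margulis invariant of the commutator when the value on
  \<open>y\<close> is altered by the coboundary of \<open>w\<close> while the value on
  \<open>x\<close> is kept.\<close>

definition "\<phi> w = lorentz (x *v (w - y *v w) - (w - y *v w)) (X_zero C)"

lemma cancel: "x *v (x' *v v) = v" "y *v (y' *v v) = v" "x' *v (x *v v) = v" "y' *v (y *v v) = v"
  using inverses inverses[unfolded matrix_left_right_inverse[of x] matrix_left_right_inverse[of y]]
  by (simp_all add: matrix_vector_mul_assoc)

lemma C_apply: "C *v v = x *v (y *v (x' *v (y' *v v)))"
  by (simp add: C_def matrix_vector_mul_assoc matrix_mul_assoc)

lemma hypC: "hyperbolic C"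
  using hC by (simp add: C_def)

lemma comm_value_add:
  "comm_value x y x' y' (q1 + q2) (p1 + p2) = comm_value x y x' y' q1 p1 + comm_value x y x' y' q2 p2"
  by (simp add: comm_value_def matvec)

lemma comm_value_coboundary: "comm_value x y x' y' (v - x *v v) (v - y *v v) = v - C *v v"
  by (simp add: comm_value_def matvec C_apply cancel)

text \<open>With p = w - yw the commutator value is xp - Cp, which differs from xp - p by a
  coboundary at \<open>C\<close>.\<close>

lemma comm_value_right: "lorentz (comm_value x y x' y' 0 (w - y *v w)) (X_zero C) = \<phi> w"
proof -
  have "comm_value x y x' y' 0 (w - y *v w)
      = (x *v (w - y *v w) - (w - y *v w)) + ((w - y *v w) - C *v (w - y *v w))"
    by (simp add: comm_value_def matvec C_apply)
  then show ?thesis using lorentz_coboundary[OF hypC] by (simp add: \<phi>_def lorentz_bilinear matvec)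
qed

lemma linear_\<phi>: "linear \<phi>"
  by (simp add: linear_iff \<phi>_def lorentz_bilinear matvec algebra_simps)

lemma \<phi>_y: "\<phi> (X_zero y) = 0"
  by (simp add: \<phi>_def hyperbolic_X_zero y lorentz_bilinear)

lemma invariant: "lorentz (x *v u) (x *v w) = lorentz u w" "lorentz (y *v u) (y *v w) = lorentz u w"
  by (simp_all add: lorentz_isometry[OF hyperbolic_isometry] x y)

text \<open>That \<open>C\<close> fixes its axis vector X means x^-1 y^-1 X = y^-1 x^-1 X. So for w
  fixed by \<open>x\<close>, B(xyw, X) = B(w, y^-1 x^-1 X) = B(w, x^-1 y^-1 X) = B(yw, X), and the
  terms of \<phi> cancel.\<close>

lemma \<phi>_x: "\<phi> (X_zero x) = 0"
proof -
  let ?X = "X_zero C" and ?w = "X_zero x"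
  have xw: "x *v ?w = ?w" using hyperbolic_X_zero[OF x] by simp
  have CX: "x *v (y *v (x' *v (y' *v ?X))) = ?X" using hyperbolic_X_zero[OF hypC] by (simp add: C_apply)
  then have eq: "x' *v (y' *v ?X) = y' *v (x' *v ?X)" by (metis cancel)
  have "lorentz (x *v (y *v ?w)) ?X = lorentz (y *v ?w) (x' *v ?X)"
    using invariant(1)[of "y *v ?w" "x' *v ?X"] by (simp add: cancel)
  also have "\<dots> = lorentz ?w (y' *v (x' *v ?X))"
    using invariant(2)[of ?w "y' *v (x' *v ?X)"] by (simp add: cancel)
  also have "\<dots> = lorentz (x *v ?w) (y' *v ?X)"
    unfolding eq[symmetric] using invariant(1)[of ?w "x' *v (y' *v ?X)"] by (simp add: cancel)
  also have "\<dots> = lorentz (y *v ?w) ?X"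
    unfolding xw using invariant(2)[of ?w "y' *v ?X"] by (simp add: cancel)
  finally show ?thesis by (simp add: \<phi>_def lorentz_bilinear matvec xw)
qed

lemma \<phi>_adjoint: "\<phi> w = lorentz w ((x' *v X_zero C - X_zero C) - y' *v (x' *v X_zero C - X_zero C))"
proof -
  let ?X = "X_zero C"
  have a: "lorentz (x *v u) v = lorentz u (x' *v v)" "lorentz (y *v u) v = lorentz u (y' *v v)" for u v
    using invariant(1)[of u "x' *v v"] invariant(2)[of u "y' *v v"] by (simp_all add: cancel)
  show ?thesis by (simp add: \<phi>_def lorentz_bilinear matvec a)
qed

text \<open>If the functional vanished, \<open>(x\<inverse> - 1) X\<^sub>C\<close>, which is orthogonal to \<open>X\<^sub>x\<close>, would be a multiple
  of \<open>X\<^sub>y\<close>: this is the only place where the angle condition enters.\<close>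

lemma \<phi>_nonzero: "\<exists>z. \<phi> z \<noteq> 0"
proof (rule ccontr)
  let ?X = "X_zero C" and ?d = "x' *v X_zero C - X_zero C"
  assume "\<nexists>z. \<phi> z \<noteq> 0"
  then have "lorentz (?d - y' *v ?d) w = 0" for w using \<phi>_adjoint[of w] by (metis lorentz_commute)
  then have "?d - y' *v ?d = 0" by (rule lorentz_nondegenerate)
  then have "y *v ?d = ?d" using cancel(2)[of ?d] by simp
  then obtain r where r: "?d = r *\<^sub>R X_zero y" using hyperbolic_fixed y by blast
  have "lorentz (X_zero x) (x' *v ?X) = lorentz (X_zero x) ?X"
    using invariant(1)[of "X_zero x" "x' *v ?X"] by (simp add: cancel hyperbolic_X_zero x)
  then have "r * lorentz (X_zero x) (X_zero y) = 0"
    using arg_cong[OF r, of "lorentz (X_zero x)"] by (simp add: lorentz_bilinear)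
  then have "x' *v ?X = ?X" using angle r by simp
  then have "x *v ?X = ?X" by (metis cancel(1))
  then have "C ** x = x ** C" using hyperbolic_common_axis_commute hypC x by blast
  then show False using ncx by (simp add: C_def)
qed

lemma torus_rigid:
  assumes q: "lorentz q (X_zero x) = 0" and p: "lorentz p (X_zero y) = 0"
    and qp: "lorentz (comm_value x y x' y' q p) (X_zero C) = 0"
  obtains v where "q = v - x *v v" "p = v - y *v v"
proof -
  obtain v1 where v1: "q = v1 - x *v v1" using orthogonal_X_zero_coboundary x q by blast
  obtain v2 where v2: "p = v2 - y *v v2" using orthogonal_X_zero_coboundary y p by blast
  \<comment> \<open>Subtracting the coboundary of \<open>v1\<close> leaves a cocycle that vanishes
    on \<open>x\<close> and is the coboundary of \<open>v2 - v1\<close> on \<open>y\<close>; its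
    commutator invariant is \<open>\<phi> (v2 - v1)\<close>.\<close>
  have "p = (v1 - y *v v1) + ((v2 - v1) - y *v (v2 - v1))" by (simp add: v2 matvec)
  then have "comm_value x y x' y' q p = (v1 - C *v v1) + comm_value x y x' y' 0 ((v2 - v1) - y *v (v2 - v1))"
    using comm_value_add[of "v1 - x *v v1" 0 "v1 - y *v v1"] unfolding comm_value_coboundary[symmetric] v1
    by (metis add.right_neutral)
  then have w: "\<phi> (v2 - v1) = 0"
    using qp lorentz_coboundary[OF hypC, of v1] comm_value_right by (simp add: lorentz_bilinear)
  obtain z where z: "\<phi> z \<noteq> 0" using \<phi>_nonzero by blast
  obtain \<alpha> \<beta> where ab: "v2 - v1 = \<alpha> *\<^sub>R X_zero x + \<beta> *\<^sub>R X_zero y"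
    using linear_functional_kernel[OF noncommuting_X_zero_independent[OF x y nc] linear_\<phi> z \<phi>_x \<phi>_y w] by blast
  define v where "v = v1 + \<alpha> *\<^sub>R X_zero x"
  have v': "v = v2 - \<beta> *\<^sub>R X_zero y" using ab by (simp add: v_def algebra_simps)
  have "q = v - x *v v" unfolding v_def v1 by (simp add: matvec hyperbolic_X_zero x)
  moreover have "p = v - y *v v" unfolding v' v2 by (simp add: matvec hyperbolic_X_zero y)
  ultimately show thesis using that by blast
qed

text \<open>Multiples of the axis vectors realise \<open>s\<close> and \<open>t\<close>. A
  coboundary on \<open>y\<close> alone, scaled through \<phi>, corrects the component of the
  commutator value along X_C. The remaining error is a coboundary at \<open>C\<close> and is
  absorbed by one common coboundary; neither correction affects \<open>s\<close> or
  \<open>t\<close>.\<close>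

lemma torus_extend:
  obtains q p where "lorentz q (X_zero x) = s" "lorentz p (X_zero y) = t" "comm_value x y x' y' q p = z"
proof -
  define q0 where "q0 = s *\<^sub>R X_zero x"
  define p0 where "p0 = t *\<^sub>R X_zero y"
  obtain w0 where w0: "\<phi> w0 \<noteq> 0" using \<phi>_nonzero by blast
  define e where "e = lorentz (z - comm_value x y x' y' q0 p0) (X_zero C)"
  define w where "w = (e / \<phi> w0) *\<^sub>R w0"
  have w: "\<phi> w = e" using w0 by (simp add: w_def linear_scale[OF linear_\<phi>])
  have "comm_value x y x' y' q0 (p0 + (w - y *v w))
      = comm_value x y x' y' q0 p0 + comm_value x y x' y' 0 (w - y *v w)"
    using comm_value_add[of q0 0] by simp
  then have "lorentz (z - comm_value x y x' y' q0 (p0 + (w - y *v w))) (X_zero C) = 0"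
    using comm_value_right[of w] w by (simp add: e_def lorentz_bilinear)
  then obtain v where v: "z - comm_value x y x' y' q0 (p0 + (w - y *v w)) = v - C *v v"
    using orthogonal_X_zero_coboundary hypC by blast
  show thesis
  proof
    show "lorentz (q0 + (v - x *v v)) (X_zero x) = s"
      using lorentz_coboundary[OF x] by (simp add: q0_def lorentz_bilinear(1,5) hyperbolic_X_zero x)
    show "lorentz (p0 + (w - y *v w) + (v - y *v v)) (X_zero y) = t"
      using lorentz_coboundary[OF y] by (simp add: p0_def lorentz_bilinear(1,5) hyperbolic_X_zero y)
    show "comm_value x y x' y' (q0 + (v - x *v v)) (p0 + (w - y *v w) + (v - y *v v)) = z"
      unfolding comm_value_add comm_value_coboundary v[symmetric] by simp
  qed
qed

end

text \<open>The axis vectors and \<open>p\<close> have Gram matrix diag(1, 1, -1), so they form a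
  basis. The direction of \<open>h\<close> at \<open>p\<close> is orthogonal to \<open>p\<close> and
  to its own axis vector, hence a multiple of \<open>X_zero k\<close>, to which the direction of
  \<open>k\<close> is orthogonal. Choosing the left half only changes a sign.\<close>

lemma orthogonal_axes_crossing_angle:
  assumes h: "hyperbolic h" and k: "hyperbolic k" and p: "p \<in> geod_axis h \<inter> geod_axis k"
    and orth: "lorentz (X_zero h) (X_zero k) = 0"
  shows "crossing_angle h k p = pi / 2"
proof -
  have pp: "lorentz p p = -1" using p by (simp add: geod_axis_def H2_def)
  have perp: "lorentz v (X_zero h) = 0" if "hyperbolic h" and v: "v \<in> span {X_minus h, X_plus h}" for v h
  proof -
    obtain a b where "v = a *\<^sub>R X_minus h + b *\<^sub>R X_plus h"
      using v by (auto simp: span_breakdown_eq algebra_simps)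
    then show ?thesis using hyperbolic_X_zero[OF that(1)]
      by (simp add: lorentz_bilinear lorentz_commute[of "X_minus h" "X_zero h"] lorentz_commute[of "X_plus h" "X_zero h"])
  qed
  have ph: "lorentz p (X_zero h) = 0" "lorentz p (X_zero k) = 0"
    using p perp h k by (auto simp: geod_axis_def)
  have dir: "lorentz (direction h p) (X_zero h) = 0 \<and> lorentz (direction h p) p = 0"
    if "hyperbolic h" "p \<in> geod_axis h" for h
  proof -
    let ?t = "X_plus h + lorentz (X_plus h) p *\<^sub>R p"
    have "?t \<in> span {X_minus h, X_plus h}"
      using that by (intro span_add span_scale) (auto simp: geod_axis_def intro: span_base)
    then have "lorentz ?t (X_zero h) = 0" by (rule perp[OF that(1)])
    moreover have "lorentz ?t p = 0" using pp by (simp add: lorentz_bilinear)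
    ultimately show ?thesis by (simp add: direction_def Let_def lorentz_bilinear(5))
  qed
  let ?n = "X_zero h" and ?m = "X_zero k"
  note X = hyperbolic_X_zero(2)[OF h] hyperbolic_X_zero(2)[OF k]
  have expand: "v = lorentz v ?n *\<^sub>R ?n + lorentz v ?m *\<^sub>R ?m" if v: "lorentz v p = 0" for v
  proof -
    have ind: "\<alpha> = 0 \<and> \<beta> = 0 \<and> \<gamma> = 0" if z: "\<alpha> *\<^sub>R ?n + \<beta> *\<^sub>R ?m + \<gamma> *\<^sub>R p = 0" for \<alpha> \<beta> \<gamma>
    proof -
      have "lorentz (\<alpha> *\<^sub>R ?n + \<beta> *\<^sub>R ?m + \<gamma> *\<^sub>R p) w = 0" for w unfolding z by (simp add: lorentz_bilinear)
      from this[of ?n] this[of ?m] this[of p] show ?thesis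
        using ph ph[unfolded lorentz_commute[of p]] pp X orth
        by (simp add: lorentz_bilinear lorentz_commute[of ?m ?n])
    qed
    obtain \<alpha> \<beta> \<gamma> where w: "v = \<alpha> *\<^sub>R ?n + \<beta> *\<^sub>R ?m + \<gamma> *\<^sub>R p" using independent_spans ind by blast
    show ?thesis
      using v ph ph[unfolded lorentz_commute[of p]] pp X orth unfolding w
      by (simp add: lorentz_bilinear lorentz_commute[of ?m ?n])
  qed
  let ?a = "direction h p" and ?b = "direction k p"
  have a: "?a = lorentz ?a ?m *\<^sub>R ?m" using expand[of ?a] dir[OF h] p by simp
  have b: "lorentz ?b ?m = 0" using dir[OF k] p by simp
  have "lorentz ?a ?b = 0"
    using b by (subst a) (simp add: lorentz_bilinear lorentz_commute[of ?m])
  then have "lorentz ?a (left_direction h k p) = 0" by (simp add: left_direction_def lorentz_bilinear)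
  then show ?thesis by (simp add: crossing_angle_def)
qed

section \<open>Cancellation in the general linear group\<close>

interpretation GL3: group GL3
  by (rule group_GL3)

lemma GL3_simps: "carrier GL3 = {A. invertible A}" "x \<otimes>\<^bsub>GL3\<^esub> y = x ** y" "\<one>\<^bsub>GL3\<^esub> = mat 1"
  by (simp_all add: GL3_def)

lemma GL3_inv_mult:
  assumes "h \<in> carrier GL3"
  shows "inv\<^bsub>GL3\<^esub> h ** h = mat 1" "h ** inv\<^bsub>GL3\<^esub> h = mat 1"
  using GL3.l_inv[OF assms] GL3.r_inv[OF assms] by (simp_all add: GL3_simps)

lemma GL3_inv_cancel:
  assumes "h \<in> carrier GL3"
  shows "inv\<^bsub>GL3\<^esub> h ** (h ** k) = k" "h ** (inv\<^bsub>GL3\<^esub> h ** k) = k"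
    "inv\<^bsub>GL3\<^esub> h *v (h *v v) = v" "h *v (inv\<^bsub>GL3\<^esub> h *v v) = v"
  by (simp_all add: matrix_mul_assoc matrix_vector_mul_assoc GL3_inv_mult assms)

lemma GL3_left_cancel: "h \<in> carrier GL3 \<Longrightarrow> h ** A = h ** B \<Longrightarrow> A = B"
  by (metis GL3_inv_cancel(1))

lemma GL3_right_cancel: "h \<in> carrier GL3 \<Longrightarrow> A ** h = B ** h \<Longrightarrow> A = B"
  by (metis GL3_inv_mult(2) matrix_mul_assoc matrix_mul_rid)

section \<open>Words in free generators\<close>

definition word_inv :: "('i \<times> bool) list \<Rightarrow> ('i \<times> bool) list" where
  "word_inv w = map (\<lambda>(i, e). (i, \<not> e)) (rev w)"

text \<open>The value forced on a word by the cocycle rule when the generators have values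
  \<open>U\<close>; the inverse letter uses u(c^-1) = -c^-1 u(c).\<close>

fun word_cocycle :: "('i \<Rightarrow> mat3) \<Rightarrow> ('i \<Rightarrow> vec3) \<Rightarrow> ('i \<times> bool) list \<Rightarrow> vec3" where
  "word_cocycle c U [] = 0"
| "word_cocycle c U ((i, e) # w) =
     (if e then U i + c i *v word_cocycle c U w
      else inv\<^bsub>GL3\<^esub> (c i) *v (word_cocycle c U w - U i))"

lemma support_word_inv: "fst ` set (word_inv w) = fst ` set w"
  by (force simp: word_inv_def)

lemma word_inv_append: "word_inv (v @ w) = word_inv w @ word_inv v"
  by (simp add: word_inv_def)

lemma word_inv_Nil_iff: "word_inv w = [] \<longleftrightarrow> w = []"
  by (simp add: word_inv_def)

lemma word_value_append: "word_value c (v @ w) = word_value c v ** word_value c w"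
  by (induction c v rule: word_value.induct) (auto simp: matrix_mul_assoc)

lemma word_cocycle_append:
  "word_cocycle c U (v @ w) = word_cocycle c U v + word_value c v *v word_cocycle c U w"
  by (induction c v rule: word_value.induct)
    (auto simp: matvec matrix_vector_mul_assoc[symmetric])

lemma word_value_in_carrier:
  "c ` fst ` set w \<subseteq> carrier GL3 \<Longrightarrow> word_value c w \<in> carrier GL3"
  by (induction c w rule: word_value.induct)
    (auto simp flip: GL3_simps(2,3))

lemma word_value_inv:
  assumes "c ` fst ` set w \<subseteq> carrier GL3"
  shows "word_value c (word_inv w) = inv\<^bsub>GL3\<^esub> (word_value c w)"
  using assms
proof (induction c w rule: word_value.induct)
  case (1 c)
  show ?case using GL3.inv_one by (simp add: word_inv_def GL3_simps)
next
  case (2 c i e w)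
  then have ci: "c i \<in> carrier GL3" and w: "word_value c w \<in> carrier GL3"
    and IH: "word_value c (word_inv w) = inv\<^bsub>GL3\<^esub> (word_value c w)"
    using word_value_in_carrier[of c w] by auto
  have "word_inv ((i, e) # w) = word_inv w @ [(i, \<not> e)]" by (simp add: word_inv_def)
  then show ?case
    using ci w GL3.inv_mult_group[of "c i" "word_value c w"]
      GL3.inv_mult_group[of "inv\<^bsub>GL3\<^esub> (c i)" "word_value c w"]
    by (simp add: word_value_append IH GL3_simps(2,3))
qed

lemma reduced_word_inv:
  assumes "reduced_word w"
  shows "reduced_word (word_inv w)"
proof -
  have "successively (\<lambda>x y. \<not> (fst y = fst x \<and> snd y \<noteq> snd x)) (rev w)"
    using assms unfolding reduced_word_def successively_rev .
  then show ?thesis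
    unfolding reduced_word_def word_inv_def successively_map
    by (rule successively_mono) auto
qed

lemma reduced_word_append:
  assumes "reduced_word v" "reduced_word w" "v \<noteq> [] \<Longrightarrow> w \<noteq> [] \<Longrightarrow> fst (last v) \<noteq> fst (hd w)"
  shows "reduced_word (v @ w)"
  using assms by (auto simp: reduced_word_def successively_append_iff)

lemma reduced_word_append_disjoint:
  assumes "reduced_word v" "reduced_word w" "fst ` set v \<inter> fst ` set w = {}"
  shows "reduced_word (v @ w)"
  using assms(1,2)
proof (rule reduced_word_append)
  assume "v \<noteq> []" "w \<noteq> []"
  then show "fst (last v) \<noteq> fst (hd w)"
    using assms(3) last_in_set[of v] hd_in_set[of w] by (metis disjoint_iff image_eqI)
qed

text \<open>Cancelling a letter against its neighbouring inverse preserves the matrix and, for every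
  \<open>U\<close>, the cocycle value. Both are tracked along the same reduction so that freeness
  can be applied to the cocycle.\<close>

lemma reduce_word:
  assumes "c ` fst ` set w \<subseteq> carrier GL3"
  shows "\<exists>w'. reduced_word w' \<and> fst ` set w' \<subseteq> fst ` set w \<and> word_value c w' = word_value c w
    \<and> (\<forall>U. word_cocycle c U w' = word_cocycle c U w)"
  using assms
proof (induction w)
  case Nil
  show ?case by (rule exI[of _ "[]"]) (simp add: reduced_word_def)
next
  case (Cons a w)
  obtain i e where a: "a = (i, e)" by fastforce
  have ci: "c i \<in> carrier GL3" using Cons.prems a by simp
  obtain w' where w': "reduced_word w'" "fst ` set w' \<subseteq> fst ` set w" "word_value c w' = word_value c w"
    "\<And>U. word_cocycle c U w' = word_cocycle c U w"
    using Cons by auto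
  show ?case
  proof (cases "\<exists>w''. w' = (i, \<not> e) # w''")
    case True
    then obtain w'' where w'': "w' = (i, \<not> e) # w''" by blast
    have "reduced_word w''" using w' w'' by (cases w'') (auto simp: reduced_word_def)
    moreover have "word_value c w'' = word_value c (a # w)"
      using w'(3)[symmetric] ci unfolding a w'' by (auto simp: GL3_inv_cancel)
    moreover have "word_cocycle c U w'' = word_cocycle c U (a # w)" for U
      using w'(4)[of U, symmetric] ci unfolding a w'' by (auto simp: GL3_inv_cancel)
    ultimately show ?thesis using w' w'' by (intro exI[of _ w'']) auto
  next
    case False
    have "reduced_word (a # w')"
      using w' False a by (cases w') (auto simp: reduced_word_def)
    then show ?thesis using w' a by (intro exI[of _ "a # w'"]) auto
  qed
qed

lemma word_cocycle_inv:
  assumes "c ` fst ` set w \<subseteq> carrier GL3"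
  shows "word_cocycle c U w + word_value c w *v word_cocycle c U (word_inv w) = 0"
  using assms
proof (induction w)
  case (Cons a w)
  obtain i e where a: "a = (i, e)" by fastforce
  then have ci: "c i \<in> carrier GL3" using Cons.prems by simp
  have w: "c ` fst ` set w \<subseteq> carrier GL3" using Cons.prems by auto
  have inv: "word_value c w *v (word_value c (word_inv w) *v v) = v" for v
    unfolding word_value_inv[OF w] by (rule GL3_inv_cancel(4)[OF word_value_in_carrier[OF w]])
  have 1: "word_inv ((i, e) # w) = word_inv w @ [(i, \<not> e)]" by (simp add: word_inv_def)
  have 2: "word_value c w *v word_cocycle c U (word_inv w) = - word_cocycle c U w"
    using Cons.IH[OF w] by (simp add: eq_neg_iff_add_eq_0 add.commute)
  show ?case
    unfolding a 1 using ci
    by (auto simp: word_cocycle_append matvec matvec_neg matrix_vector_mul_assoc[symmetric] 2 inv GL3_inv_cancel)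
qed (simp add: word_inv_def)

section \<open>Cocycles on free groups\<close>

lemma generate_GL3_word:
  assumes "h \<in> generate GL3 (c ` I)" "c ` I \<subseteq> carrier GL3"
  shows "\<exists>w. fst ` set w \<subseteq> I \<and> word_value c w = h"
  using assms
proof (induction rule: generate.induct)
  case one
  show ?case by (rule exI[of _ "[]"]) (simp add: GL3_simps)
next
  case (incl h)
  then obtain i where "i \<in> I" "h = c i" by blast
  then show ?case by (intro exI[of _ "[(i, True)]"]) simp
next
  case (inv h)
  then obtain i where "i \<in> I" "h = c i" by blast
  then show ?case by (intro exI[of _ "[(i, False)]"]) simp
next
  case (eng h1 h2)
  then obtain w1 w2 where "fst ` set w1 \<subseteq> I" "word_value c w1 = h1" "fst ` set w2 \<subseteq> I" "word_value c w2 = h2"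
    by blast
  then show ?case by (intro exI[of _ "w1 @ w2"]) (auto simp: word_value_append GL3_simps)
qed

lemma freely_generatedD:
  "freely_generated G I c \<Longrightarrow> reduced_word w \<Longrightarrow> w \<noteq> [] \<Longrightarrow> fst ` set w \<subseteq> I \<Longrightarrow> word_value c w \<noteq> mat 1"
  by (simp add: freely_generated_def)

text \<open>The word \<open>v @ word_inv w\<close> has value 1, so by freeness its reduction is
  empty and its cocycle value is 0.\<close>

lemma word_cocycle_well_defined:
  assumes free: "freely_generated G I c" and c: "c ` I \<subseteq> carrier GL3"
    and v: "fst ` set v \<subseteq> I" and w: "fst ` set w \<subseteq> I" and eq: "word_value c v = word_value c w"
  shows "word_cocycle c U v = word_cocycle c U w"
proof -
  have cv: "c ` fst ` set v \<subseteq> carrier GL3" and cw: "c ` fst ` set w \<subseteq> carrier GL3" using c v w by blast+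
  let ?w = "v @ word_inv w"
  have sup: "fst ` set ?w \<subseteq> I" using v w support_word_inv[of w] by (simp add: image_Un)
  then have c': "c ` fst ` set ?w \<subseteq> carrier GL3" using c by blast
  obtain w' where w': "reduced_word w'" "fst ` set w' \<subseteq> fst ` set ?w" "word_value c w' = word_value c ?w"
    "word_cocycle c U w' = word_cocycle c U ?w"
    using reduce_word[OF c'] by blast
  have "word_value c ?w = mat 1"
    by (simp add: word_value_append word_value_inv[OF cw] eq GL3_inv_mult word_value_in_carrier cw)
  then have "w' = []" using freely_generatedD[OF free w'(1)] w'(2,3) sup by (metis order.trans)
  then have "word_cocycle c U v + word_value c w *v word_cocycle c U (word_inv w) = 0"
    using w'(4) eq by (simp add: word_cocycle_append)
  then show ?thesis using word_cocycle_inv[OF cw, of U] by (metis add_right_cancel)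
qed

text \<open>On a free group the values on generators are arbitrary. The models of the twists and the
  cocycles with prescribed invariants are obtained from this.\<close>

lemma free_cocycle:
  assumes free: "freely_generated G I c" and c: "c ` I \<subseteq> carrier GL3"
  shows "\<exists>u. u \<in> Z1 G \<and> (\<forall>i\<in>I. u (c i) = U i)"
proof -
  have G: "G = generate GL3 (c ` I)" using free by (simp add: freely_generated_def)
  have "\<forall>h\<in>G. \<exists>w. fst ` set w \<subseteq> I \<and> word_value c w = h" using generate_GL3_word c G by blast
  then obtain W where W: "\<And>h. h \<in> G \<Longrightarrow> fst ` set (W h) \<subseteq> I" "\<And>h. h \<in> G \<Longrightarrow> word_value c (W h) = h"
    by metis
  define u where "u h = (if h \<in> G then word_cocycle c U (W h) else 0)" for h
  have u: "u h = word_cocycle c U w" if "h \<in> G" "fst ` set w \<subseteq> I" "word_value c w = h" for h w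
    using word_cocycle_well_defined[OF free c W(1)[OF that(1)] that(2)] W(2) that by (simp add: u_def)
  have "u (h1 ** h2) = h1 *v u h2 + u h1" if "h1 \<in> G" "h2 \<in> G" for h1 h2
  proof -
    have "h1 ** h2 \<in> G" using that generate.eng[of h1 GL3 _ h2] unfolding G by (simp add: GL3_simps)
    then have "u (h1 ** h2) = word_cocycle c U (W h1 @ W h2)"
      using u W that by (auto simp: word_value_append image_Un)
    then show ?thesis using that W(2) by (simp add: word_cocycle_append u_def)
  qed
  then have "u \<in> Z1 G" by (simp add: Z1_def u_def)
  moreover have "u (c i) = U i" if "i \<in> I" for i
    using u[of "c i" "[(i, True)]"] that generate.incl[of "c i" "c ` I" GL3] by (simp add: G)
  ultimately show ?thesis by blast
qed

text \<open>The commutator of two words in disjoint sets of letters is itself reduced.\<close>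

lemma disjoint_words_noncommuting:
  assumes free: "freely_generated G I c" and c: "c ` I \<subseteq> carrier GL3"
    and v: "reduced_word v" "v \<noteq> []" "fst ` set v \<subseteq> I"
    and w: "reduced_word w" "w \<noteq> []" "fst ` set w \<subseteq> I" and disj: "fst ` set v \<inter> fst ` set w = {}"
  shows "word_value c v ** word_value c w \<noteq> word_value c w ** word_value c v"
proof
  assume eq: "word_value c v ** word_value c w = word_value c w ** word_value c v"
  let ?vw = "v @ w" and ?z = "(v @ w) @ word_inv (w @ v)"
  have cv: "c ` fst ` set v \<subseteq> carrier GL3" "c ` fst ` set w \<subseteq> carrier GL3" "c ` fst ` set (w @ v) \<subseteq> carrier GL3"
    using c v w unfolding set_append image_Un by blast+
  have red: "reduced_word ?z"
  proof -
    let ?v' = "word_inv v" and ?w' = "word_inv w"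
    have ne: "?v' \<noteq> []" "?w' \<noteq> []" using v w by (simp_all add: word_inv_Nil_iff)
    have sup: "fst (last x) \<in> fst ` set x" "fst (hd x) \<in> fst ` set x" if "x \<noteq> []"
      for x :: "('a \<times> bool) list"
      using that by auto
    have 1: "reduced_word (?v' @ ?w')"
      using reduced_word_inv[OF v(1)] reduced_word_inv[OF w(1)] disj
      by (intro reduced_word_append_disjoint) (simp_all add: support_word_inv)
    have "fst (last w) \<noteq> fst (hd ?v')"
      using sup(1)[OF w(2)] sup(2)[OF ne(1)] disj unfolding support_word_inv by (metis disjoint_iff)
    then have 2: "reduced_word (w @ ?v' @ ?w')"
      using reduced_word_append[OF w(1) 1] ne by simp
    have "fst (last v) \<noteq> fst (hd w)"
      using sup(1)[OF v(2)] sup(2)[OF w(2)] disj by (metis disjoint_iff)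
    then have "reduced_word (v @ w @ ?v' @ ?w')"
      using reduced_word_append[OF v(1) 2] w by simp
    then show ?thesis by (simp add: word_inv_append)
  qed
  have "fst ` set ?z \<subseteq> I" using v w support_word_inv[of "w @ v"] by (simp add: image_Un)
  then have "word_value c ?z \<noteq> mat 1"
    using freely_generatedD[OF free red] v(2) by blast
  moreover have "word_value c ?z = mat 1"
    unfolding word_value_append[of c "v @ w"] word_value_inv[OF cv(3)]
    using GL3_inv_mult(2)[OF word_value_in_carrier[OF cv(3)]] eq by (simp add: word_value_append)
  ultimately show False by blast
qed

section \<open>Cocycles modulo coboundaries\<close>

lemma Z1_add: "u \<in> Z1 G \<Longrightarrow> u' \<in> Z1 G \<Longrightarrow> (\<lambda>h. u h + u' h) \<in> Z1 G"
  by (simp add: Z1_def matvec)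

lemma Z1_diff: "u \<in> Z1 G \<Longrightarrow> u' \<in> Z1 G \<Longrightarrow> (\<lambda>h. u h - u' h) \<in> Z1 G"
  by (simp add: Z1_def matvec)

lemma Z1_scale: "u \<in> Z1 G \<Longrightarrow> (\<lambda>h. a *\<^sub>R u h) \<in> Z1 G"
  by (simp add: Z1_def matvec scaleR_add_right)

lemma Z1_zero: "(\<lambda>h. 0) \<in> Z1 G"
  by (simp add: Z1_def)

lemma Z1_sum: "(\<And>i. i \<in> I \<Longrightarrow> f i \<in> Z1 G) \<Longrightarrow> (\<lambda>h. \<Sum>i\<in>I. f i h) \<in> Z1 G"
  by (induction I rule: infinite_finite_induct) (simp_all add: Z1_zero Z1_add)

lemma Z1_mult: "u \<in> Z1 G \<Longrightarrow> h \<in> G \<Longrightarrow> k \<in> G \<Longrightarrow> u (h ** k) = h *v u k + u h"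
  by (simp add: Z1_def)

lemma coboundary_add: "coboundary G (v + w) h = coboundary G v h + coboundary G w h"
  by (simp add: coboundary_def matvec)

lemma coboundary_diff: "coboundary G (v - w) h = coboundary G v h - coboundary G w h"
  by (simp add: coboundary_def matvec)

lemma coboundary_scale: "coboundary G (a *\<^sub>R v) h = a *\<^sub>R coboundary G v h"
  by (simp add: coboundary_def matvec scaleR_diff_right)

lemma coboundary_zero: "coboundary G 0 h = 0"
  by (simp add: coboundary_def)

lemma coboundary_sum: "coboundary G (\<Sum>i\<in>I. f i) h = (\<Sum>i\<in>I. coboundary G (f i) h)"
  by (induction I rule: infinite_finite_induct) (simp_all add: coboundary_zero coboundary_add)

locale matrix_group =
  fixes G :: "mat3 set"
  assumes subgroup: "subgroup G GL3"
begin

lemma in_carrier: "h \<in> G \<Longrightarrow> h \<in> carrier GL3"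
  using subgroup.subset[OF subgroup] by blast

lemma one_closed: "mat 1 \<in> G"
  using subgroup.one_closed[OF subgroup] by (simp add: GL3_simps)

lemma mult_closed: "h \<in> G \<Longrightarrow> k \<in> G \<Longrightarrow> h ** k \<in> G"
  using subgroup.m_closed[OF subgroup] by (simp add: GL3_simps)

lemma inv_closed: "h \<in> G \<Longrightarrow> inv\<^bsub>GL3\<^esub> h \<in> G"
  using subgroup.m_inv_closed[OF subgroup] by blast

lemma generate_closed: "S \<subseteq> G \<Longrightarrow> generate GL3 S \<subseteq> G"
  using GL3.generate_subgroup_incl[OF _ subgroup] by blast

lemma word_value_closed: "c ` fst ` set w \<subseteq> G \<Longrightarrow> word_value c w \<in> G"
  by (induction c w rule: word_value.induct) (auto simp: one_closed mult_closed inv_closed)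

lemma coboundary_Z1: "coboundary G v \<in> Z1 G"
  by (auto simp: Z1_def coboundary_def mult_closed matvec matrix_vector_mul_assoc[symmetric])

lemma cocycle_one:
  assumes "u \<in> Z1 G" shows "u (mat 1) = 0"
  using Z1_mult[OF assms one_closed one_closed] by simp

lemma cocycle_inv:
  assumes "u \<in> Z1 G" "h \<in> G" shows "u (inv\<^bsub>GL3\<^esub> h) = - (inv\<^bsub>GL3\<^esub> h *v u h)"
proof -
  have "inv\<^bsub>GL3\<^esub> h *v u h + u (inv\<^bsub>GL3\<^esub> h) = 0"
    using Z1_mult[OF assms(1) inv_closed assms(2), of h] assms
    by (simp add: GL3_inv_mult in_carrier cocycle_one)
  then show ?thesis by (simp add: eq_neg_iff_add_eq_0 add.commute)
qed

lemma cocycle_zero_on_generate: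
  assumes u: "u \<in> Z1 G" and S: "S \<subseteq> G" "\<And>h. h \<in> S \<Longrightarrow> u h = 0" and h: "h \<in> generate GL3 S"
  shows "u h = 0"
  using h
proof (induction rule: generate.induct)
  case one
  show ?case using cocycle_one[OF u] by (simp add: GL3_simps)
next
  case (incl h)
  then show ?case using S by blast
next
  case (inv h)
  then show ?case using S cocycle_inv[OF u, of h] by auto
next
  case (eng h1 h2)
  have "h1 \<in> G" "h2 \<in> G" using generate_closed[OF S(1)] eng by auto
  then show ?case using eng Z1_mult[OF u] by (simp add: GL3_simps)
qed

lemma cocycle_eq_on_generate:
  assumes "u \<in> Z1 G" "u' \<in> Z1 G" "S \<subseteq> G" "\<And>h. h \<in> S \<Longrightarrow> u h = u' h" "h \<in> generate GL3 S"
  shows "u h = u' h"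
  using cocycle_zero_on_generate[OF Z1_diff[OF assms(1,2)] assms(3) _ assms(5)] assms(4) by simp

lemma cohomologous_iff:
  "(u, u') \<in> cohomologous G \<longleftrightarrow> u \<in> Z1 G \<and> u' \<in> Z1 G \<and> (\<exists>v. \<forall>h. u' h = u h + coboundary G v h)"
  by (auto simp: cohomologous_def algebra_simps)

lemma equiv_cohomologous: "equiv (Z1 G) (cohomologous G)"
proof (rule equivI)
  show "cohomologous G \<subseteq> Z1 G \<times> Z1 G" by (auto simp: cohomologous_def)
  show "refl_on (Z1 G) (cohomologous G)"
    by (rule refl_onI) (auto simp: cohomologous_iff intro!: exI[of _ 0] simp: coboundary_zero)
  show "sym (cohomologous G)"
  proof (rule symI)
    fix u u' assume "(u, u') \<in> cohomologous G"
    then obtain v where "u \<in> Z1 G" "u' \<in> Z1 G" "\<forall>h. u' h = u h + coboundary G v h"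
      by (auto simp: cohomologous_iff)
    then show "(u', u) \<in> cohomologous G"
      using coboundary_diff[of G 0 v] by (auto simp: cohomologous_iff coboundary_zero intro!: exI[of _ "- v"])
  qed
  show "trans (cohomologous G)"
  proof (rule transI)
    fix u1 u2 u3 assume "(u1, u2) \<in> cohomologous G" "(u2, u3) \<in> cohomologous G"
    then obtain v w where "u1 \<in> Z1 G" "u3 \<in> Z1 G" "\<forall>h. u2 h = u1 h + coboundary G v h"
      "\<forall>h. u3 h = u2 h + coboundary G w h"
      unfolding cohomologous_iff by blast
    then show "(u1, u3) \<in> cohomologous G"
      by (auto simp: cohomologous_iff coboundary_add intro!: exI[of _ "v + w"])
  qed
qed

lemma coh_class_eq_iff:
  assumes "u \<in> Z1 G" "u' \<in> Z1 G"
  shows "coh_class G u = coh_class G u' \<longleftrightarrow> (\<exists>v. \<forall>h. u' h = u h + coboundary G v h)"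
  using eq_equiv_class_iff[OF equiv_cohomologous assms] assms
  by (simp add: coh_class_def cohomologous_iff)

lemma mem_coh_class:
  assumes "u \<in> Z1 G"
  shows "u' \<in> coh_class G u \<longleftrightarrow> u' \<in> Z1 G \<and> coh_class G u = coh_class G u'"
  using assms coh_class_eq_iff[of u u'] by (auto simp: coh_class_def cohomologous_iff)

text \<open>Every pair of representatives yields the same class, so the union defining
  \<open>H1_add\<close> is a union of equal sets.\<close>

lemma H1_add_class:
  assumes "u \<in> Z1 G" "u' \<in> Z1 G"
  shows "H1_add G (coh_class G u) (coh_class G u') = coh_class G (\<lambda>h. u h + u' h)"
proof -
  have "coh_class G (\<lambda>h. x h + y h) = coh_class G (\<lambda>h. u h + u' h)"
    if xy: "x \<in> coh_class G u" "y \<in> coh_class G u'" for x y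
  proof -
    obtain v w where v: "x \<in> Z1 G" "y \<in> Z1 G" "\<forall>h. x h = u h + coboundary G v h" "\<forall>h. y h = u' h + coboundary G w h"
      using xy assms by (auto simp: coh_class_def cohomologous_iff)
    then have "coh_class G (\<lambda>h. u h + u' h) = coh_class G (\<lambda>h. x h + y h)"
      unfolding coh_class_eq_iff[OF Z1_add[OF assms] Z1_add[OF v(1,2)]]
      using v(3,4) by (intro exI[of _ "v + w"]) (simp add: coboundary_add)
    then show ?thesis by simp
  qed
  moreover have "u \<in> coh_class G u" "u' \<in> coh_class G u'" using mem_coh_class assms by auto
  ultimately show ?thesis unfolding H1_add_def by blast
qed

lemma H1_scale_class:
  assumes "u \<in> Z1 G"
  shows "H1_scale G a (coh_class G u) = coh_class G (\<lambda>h. a *\<^sub>R u h)"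
proof -
  have "coh_class G (\<lambda>h. a *\<^sub>R x h) = coh_class G (\<lambda>h. a *\<^sub>R u h)" if x: "x \<in> coh_class G u" for x
  proof -
    obtain v where v: "x \<in> Z1 G" "\<forall>h. x h = u h + coboundary G v h"
      using x assms by (auto simp: coh_class_def cohomologous_iff)
    then have "coh_class G (\<lambda>h. a *\<^sub>R u h) = coh_class G (\<lambda>h. a *\<^sub>R x h)"
      unfolding coh_class_eq_iff[OF Z1_scale[OF assms] Z1_scale[OF v(1)]]
      using v(2) by (intro exI[of _ "a *\<^sub>R v"]) (simp add: coboundary_scale scaleR_add_right)
    then show ?thesis by simp
  qed
  moreover have "u \<in> coh_class G u" using mem_coh_class assms by auto
  ultimately show ?thesis unfolding H1_scale_def by blast
qed

end

section \<open>Boundary and cutting curves as words in the free generators\<close>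

locale surface = matrix_group G for G :: "mat3 set" +
  fixes g b :: nat and c :: "loop \<Rightarrow> mat3"
  assumes b_pos: "b \<ge> 1" and nonsporadic: "2 * g + b > 2"
    and hyperbolic_G: "\<And>h. h \<in> G \<Longrightarrow> h \<noteq> mat 1 \<Longrightarrow> hyperbolic h"
    and free: "freely_generated G (Boundary ` {1..<b} \<union> Longitude ` {1..g} \<union> Meridian ` {1..g}) c"
    and sep: "\<And>j. j \<in> {1..g} \<Longrightarrow> c (Sep j) = commutator (c (Longitude j)) (c (Meridian j))"
    and relation: "hole_product b c (g + b - 1) = mat 1"
    and cut: "\<And>k. k \<in> {1..b + g - 3} \<Longrightarrow> c (Cut k) = hole_product b c k"
    and angle: "\<And>j. j \<in> {1..g} \<Longrightarrow> lorentz (X_zero (c (Longitude j))) (X_zero (c (Meridian j))) \<noteq> 0"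
begin

abbreviation "gens \<equiv> Boundary ` {1..<b} \<union> Longitude ` {1..g} \<union> Meridian ` {1..g}"
abbreviation "n \<equiv> g + b"
abbreviation "hol i \<equiv> c (hole b i)"
abbreviation "hp k \<equiv> hole_product b c k"

lemma n_ge_2: "n \<ge> 2"
  using nonsporadic by linarith

lemma n_pos: "0 < n"
  using n_ge_2 by linarith

lemma gens_in_G: "c ` gens \<subseteq> G"
proof -
  have "G = generate GL3 (c ` gens)" using free by (simp add: freely_generated_def)
  then show ?thesis using generate.incl[of _ "c ` gens" GL3] by blast
qed

lemma gens_in_carrier: "c ` gens \<subseteq> carrier GL3"
  using gens_in_G in_carrier by blast

lemma gens_holes: "gens = (\<Union>i\<in>{1..<n}. hole_generators b i)"
proof
  show "gens \<subseteq> (\<Union>i\<in>{1..<n}. hole_generators b i)"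
  proof
    fix e assume "e \<in> gens"
    then consider i where "e = Boundary i" "i \<in> {1..<b}" | j where "e \<in> {Longitude j, Meridian j}" "j \<in> {1..g}"
      by blast
    then show "e \<in> (\<Union>i\<in>{1..<n}. hole_generators b i)"
    proof cases
      case 1
      then show ?thesis by (intro UN_I[of i]) (auto simp: hole_generators_def hole_def)
    next
      case 2
      then show ?thesis
        using b_pos by (intro UN_I[of "b + j - 1"]) (auto simp: hole_generators_def)
    qed
  qed
  show "(\<Union>i\<in>{1..<n}. hole_generators b i) \<subseteq> gens"
    using b_pos by (fastforce simp: hole_generators_def hole_def split: if_splits)
qed

lemma hole_generators_gens: "i \<in> {1..<n} \<Longrightarrow> hole_generators b i \<subseteq> gens"
  unfolding gens_holes by blast

lemma hole_generators_disjoint: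
  assumes "i \<ge> 1" "i' \<ge> 1" "i \<noteq> i'"
  shows "hole_generators b i \<inter> hole_generators b i' = {}"
  using assms by (auto simp: hole_generators_def hole_def)

text \<open>Meaningful for i between 1 and \<open>n - 1\<close>: the curve at hole 0 is
  \<open>Boundary b\<close>, which is not a free generator.\<close>

definition hole_word :: "nat \<Rightarrow> (loop \<times> bool) list" where
  "hole_word i = (if i < b then [(Boundary i, True)]
     else [(Longitude (i + 1 - b), True), (Meridian (i + 1 - b), True),
           (Longitude (i + 1 - b), False), (Meridian (i + 1 - b), False)])"

lemma hole_Sep: "b \<le> i \<Longrightarrow> hole b i = Sep (i + 1 - b)"
  using b_pos by (simp add: hole_def)

lemma hole_word_value:
  assumes "i \<in> {1..<n}"
  shows "word_value c (hole_word i) = hol i"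
proof (cases "i < b")
  case True
  then show ?thesis using assms by (simp add: hole_word_def hole_def)
next
  case False
  then have "i + 1 - b \<in> {1..g}" using assms by auto
  from sep[OF this] False show ?thesis
    by (simp add: hole_word_def hole_Sep commutator_def matrix_mul_assoc)
qed

lemma hole_word_support: "i \<ge> 1 \<Longrightarrow> fst ` set (hole_word i) = hole_generators b i"
  by (auto simp: hole_word_def hole_generators_def hole_def)

lemma hole_word_reduced: "reduced_word (hole_word i)"
  by (simp add: hole_word_def reduced_word_def)

lemma hole_word_nonempty: "hole_word i \<noteq> []"
  by (simp add: hole_word_def)

text \<open>By the relation, the tail starting at hole k + 1 is inverse to \<open>hp k\<close>; it
  expresses that product without hole 0.\<close>

definition tail_word :: "nat \<Rightarrow> nat \<Rightarrow> (loop \<times> bool) list" where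
  "tail_word i m = concat (map hole_word [i..<m])"

lemma tail_word_support: "i \<ge> 1 \<Longrightarrow> fst ` set (tail_word i m) = (\<Union>k\<in>{i..<m}. hole_generators b k)"
  by (simp add: tail_word_def image_UN hole_word_support)

lemma tail_word_Suc: "i \<le> m \<Longrightarrow> tail_word i (Suc m) = tail_word i m @ hole_word m"
  by (simp add: tail_word_def)

lemma tail_word_Cons: "i < m \<Longrightarrow> tail_word i m = hole_word i @ tail_word (Suc i) m"
  by (simp add: tail_word_def upt_conv_Cons)

lemma tail_word_nonempty: "i < m \<Longrightarrow> tail_word i m \<noteq> []"
  by (simp add: tail_word_Cons hole_word_nonempty)

lemma tail_hole_disjoint:
  assumes "\<And>k. k \<in> K \<Longrightarrow> k \<ge> 1 \<and> k \<noteq> m" "m \<ge> 1"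
  shows "(\<Union>k\<in>K. hole_generators b k) \<inter> hole_generators b m = {}"
  using hole_generators_disjoint[of _ m] assms by blast

lemma tail_word_reduced:
  assumes "i \<ge> 1"
  shows "reduced_word (tail_word i m)"
proof (induction m)
  case (Suc m)
  show ?case
  proof (cases "i \<le> m")
    case True
    have "fst ` set (tail_word i m) \<inter> fst ` set (hole_word m) = {}"
      using tail_hole_disjoint[of "{i..<m}" m] assms True by (simp add: tail_word_support hole_word_support)
    then show ?thesis unfolding tail_word_Suc[OF True]
      using reduced_word_append_disjoint Suc hole_word_reduced by blast
  qed (simp add: tail_word_def reduced_word_def)
qed (simp add: tail_word_def reduced_word_def)

lemma tail_word_gens: "i \<ge> 1 \<Longrightarrow> fst ` set (tail_word i n) \<subseteq> gens"
  unfolding gens_holes tail_word_support by (rule UN_mono) auto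

definition "tail i = word_value c (tail_word i n)"

lemma tail_in_G: "i \<ge> 1 \<Longrightarrow> tail i \<in> G"
  unfolding tail_def using word_value_closed[of c "tail_word i n"] tail_word_gens[of i] gens_in_G by blast

lemma hole_product_append:
  assumes "k < m" "m \<le> n"
  shows "hp k ** word_value c (tail_word (Suc k) m) = hp (m - 1)"
  using assms
proof (induction m)
  case (Suc m)
  show ?case
  proof (cases "k = m")
    case True
    then show ?thesis by (simp add: tail_word_def)
  next
    case False
    then have "k < m" using Suc by simp
    then obtain m' where m': "m = Suc m'" by (cases m) auto
    have "hp k ** word_value c (tail_word (Suc k) (Suc m))
        = (hp k ** word_value c (tail_word (Suc k) m)) ** hol m"
      using \<open>k < m\<close> Suc.prems hole_word_value[of m]
      by (simp add: tail_word_Suc word_value_append matrix_mul_assoc)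
    also have "\<dots> = hp (m - 1) ** hol m" using Suc \<open>k < m\<close> by simp
    finally show ?thesis using m' by simp
  qed
qed simp

lemma hole_product_tail:
  assumes "k < n"
  shows "hp k = inv\<^bsub>GL3\<^esub> (tail (Suc k))"
proof -
  have t: "tail (Suc k) \<in> carrier GL3" using tail_in_G in_carrier by simp
  have "hp k ** tail (Suc k) = mat 1"
    using hole_product_append[of k n] assms relation by (simp add: tail_def)
  then have "hp k ** tail (Suc k) = inv\<^bsub>GL3\<^esub> (tail (Suc k)) ** tail (Suc k)"
    using GL3_inv_mult[OF t] by simp
  then show ?thesis using GL3_right_cancel t by blast
qed

lemma hp_in_G: "k < n \<Longrightarrow> hp k \<in> G"
  by (simp add: hole_product_tail tail_in_G inv_closed)

lemma hol_in_G: "i < n \<Longrightarrow> hol i \<in> G"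
proof (cases "i = 0")
  case True
  then show ?thesis using hp_in_G[OF n_pos] by simp
next
  case False
  assume "i < n"
  with False have i: "i \<in> {1..<n}" by simp
  then have "fst ` set (hole_word i) \<subseteq> gens" using hole_generators_gens[OF i] by (simp add: hole_word_support)
  then have "word_value c (hole_word i) \<in> G"
    using word_value_closed[of c "hole_word i"] gens_in_G by blast
  then show ?thesis using hole_word_value[OF i] by simp
qed

text \<open>Up to \<open>n - 2\<close> the complementary tail is a nonempty reduced word, hence
  nontrivial; \<open>hp (n - 1)\<close> is the identity.\<close>

lemma hp_hyperbolic:
  assumes "k \<le> n - 2"
  shows "hyperbolic (hp k)"
proof (rule hyperbolic_G)
  have k: "Suc k < n" using assms n_ge_2 by linarith
  then show "hp k \<in> G" by (intro hp_in_G) simp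
  have "tail (Suc k) \<noteq> mat 1"
    unfolding tail_def
    using freely_generatedD[OF free tail_word_reduced tail_word_nonempty tail_word_gens] k by simp
  moreover have "hp k ** tail (Suc k) = mat 1"
    using hole_product_append[of k n] k relation by (simp add: tail_def)
  ultimately show "hp k \<noteq> mat 1" by auto
qed

lemma hol_hyperbolic:
  assumes "i < n"
  shows "hyperbolic (hol i)"
proof (cases "i = 0")
  case True
  then show ?thesis using hp_hyperbolic[of 0] by simp
next
  case False
  with assms have i: "i \<in> {1..<n}" by simp
  have "word_value c (hole_word i) \<noteq> mat 1"
    using freely_generatedD[OF free hole_word_reduced hole_word_nonempty] hole_generators_gens[OF i] i
    by (simp add: hole_word_support)
  then show ?thesis using hyperbolic_G hol_in_G[OF assms] hole_word_value[OF i] by simp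
qed

lemma gens_hyperbolic:
  assumes "e \<in> gens"
  shows "hyperbolic (c e)"
proof (rule hyperbolic_G)
  show "c e \<in> G" using gens_in_G assms by blast
  have "word_value c [(e, True)] \<noteq> mat 1"
    using assms by (intro freely_generatedD[OF free]) (auto simp: reduced_word_def)
  then show "c e \<noteq> mat 1" by simp
qed

text \<open>\<open>hp (k - 1)\<close> is the inverse of \<open>tail k\<close>, and
  \<open>tail k\<close> is \<open>hol k ** tail (Suc k)\<close>. Commuting with \<open>hol k\<close>
  would therefore pass to \<open>tail (Suc k)\<close>, a word in letters disjoint from those of hole
  k.\<close>

lemma pants_noncommuting:
  assumes "k \<in> {1..n - 2}"
  shows "hp (k - 1) ** hol k \<noteq> hol k ** hp (k - 1)"
proof
  have k: "k \<in> {1..<n}" "Suc k < n" using assms n_ge_2 by auto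
  have c: "tail k \<in> carrier GL3" "hol k \<in> carrier GL3"
    using tail_in_G in_carrier hol_in_G k by auto
  have p: "hp (k - 1) = inv\<^bsub>GL3\<^esub> (tail k)" using hole_product_tail[of "k - 1"] k by simp
  assume "hp (k - 1) ** hol k = hol k ** hp (k - 1)"
  then have "tail k ** (inv\<^bsub>GL3\<^esub> (tail k) ** hol k) ** tail k = tail k ** (hol k ** inv\<^bsub>GL3\<^esub> (tail k)) ** tail k"
    unfolding p by simp
  then have "hol k ** tail k = tail k ** hol k"
    using c by (simp add: GL3_inv_cancel GL3_inv_mult flip: matrix_mul_assoc)
  moreover have "tail k = hol k ** tail (Suc k)"
    using k hole_word_value[of k] by (simp add: tail_def tail_word_Cons word_value_append)
  ultimately have "hol k ** tail (Suc k) = tail (Suc k) ** hol k"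
    using c(2) GL3_left_cancel[of "hol k"] by (metis matrix_mul_assoc)
  moreover have "fst ` set (hole_word k) \<inter> fst ` set (tail_word (Suc k) n) = {}"
    using tail_hole_disjoint[of "{Suc k..<n}" k] k by (simp add: tail_word_support hole_word_support Int_commute)
  ultimately show False
    using disjoint_words_noncommuting[OF free gens_in_carrier hole_word_reduced hole_word_nonempty _
        tail_word_reduced tail_word_nonempty tail_word_gens, of k "Suc k"]
      hole_generators_gens[OF k(1)] k hole_word_value[OF k(1)]
    by (simp add: hole_word_support tail_def)
qed

lemma handle_hole: "j \<in> {1..g} \<Longrightarrow> b + j - 1 \<in> {1..<n}" "j \<in> {1..g} \<Longrightarrow> hole b (b + j - 1) = Sep j"
  "j \<in> {1..g} \<Longrightarrow> hole_generators b (b + j - 1) = {Longitude j, Meridian j}"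
  using b_pos by (auto simp: hole_def hole_generators_def)

lemma torus:
  assumes j: "j \<in> {1..g}"
  shows "once_holed_torus (c (Longitude j)) (c (Meridian j))
    (inv\<^bsub>GL3\<^esub> (c (Longitude j))) (inv\<^bsub>GL3\<^esub> (c (Meridian j)))"
proof
  let ?x = "c (Longitude j)" and ?y = "c (Meridian j)"
  have mem: "Longitude j \<in> gens" "Meridian j \<in> gens" using j by auto
  have carr: "?x \<in> carrier GL3" "?y \<in> carrier GL3" using mem gens_in_carrier by auto
  show "hyperbolic ?x" "hyperbolic ?y" using mem gens_hyperbolic by auto
  show "?x ** inv\<^bsub>GL3\<^esub> ?x = mat 1" "?y ** inv\<^bsub>GL3\<^esub> ?y = mat 1" using carr GL3_inv_mult by auto
  show "lorentz (X_zero ?x) (X_zero ?y) \<noteq> 0" using angle j by blast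
  have C: "hol (b + j - 1) = ?x ** ?y ** inv\<^bsub>GL3\<^esub> ?x ** inv\<^bsub>GL3\<^esub> ?y"
    using handle_hole[OF j] sep[OF j] by (simp add: commutator_def)
  show "hyperbolic (?x ** ?y ** inv\<^bsub>GL3\<^esub> ?x ** inv\<^bsub>GL3\<^esub> ?y)"
    using hol_hyperbolic[of "b + j - 1"] handle_hole(1)[OF j] unfolding C by simp
  show "?x ** ?y \<noteq> ?y ** ?x"
    using disjoint_words_noncommuting[OF free gens_in_carrier, of "[(Longitude j, True)]" "[(Meridian j, True)]"] mem
    by (simp add: reduced_word_def)
  \<comment> \<open>With C = [x, y], the equation xC = Cx becomes xyx^-1y^-1 = yx^-1y^-1x after
    cancelling \<open>?x\<close> on the left. This reduced word is the left side times the inverse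
    of the right.\<close>
  let ?w = "[(Longitude j, True), (Meridian j, True), (Longitude j, False), (Meridian j, False),
    (Longitude j, False), (Meridian j, True), (Longitude j, True), (Meridian j, False)]"
  have w: "word_value c ?w \<noteq> mat 1"
    using mem by (intro freely_generatedD[OF free]) (auto simp: reduced_word_def)
  show "?x ** (?x ** ?y ** inv\<^bsub>GL3\<^esub> ?x ** inv\<^bsub>GL3\<^esub> ?y) \<noteq> ?x ** ?y ** inv\<^bsub>GL3\<^esub> ?x ** inv\<^bsub>GL3\<^esub> ?y ** ?x"
  proof
    assume "?x ** (?x ** ?y ** inv\<^bsub>GL3\<^esub> ?x ** inv\<^bsub>GL3\<^esub> ?y) = ?x ** ?y ** inv\<^bsub>GL3\<^esub> ?x ** inv\<^bsub>GL3\<^esub> ?y ** ?x"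
    then have "?x ** (?x ** (?y ** (inv\<^bsub>GL3\<^esub> ?x ** inv\<^bsub>GL3\<^esub> ?y)))
        = ?x ** (?y ** (inv\<^bsub>GL3\<^esub> ?x ** (inv\<^bsub>GL3\<^esub> ?y ** ?x)))" by (simp add: matrix_mul_assoc)
    then have "?x ** (?y ** (inv\<^bsub>GL3\<^esub> ?x ** inv\<^bsub>GL3\<^esub> ?y)) = ?y ** (inv\<^bsub>GL3\<^esub> ?x ** (inv\<^bsub>GL3\<^esub> ?y ** ?x))"
      using GL3_left_cancel[OF carr(1)] by blast
    then have "(?x ** (?y ** (inv\<^bsub>GL3\<^esub> ?x ** inv\<^bsub>GL3\<^esub> ?y))) ** (inv\<^bsub>GL3\<^esub> ?x ** (?y ** (?x ** inv\<^bsub>GL3\<^esub> ?y)))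
        = (?y ** (inv\<^bsub>GL3\<^esub> ?x ** (inv\<^bsub>GL3\<^esub> ?y ** ?x))) ** (inv\<^bsub>GL3\<^esub> ?x ** (?y ** (?x ** inv\<^bsub>GL3\<^esub> ?y)))"
      by simp
    also have "\<dots> = mat 1"
      using carr by (simp add: GL3_inv_cancel GL3_inv_mult flip: matrix_mul_assoc)
    finally have "word_value c ?w = mat 1" by (simp add: matrix_mul_assoc)
    then show False using w by blast
  qed
qed

lemma cocycle_commutator:
  assumes j: "j \<in> {1..g}" and u: "u \<in> Z1 G"
  shows "u (c (Sep j)) = comm_value (c (Longitude j)) (c (Meridian j))
    (inv\<^bsub>GL3\<^esub> (c (Longitude j))) (inv\<^bsub>GL3\<^esub> (c (Meridian j))) (u (c (Longitude j))) (u (c (Meridian j)))"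
proof -
  let ?x = "c (Longitude j)" and ?y = "c (Meridian j)"
  have G: "?x \<in> G" "?y \<in> G" using j gens_in_G by auto
  show ?thesis
    unfolding sep[OF j] commutator_def
    using G by (simp add: Z1_mult[OF u] mult_closed inv_closed cocycle_inv[OF u] comm_value_def
        matvec matvec_neg flip: matrix_vector_mul_assoc)
qed

lemma hole_coboundary:
  assumes u: "u \<in> Z1 G" and i: "i \<in> {1..<n}"
    and eq: "\<And>e. e \<in> hole_generators b i \<Longrightarrow> u (c e) = coboundary G v (c e)"
  shows "u (hol i) = coboundary G v (hol i)"
proof (cases "i < b")
  case True
  then show ?thesis using eq by (simp add: hole_generators_def)
next
  case False
  then have j: "i + 1 - b \<in> {1..g}" using i by auto
  then show ?thesis
    using False eq cocycle_commutator[OF j u] cocycle_commutator[OF j coboundary_Z1]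
    by (simp add: hole_Sep hole_generators_def)
qed

lemma cocycle_hp_Suc:
  assumes "u \<in> Z1 G" "Suc k < n"
  shows "u (hp (Suc k)) = hp k *v u (hol (Suc k)) + u (hp k)"
  using Z1_mult[OF assms(1) hp_in_G[of k] hol_in_G[of "Suc k"]] assms by simp

lemma cocycle_hp_last: "u \<in> Z1 G \<Longrightarrow> u (hp (n - 1)) = 0"
  unfolding relation by (rule cocycle_one)

text \<open>Vanishing on a product and on its right factor gives vanishing on the left factor.
  Descending from the trivial product reaches hole 0, on which no value is given directly.\<close>

lemma cocycle_hp_descend:
  assumes u: "u \<in> Z1 G" and "u (hp K) = 0" "K < n" "k \<le> K" "\<And>i. k < i \<Longrightarrow> i \<le> K \<Longrightarrow> u (hol i) = 0"
  shows "u (hp k) = 0"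
  using assms(4,5)
proof (induction k rule: inc_induct)
  case base
  show ?case by fact
next
  case (step k)
  then have "u (hp (Suc k)) = 0" by simp
  moreover have "u (hol (Suc k)) = 0" using step by simp
  ultimately show ?case using cocycle_hp_Suc[OF u, of k] step assms(3) by simp
qed

lemma cocycle_eq_on_gens:
  assumes "u \<in> Z1 G" "u' \<in> Z1 G" "\<And>e. e \<in> gens \<Longrightarrow> u (c e) = u' (c e)"
  shows "u h = u' h"
proof (cases "h \<in> G")
  case True
  then have "h \<in> generate GL3 (c ` gens)" using free by (simp add: freely_generated_def)
  then show ?thesis using cocycle_eq_on_generate[OF assms(1,2) gens_in_G] assms(3) by blast
next
  case False
  then show ?thesis using assms by (simp add: Z1_def)
qed

section \<open>Twist cocycles\<close>

text \<open>A model of the affine twist that is 0 on the side containing hole 0. Prescribing it on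
  free generators makes existence immediate.\<close>

definition twist :: "loop \<Rightarrow> mat3 \<Rightarrow> vec3" where
  "twist l = (SOME u. u \<in> Z1 G \<and> (\<forall>e\<in>gens. u (c e) =
     (if e \<in> (\<Union>i\<in>holes_beyond g b l. hole_generators b i) then coboundary G (X_zero (c l)) (c e) else 0)))"

lemma twist:
  shows twist_Z1: "twist l \<in> Z1 G"
    and twist_gens: "e \<in> gens \<Longrightarrow> twist l (c e) =
      (if e \<in> (\<Union>i\<in>holes_beyond g b l. hole_generators b i) then coboundary G (X_zero (c l)) (c e) else 0)"
proof -
  let ?P = "\<lambda>u. u \<in> Z1 G \<and> (\<forall>e\<in>gens. u (c e) =
     (if e \<in> (\<Union>i\<in>holes_beyond g b l. hole_generators b i) then coboundary G (X_zero (c l)) (c e) else 0))"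
  have "\<exists>u. ?P u" by (rule free_cocycle[OF free gens_in_carrier])
  then have "?P (twist l)" unfolding twist_def by (rule someI_ex)
  then show "twist l \<in> Z1 G" "e \<in> gens \<Longrightarrow> twist l (c e) =
      (if e \<in> (\<Union>i\<in>holes_beyond g b l. hole_generators b i) then coboundary G (X_zero (c l)) (c e) else 0)"
    by blast+
qed

lemma cutting_loops_cases:
  assumes "l \<in> cutting_loops g b"
  obtains j where "l = Sep j" "j \<in> {1..g}" "n \<ge> 3" | k where "l = Cut k" "k \<in> {1..n - 3}" "n \<ge> 3"
proof -
  have "n \<ge> 3" using assms nonsporadic b_pos by (auto simp: cutting_loops_def split: if_splits)
  then show thesis using assms that by (auto simp: cutting_loops_def add.commute split: if_splits)
qed

lemma holes_beyond_range: "l \<in> cutting_loops g b \<Longrightarrow> holes_beyond g b l \<subseteq> {1..<n}"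
  using b_pos by (elim cutting_loops_cases) auto

lemma twist_hole_gens:
  assumes "l \<in> cutting_loops g b" "i \<in> {1..<n}" "e \<in> hole_generators b i"
  shows "twist l (c e) = coboundary G (if i \<in> holes_beyond g b l then X_zero (c l) else 0) (c e)"
proof -
  have "e \<in> gens" using assms hole_generators_gens by blast
  moreover have "e \<in> (\<Union>i\<in>holes_beyond g b l. hole_generators b i) \<longleftrightarrow> i \<in> holes_beyond g b l"
    using assms hole_generators_disjoint[of i] holes_beyond_range[OF assms(1)] by fastforce
  ultimately show ?thesis by (simp add: twist_gens coboundary_zero)
qed

lemma twist_hol:
  assumes "l \<in> cutting_loops g b" "i \<in> {1..<n}"
  shows "twist l (hol i) = coboundary G (if i \<in> holes_beyond g b l then X_zero (c l) else 0) (hol i)"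
  using hole_coboundary[OF twist_Z1 assms(2)] twist_hole_gens[OF assms] by blast

lemma coboundary_fixed: "h *v v = v \<Longrightarrow> coboundary G v h = 0"
  by (simp add: coboundary_def)

lemma Cut_hp: "k \<in> {1..n - 3} \<Longrightarrow> c (Cut k) = hp k"
  using cut[of k] by (simp add: add.commute)

lemma Cut_range: "k \<in> {1..n - 3} \<Longrightarrow> k \<le> n - 2" "k \<in> {1..n - 3} \<Longrightarrow> k < n"
  by auto

text \<open>For \<open>Sep j\<close> the twist vanishes on every hole, since a coboundary of X_c
  vanishes on c itself. For \<open>Cut k\<close> the difference to the coboundary of X_c descends as
  0 from the trivial product to \<open>hp k\<close>; there the coboundary vanishes too, and below it
  the twist itself descends as 0.\<close>

lemma twist_hp:
  assumes l: "l \<in> cutting_loops g b" and k: "k < n"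
  shows "\<exists>v. twist l (hp k) = coboundary G v (hp k)" and "twist l (hp 0) = 0"
proof -
  show "twist l (hp 0) = 0"
    using l
  proof (cases rule: cutting_loops_cases)
    case (1 j)
    have zero: "twist l (hol i) = 0" if "i \<in> {1..<n}" for i
    proof (cases "i = b + j - 1")
      case True
      then have "hol i = c l" using 1 handle_hole(2) by simp
      moreover have "hyperbolic (c l)" using hol_hyperbolic[of i] that calculation by simp
      ultimately show ?thesis
        using twist_hol[OF l that] by (simp add: coboundary_fixed hyperbolic_X_zero coboundary_zero)
    qed (use 1 twist_hol[OF l that] in \<open>simp add: coboundary_zero\<close>)
    show ?thesis
      by (rule cocycle_hp_descend[OF twist_Z1 cocycle_hp_last[OF twist_Z1]]) (use n_ge_2 zero in auto)
  next
    case (2 k)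
    let ?d = "\<lambda>h. twist l h - coboundary G (X_zero (c l)) h"
    have d: "?d \<in> Z1 G" by (intro Z1_diff twist_Z1 coboundary_Z1)
    have "?d (hp k) = 0"
      by (rule cocycle_hp_descend[OF d cocycle_hp_last[OF d]]) (use 2 twist_hol[OF l] in auto)
    moreover have "hyperbolic (c l)" using hp_hyperbolic[of k] 2 Cut_hp[of k] Cut_range by simp
    ultimately have "twist l (hp k) = 0"
      using 2 Cut_hp[of k] by (simp add: coboundary_fixed hyperbolic_X_zero)
    then show ?thesis
      by (rule cocycle_hp_descend[OF twist_Z1]) (use 2 twist_hol[OF l] in \<open>auto simp: coboundary_zero\<close>)
  qed
  show "\<exists>v. twist l (hp k) = coboundary G v (hp k)"
    using l
  proof (cases rule: cutting_loops_cases)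
    case (1 j)
    have "twist l (hp k) = 0"
    proof (rule cocycle_hp_descend[OF twist_Z1 cocycle_hp_last[OF twist_Z1]])
      fix i assume i: "k < i" "i \<le> n - 1"
      show "twist l (hol i) = 0"
      proof (cases "i = b + j - 1")
        case True
        then have "hol i = c l" using 1 handle_hole(2) by simp
        moreover have "hyperbolic (c l)" using hol_hyperbolic[of i] i k calculation by simp
        ultimately show ?thesis
          using twist_hol[OF l, of i] i k by (simp add: coboundary_fixed hyperbolic_X_zero coboundary_zero)
      qed (use 1 twist_hol[OF l, of i] i k in \<open>simp add: coboundary_zero\<close>)
    qed (use k in auto)
    then show ?thesis by (intro exI[of _ 0]) (simp add: coboundary_zero)
  next
    case (2 k0)
    let ?d = "\<lambda>h. twist l h - coboundary G (X_zero (c l)) h"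
    have d: "?d \<in> Z1 G" by (intro Z1_diff twist_Z1 coboundary_Z1)
    have beyond: "?d (hp i) = 0" if "k0 \<le> i" "i < n" for i
      by (rule cocycle_hp_descend[OF d cocycle_hp_last[OF d]]) (use that 2 twist_hol[OF l] in auto)
    show ?thesis
    proof (cases "k0 \<le> k")
      case True
      then show ?thesis using beyond[of k] k by (intro exI[of _ "X_zero (c l)"]) simp
    next
      case False
      have "hyperbolic (c l)" using hp_hyperbolic[of k0] 2 Cut_hp[of k0] Cut_range by simp
      then have "twist l (hp k0) = 0"
        using beyond[of k0] 2 Cut_hp[of k0] Cut_range[of k0] by (simp add: coboundary_fixed hyperbolic_X_zero)
      then have "twist l (hp k) = 0"
        by (rule cocycle_hp_descend[OF twist_Z1])
          (use 2 False twist_hol[OF l] in \<open>auto simp: coboundary_zero\<close>)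
      then show ?thesis by (intro exI[of _ 0]) (simp add: coboundary_zero)
    qed
  qed
qed

text \<open>Sorts the curves by how cocycle values on them are computed. The case of hole 0 needs
  \<open>n \<ge> 3\<close>: on the once-holed torus the boundary is listed as \<open>Sep 1\<close>,
  that is hole 1.\<close>

lemma loops_cases:
  assumes "l \<in> loops g b"
  obtains (gen) "l \<in> gens" | (hol) i where "i \<in> {1..<n}" "l = hole b i"
  | (first) "n \<ge> 3" "l = hole b 0" "c l = hp 0" | (cut) k where "l = Cut k" "k \<in> {1..n - 3}" "c l = hp k"
proof (cases "g = 1 \<and> b = 1")
  case True
  then have "l \<in> gens \<or> l = hole b 1" using assms by (auto simp: loops_def hole_def)
  then show thesis using gen hol[of 1] True by auto
next
  case False
  then have n: "n \<ge> 3" using nonsporadic b_pos by linarith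
  consider i where "l = Boundary i" "i \<in> {1..b}" | j where "l = Sep j" "j \<in> {1..g}"
    | k where "l = Cut k" "k \<in> {1..n - 3}" | "l \<in> gens"
    using assms False by (auto simp: loops_def add.commute)
  then show thesis
  proof cases
    case (1 i)
    show thesis
    proof (cases "i = b")
      case True
      then show thesis using first n 1 by (simp add: hole_def)
    next
      case False
      then show thesis using gen 1 by auto
    qed
  next
    case (2 j)
    then show thesis using hol handle_hole[OF 2(2)] by simp
  next
    case (3 k)
    then show thesis using cut Cut_hp by simp
  next
    case 4
    then show thesis using gen by simp
  qed
qed

lemma loops_hyperbolic:
  assumes "l \<in> loops g b"
  shows "hyperbolic (c l)"
  using assms
proof (cases rule: loops_cases)
  case gen
  then show ?thesis by (rule gens_hyperbolic)
next
  case (hol i)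
  then show ?thesis using hol_hyperbolic by simp
next
  case first
  then show ?thesis using hol_hyperbolic[OF n_pos] by simp
next
  case (cut k)
  then show ?thesis using hp_hyperbolic[of k] Cut_range by simp
qed

lemma loops_in_G:
  assumes "l \<in> loops g b"
  shows "c l \<in> G"
  using assms
proof (cases rule: loops_cases)
  case gen
  then show ?thesis using gens_in_G by blast
next
  case (hol i)
  then show ?thesis using hol_in_G by simp
next
  case first
  then show ?thesis using hol_in_G[OF n_pos] by simp
next
  case (cut k)
  then show ?thesis using hp_in_G[of k] Cut_range by simp
qed

lemma margulis_coboundary:
  assumes "l \<in> loops g b"
  shows "margulis (coboundary G v) (c l) = 0"
  using lorentz_coboundary[OF loops_hyperbolic[OF assms]] loops_in_G[OF assms]
  by (simp add: margulis_def coboundary_def)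

lemma margulis_twist:
  assumes l: "l \<in> cutting_loops g b" and m: "m \<in> loops g b"
  shows "margulis (twist l) (c m) = 0"
proof -
  have "\<exists>v. twist l (c m) = coboundary G v (c m)"
    using m
  proof (cases rule: loops_cases)
    case gen
    then show ?thesis using twist_hole_gens[OF l] unfolding gens_holes by blast
  next
    case (hol i)
    then show ?thesis using twist_hol[OF l] by blast
  next
    case first
    then show ?thesis using twist_hp(1)[OF l n_pos] by simp
  next
    case (cut k)
    then show ?thesis using twist_hp(1)[OF l, of k] Cut_range by simp
  qed
  then show ?thesis using margulis_coboundary[OF m] by (auto simp: margulis_def)
qed

section \<open>Cocycles with vanishing Margulis invariants\<close>

definition twist_comb :: "vec3 \<Rightarrow> (loop \<Rightarrow> real) \<Rightarrow> mat3 \<Rightarrow> vec3" where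
  "twist_comb v t h = coboundary G v h + (\<Sum>l\<in>cutting_loops g b. t l *\<^sub>R twist l h)"

lemma twist_comb_Z1: "twist_comb v t \<in> Z1 G"
  unfolding twist_comb_def by (intro Z1_add coboundary_Z1 Z1_sum Z1_scale twist_Z1)

text \<open>On the pair of pants \<open>P\<^sub>i\<close>, resp. on the torus at hole \<open>i\<close>, a combination of twists is the
  coboundary of the following vector.\<close>

definition pants_vector :: "vec3 \<Rightarrow> (loop \<Rightarrow> real) \<Rightarrow> nat \<Rightarrow> vec3" where
  "pants_vector v t i = v + (\<Sum>k\<in>{1..n - 3} \<inter> {..<i}. t (Cut k) *\<^sub>R X_zero (c (Cut k)))"

definition hole_vector :: "vec3 \<Rightarrow> (loop \<Rightarrow> real) \<Rightarrow> nat \<Rightarrow> vec3" where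
  "hole_vector v t i = pants_vector v t i +
     (if i < b then 0 else t (hole b i) *\<^sub>R X_zero (hol i))"

lemma pants_vector_1: "pants_vector v t (Suc 0) = v"
proof -
  have "{1..n - 3} \<inter> {..<Suc 0} = {}" by auto
  then show ?thesis unfolding pants_vector_def by simp
qed

lemma pants_vector_Suc:
  "pants_vector v t (Suc i) = pants_vector v t i + (if i \<in> {1..n - 3} then t (Cut i) *\<^sub>R X_zero (c (Cut i)) else 0)"
proof (cases "i \<in> {1..n - 3}")
  case True
  then have "{1..n - 3} \<inter> {..<Suc i} = insert i ({1..n - 3} \<inter> {..<i})" by auto
  then show ?thesis using True by (simp add: pants_vector_def algebra_simps)
next
  case False
  then have "{1..n - 3} \<inter> {..<Suc i} = {1..n - 3} \<inter> {..<i}" by (auto simp: less_Suc_eq)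
  then show ?thesis using False unfolding pants_vector_def by (simp only: if_False) simp
qed

lemma sum_cutting_loops:
  fixes f :: "loop \<Rightarrow> vec3"
  assumes "n \<ge> 3"
  shows "(\<Sum>l\<in>cutting_loops g b. f l) = (\<Sum>j\<in>{1..g}. f (Sep j)) + (\<Sum>k\<in>{1..n - 3}. f (Cut k))"
proof -
  have "cutting_loops g b = Sep ` {1..g} \<union> Cut ` {1..n - 3}"
    using assms by (auto simp: cutting_loops_def add.commute)
  moreover have "(\<Sum>l\<in>Sep ` {1..g} \<union> Cut ` {1..n - 3}. f l)
      = (\<Sum>l\<in>Sep ` {1..g}. f l) + (\<Sum>l\<in>Cut ` {1..n - 3}. f l)"
    by (rule sum.union_disjoint) auto
  ultimately show ?thesis by (simp add: sum.reindex inj_on_def)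
qed

lemma cutting_loopsI: "n \<ge> 3 \<Longrightarrow> j \<in> {1..g} \<Longrightarrow> Sep j \<in> cutting_loops g b"
  "n \<ge> 3 \<Longrightarrow> k \<in> {1..n - 3} \<Longrightarrow> Cut k \<in> cutting_loops g b"
  by (auto simp: cutting_loops_def add.commute)

text \<open>On hole i the twist along \<open>Sep j\<close> acts only when hole i is the j-th torus,
  and that along \<open>Cut k\<close> only when k < i. The two sums thus collapse to the summands of
  \<open>hole_vector\<close>.\<close>

lemma twist_comb_hole_gens:
  assumes n: "n \<ge> 3" and i: "i \<in> {1..<n}" and e: "e \<in> hole_generators b i"
  shows "twist_comb v t (c e) = coboundary G (hole_vector v t i) (c e)"
proof -
  let ?\<delta> = "\<lambda>v. coboundary G v (c e)"
  have "(\<Sum>j\<in>{1..g}. t (Sep j) *\<^sub>R twist (Sep j) (c e))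
      = (\<Sum>j\<in>{1..g}. if j = i + 1 - b then (if b \<le> i then ?\<delta> (t (Sep j) *\<^sub>R X_zero (c (Sep j))) else 0) else 0)"
  proof (rule sum.cong[OF refl])
    fix j assume j: "j \<in> {1..g}"
    have "i = b + j - 1 \<longleftrightarrow> j = i + 1 - b \<and> b \<le> i" using j b_pos by auto
    then show "t (Sep j) *\<^sub>R twist (Sep j) (c e)
      = (if j = i + 1 - b then (if b \<le> i then ?\<delta> (t (Sep j) *\<^sub>R X_zero (c (Sep j))) else 0) else 0)"
      using twist_hole_gens[OF cutting_loopsI(1)[OF n j] i e]
      by (auto simp: coboundary_scale coboundary_zero)
  qed
  also have "\<dots> = ?\<delta> (if i < b then 0 else t (hole b i) *\<^sub>R X_zero (hol i))"
    using i by (subst sum.delta) (auto simp: hole_Sep coboundary_zero)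
  finally have S: "(\<Sum>j\<in>{1..g}. t (Sep j) *\<^sub>R twist (Sep j) (c e))
      = ?\<delta> (if i < b then 0 else t (hole b i) *\<^sub>R X_zero (hol i))" .
  have "(\<Sum>k\<in>{1..n - 3}. t (Cut k) *\<^sub>R twist (Cut k) (c e))
      = (\<Sum>k\<in>{1..n - 3}. if k \<in> {..<i} then ?\<delta> (t (Cut k) *\<^sub>R X_zero (c (Cut k))) else 0)"
  proof (rule sum.cong[OF refl])
    fix k assume k: "k \<in> {1..n - 3}"
    show "t (Cut k) *\<^sub>R twist (Cut k) (c e) = (if k \<in> {..<i} then ?\<delta> (t (Cut k) *\<^sub>R X_zero (c (Cut k))) else 0)"
      using twist_hole_gens[OF cutting_loopsI(2)[OF n k] i e] i
      by (auto simp: coboundary_scale coboundary_zero)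
  qed
  also have "\<dots> = ?\<delta> (\<Sum>k\<in>{1..n - 3} \<inter> {..<i}. t (Cut k) *\<^sub>R X_zero (c (Cut k)))"
    by (auto simp: sum.inter_restrict coboundary_sum coboundary_zero intro!: sum.cong)
  finally show ?thesis
    using S by (simp only: twist_comb_def sum_cutting_loops[OF n] hole_vector_def pants_vector_def coboundary_add)
      (simp add: algebra_simps)
qed

text \<open>The torus and pants vectors at hole i differ by a multiple of the axis of their common
  curve, invisible on that curve.\<close>

lemma twist_comb_hol:
  assumes n: "n \<ge> 3" and i: "i \<in> {1..<n}"
  shows "twist_comb v t (hol i) = coboundary G (pants_vector v t i) (hol i)"
proof -
  have "twist_comb v t (hol i) = coboundary G (hole_vector v t i) (hol i)"
    using hole_coboundary[OF twist_comb_Z1 i] twist_comb_hole_gens[OF n i] by blast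
  also have "\<dots> = coboundary G (pants_vector v t i) (hol i)"
    using hyperbolic_X_zero(1)[OF hol_hyperbolic[of i]] i
    by (simp add: hole_vector_def coboundary_add coboundary_scale coboundary_zero coboundary_fixed)
  finally show ?thesis .
qed

lemma twist_comb_first:
  shows "twist_comb v t (hol 0) = coboundary G v (hol 0)"
  using twist_hp(2)[OF _ n_pos] by (simp add: twist_comb_def)

text \<open>The vector on each pair of pants is fixed by two noncommuting boundary elements and
  vanishes. Going along the chain, each new vector is a multiple of the axis of the curve just
  crossed, so its twist coefficient vanishes as well.\<close>

lemma twist_comb_zero_imp:
  assumes t: "t \<in> coord_space (cutting_loops g b)" and zero: "\<And>h. twist_comb v t h = 0"
  shows "t = (\<lambda>_. 0)"
proof (cases "n \<ge> 3")
  case False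
  then have "g = 1 \<and> b = 1" using nonsporadic b_pos by linarith
  then show ?thesis using t by (auto simp: coord_space_def cutting_loops_def)
next
  case n: True
  let ?V = "pants_vector v t"
  have fixed: "hol i *v ?V i = ?V i" if "i \<in> {1..<n}" for i
    using twist_comb_hol[OF n that, of v t] zero hol_in_G[of i] that by (simp add: coboundary_def)
  have v: "hol 0 *v v = v"
    using twist_comb_first[of v t] zero hol_in_G[OF n_pos] by (simp add: coboundary_def)
  have V0: "?V (Suc k) = 0" if "Suc k \<le> n - 2" for k
    using that
  proof (induction k)
    case 0
    have "v = 0"
      using noncommuting_common_fixed[OF hp_hyperbolic[of 0] hol_hyperbolic[of 1]]
        pants_noncommuting[of 1] n v fixed[of 1] pants_vector_1 by simp
    then show ?case by (simp add: pants_vector_1)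
  next
    case (Suc k)
    have k: "Suc k \<in> {1..n - 3}" using Suc by auto
    have "?V (Suc (Suc k)) = t (Cut (Suc k)) *\<^sub>R X_zero (hp (Suc k))"
      using Suc k Cut_hp[OF k] pants_vector_Suc[of v t "Suc k"] by simp
    then have "hp (Suc k) *v ?V (Suc (Suc k)) = ?V (Suc (Suc k))"
      using hyperbolic_X_zero(1)[OF hp_hyperbolic[of "Suc k"]] k by (simp add: matvec del: hole_product.simps)
    moreover have "hol (Suc (Suc k)) *v ?V (Suc (Suc k)) = ?V (Suc (Suc k))"
      using fixed Suc by simp
    moreover have "hp (Suc k) ** hol (Suc (Suc k)) \<noteq> hol (Suc (Suc k)) ** hp (Suc k)"
      using pants_noncommuting[of "Suc (Suc k)"] Suc by simp
    ultimately show ?case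
      using noncommuting_common_fixed[OF hp_hyperbolic[of "Suc k"] hol_hyperbolic[of "Suc (Suc k)"]] Suc by simp
  qed
  have cut0: "t (Cut k) = 0" if k: "k \<in> {1..n - 3}" for k
  proof -
    have "?V (Suc k) = 0" "?V k = 0" using V0[of k] V0[of "k - 1"] k by auto
    then have "t (Cut k) *\<^sub>R X_zero (hp k) = 0" using k pants_vector_Suc[of v t k] Cut_hp[OF k] by simp
    then show ?thesis using hyperbolic_X_zero(3)[OF hp_hyperbolic[of k]] Cut_range[OF k] by simp
  qed
  have V: "?V i = 0" if "i \<in> {1..<n}" for i
  proof (cases "i \<le> n - 2")
    case True
    then show ?thesis using V0[of "i - 1"] that by simp
  next
    case False
    \<comment> \<open>The last pair of pants carries both last holes: no curve
      \<open>Cut (n - 2)\<close> separates them, so the vector stays the same.\<close>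
    then have "i = Suc (n - 2)" using that by auto
    moreover have "n - 2 = Suc (n - 3)" "n - 2 \<notin> {1..n - 3}" using n by auto
    ultimately show ?thesis using V0[of "n - 3"] pants_vector_Suc[of v t "n - 2"] by (simp only: if_False) simp
  qed
  \<comment> \<open>With the pants vectors gone, only a multiple of the axis of g^j is left on the
    torus, and it is fixed by the noncommuting w_1 and w_2.\<close>
  have sep0: "t (Sep j) = 0" if j: "j \<in> {1..g}" for j
  proof -
    let ?i = "b + j - 1"
    interpret once_holed_torus "c (Longitude j)" "c (Meridian j)"
      "inv\<^bsub>GL3\<^esub> (c (Longitude j))" "inv\<^bsub>GL3\<^esub> (c (Meridian j))" by (rule torus[OF j])
    have hv: "hole_vector v t ?i = t (Sep j) *\<^sub>R X_zero (c (Sep j))"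
      using V[OF handle_hole(1)[OF j]] handle_hole(2)[OF j] j by (auto simp: hole_vector_def)
    have "c e *v (t (Sep j) *\<^sub>R X_zero (c (Sep j))) = t (Sep j) *\<^sub>R X_zero (c (Sep j))"
      if "e \<in> {Longitude j, Meridian j}" for e
    proof -
      have "e \<in> gens" using that j by auto
      then have "c e \<in> G" using gens_in_G by blast
      moreover have "twist_comb v t (c e) = coboundary G (t (Sep j) *\<^sub>R X_zero (c (Sep j))) (c e)"
        using twist_comb_hole_gens[OF n handle_hole(1)[OF j], of e v t] that
        unfolding handle_hole(3)[OF j] hv by blast
      ultimately show ?thesis using zero by (simp add: coboundary_def)
    qed
    then have "t (Sep j) *\<^sub>R X_zero (c (Sep j)) = 0"
      using noncommuting_common_fixed[OF x y nc] by blast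
    moreover have "hyperbolic (c (Sep j))"
      using hol_hyperbolic[of ?i] handle_hole[OF j] by simp
    ultimately show ?thesis using hyperbolic_X_zero(3) by simp
  qed
  show ?thesis
  proof
    fix l
    show "t l = 0"
    proof (cases "l \<in> cutting_loops g b")
      case True
      then show ?thesis by (cases rule: cutting_loops_cases) (use cut0 sep0 in auto)
    qed (use t in \<open>simp add: coord_space_def\<close>)
  qed
qed


lemma cocycle_hp_ascend:
  assumes u: "u \<in> Z1 G" and "k < n - 1" "u (hp k) = 0"
  shows "u (hol (Suc k)) = 0 \<longleftrightarrow> u (hp (Suc k)) = 0"
proof -
  have k: "Suc k < n" using assms by simp
  have "hp k *v u (hol (Suc k)) = 0 \<longleftrightarrow> u (hol (Suc k)) = 0"
    using GL3_inv_cancel(3)[of "hp k"] hp_in_G[of k] in_carrier k by (metis Suc_lessD matrix_vector_mult_0_right)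
  then show ?thesis using cocycle_hp_Suc[OF u k] assms(3) by simp
qed

lemma pants_coboundary:
  assumes u: "u \<in> Z1 G" and k: "k \<in> {1..n - 2}"
    and m: "lorentz (u (hp (k - 1))) (X_zero (hp (k - 1))) = 0" "lorentz (u (hol k)) (X_zero (hol k)) = 0"
      "lorentz (u (hp k)) (X_zero (hp k)) = 0"
  shows "\<exists>v. u (hp (k - 1)) = coboundary G v (hp (k - 1)) \<and> u (hol k) = coboundary G v (hol k)"
proof -
  obtain k' where k': "k = Suc k'" using k by (cases k) auto
  have lt: "Suc k' < n" "k' \<le> n - 2" "Suc k' \<le> n - 2" using k k' n_ge_2 by auto
  have "lorentz (u (hp k') + hp k' *v u (hol k)) (X_zero (hp k' ** hol k)) = 0"
    using m(3) cocycle_hp_Suc[OF u lt(1)] by (simp add: k' add.commute)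
  then obtain v where "u (hp k') = v - hp k' *v v" "u (hol k) = v - hol k *v v"
    using pants_rigid[OF hp_hyperbolic[OF lt(2)] hol_hyperbolic[of k], of "u (hp k')" "u (hol k)"]
      hp_hyperbolic[OF lt(3)] pants_noncommuting[OF k] m lt by (auto simp: k')
  then show ?thesis
    using hp_in_G[of k'] hol_in_G[of k] lt by (intro exI[of _ v]) (auto simp: k' coboundary_def)
qed

lemma torus_coboundary:
  assumes u: "u \<in> Z1 G" and j: "j \<in> {1..g}"
    and m: "margulis u (c (Longitude j)) = 0" "margulis u (c (Meridian j)) = 0" "margulis u (c (Sep j)) = 0"
  shows "\<exists>v. \<forall>e\<in>{Longitude j, Meridian j}. u (c e) = coboundary G v (c e)"
proof -
  interpret once_holed_torus "c (Longitude j)" "c (Meridian j)"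
    "inv\<^bsub>GL3\<^esub> (c (Longitude j))" "inv\<^bsub>GL3\<^esub> (c (Meridian j))" by (rule torus[OF j])
  have G: "c (Longitude j) \<in> G" "c (Meridian j) \<in> G" using j gens_in_G by auto
  have "c (Sep j) = C" by (simp add: sep[OF j] commutator_def C_def)
  then obtain v where "u (c (Longitude j)) = v - c (Longitude j) *v v" "u (c (Meridian j)) = v - c (Meridian j) *v v"
    using torus_rigid m cocycle_commutator[OF j u] unfolding margulis_def by metis
  then show ?thesis using G by (intro exI[of _ v]) (simp add: coboundary_def)
qed

lemma coboundary_eq_fixed:
  assumes "h \<in> G" "hyperbolic h" "coboundary G v h = coboundary G w h"
  obtains r where "w = v + r *\<^sub>R X_zero h"
proof -
  have "h *v (w - v) = w - v" using assms by (simp add: coboundary_def matvec algebra_simps)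
  then obtain r where "w - v = r *\<^sub>R X_zero h" using hyperbolic_fixed assms(2) by blast
  then show thesis using that[of r] by (simp add: algebra_simps)
qed

lemma hp_last_inverse: "hol (n - 1) ** hp (n - 2) = mat 1"
proof -
  have "hp (n - 2) ** hol (n - 1) = mat 1"
  proof -
    have "n - 1 = Suc (n - 2)" using n_ge_2 by linarith
    then show ?thesis using relation by (metis hole_product.simps(2))
  qed
  then show ?thesis using matrix_left_right_inverse by blast
qed

lemma X_zero_last: "X_zero (hol (n - 1)) = - X_zero (hp (n - 2))"
  using X_zero_inverse[OF hp_hyperbolic hol_hyperbolic hp_last_inverse] n_ge_2 by simp

text \<open>The last hole is inverse to \<open>hp (n - 2)\<close>, and the hypothesis is the cocycle
  rule for a trivial product. The sign changes of value and axis cancel, as in Mar(h^-1) =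
  Mar(h).\<close>

lemma lorentz_last:
  assumes "hp (n - 2) *v z = - w"
  shows "lorentz z (X_zero (hol (n - 1))) = lorentz w (X_zero (hp (n - 2)))"
proof -
  have h: "hyperbolic (hp (n - 2))" by (rule hp_hyperbolic) simp
  have "lorentz z (X_zero (hp (n - 2))) = lorentz (hp (n - 2) *v z) (hp (n - 2) *v X_zero (hp (n - 2)))"
    by (simp add: lorentz_isometry[OF hyperbolic_isometry[OF h]])
  then show ?thesis
    unfolding X_zero_last assms hyperbolic_X_zero(1)[OF h] by (simp add: lorentz_bilinear)
qed

lemma cocycle_last:
  assumes u: "u \<in> Z1 G"
  shows "hp (n - 2) *v u (hol (n - 1)) = - u (hp (n - 2))"
proof -
  have s: "n - 1 = Suc (n - 2)" using n_ge_2 by linarith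
  have "Suc (n - 2) < n" using n_ge_2 by linarith
  from cocycle_hp_Suc[OF u this] have "u (hp (n - 1)) = hp (n - 2) *v u (hol (n - 1)) + u (hp (n - 2))"
    unfolding s .
  then show ?thesis unfolding cocycle_hp_last[OF u] by (simp add: eq_neg_iff_add_eq_0)
qed

lemma hole_in_loops:
  assumes "i < n" "n \<ge> 3 \<or> i \<noteq> 0"
  shows "hole b i \<in> loops g b"
proof -
  consider "i = 0" "\<not> (g = 1 \<and> b = 1)" | "i = 1" "g = 1" "b = 1" | "i \<noteq> 0" "\<not> (g = 1 \<and> b = 1)"
    using assms by linarith
  then show ?thesis
  proof cases
    case 1
    then show ?thesis using b_pos by (simp add: hole_def loops_def)
  next
    case 2
    then show ?thesis by (simp add: hole_def loops_def)
  next
    case 3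
    show ?thesis
    proof (cases "i < b")
      case False
      then have "i + 1 - b \<in> {1..g}" using assms(1) by auto
      then show ?thesis unfolding loops_def if_not_P[OF 3(2)] hole_Sep[OF leI[OF False]] by blast
    qed (use 3 in \<open>simp add: loops_def hole_def\<close>)
  qed
qed

lemma loopsI: "j \<in> {1..g} \<Longrightarrow> Longitude j \<in> loops g b" "j \<in> {1..g} \<Longrightarrow> Meridian j \<in> loops g b"
  "j \<in> {1..g} \<Longrightarrow> Sep j \<in> loops g b" "k \<in> {1..n - 3} \<Longrightarrow> Cut k \<in> loops g b"
  by (auto simp: loops_def add.commute)

text \<open>Only the inner partial products are cutting curves. At the ends of the chain they are
  hole 0 and the inverse of the last hole, whose invariants are prescribed as well.\<close>

lemma hp_margulis_zero:
  assumes u: "u \<in> Z1 G" and m: "\<And>l. l \<in> loops g b \<Longrightarrow> margulis u (c l) = 0" and n: "n \<ge> 3" and k: "k \<le> n - 2"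
  shows "lorentz (u (hp k)) (X_zero (hp k)) = 0"
proof -
  consider "k = 0" | "k = n - 2" | "k \<in> {1..n - 3}"
    using k n unfolding atLeastAtMost_iff by linarith
  then show ?thesis
  proof cases
    case 1
    then show ?thesis using m[OF hole_in_loops[of 0]] n n_pos by (simp add: margulis_def)
  next
    case 2
    have "margulis u (hol (n - 1)) = 0" using m[OF hole_in_loops[of "n - 1"]] n by simp
    then show ?thesis
      using lorentz_last[OF cocycle_last[OF u]] unfolding 2 by (simp add: margulis_def)
  next
    case 3
    then show ?thesis using m[OF loopsI(4)[OF 3]] Cut_hp[OF 3] by (simp add: margulis_def)
  qed
qed

text \<open>The vanishing invariants make the cocycle a coboundary on every piece; the vectors of
  neighbouring pieces differ by a multiple of the axis of their common curve, which is the twist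
  coefficient.\<close>

lemma margulis_zero_imp_twist_comb:
  assumes u: "u \<in> Z1 G" and m: "\<And>l. l \<in> loops g b \<Longrightarrow> margulis u (c l) = 0"
  obtains v t where "t \<in> coord_space (cutting_loops g b)" "u = twist_comb v t"
proof -
  have "\<forall>j\<in>{1..g}. \<exists>v. \<forall>e\<in>{Longitude j, Meridian j}. u (c e) = coboundary G v (c e)"
    using torus_coboundary[OF u] m loopsI by blast
  then obtain vt where vt: "\<And>j e. j \<in> {1..g} \<Longrightarrow> e \<in> {Longitude j, Meridian j} \<Longrightarrow> u (c e) = coboundary G (vt j) (c e)"
    by metis
  show thesis
  proof (cases "n \<ge> 3")
    case False
    then have 1: "g = 1" "b = 1" using nonsporadic b_pos by auto
    have "u h = twist_comb (vt 1) (\<lambda>_. 0) h" for h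
    proof (rule cocycle_eq_on_gens[OF u twist_comb_Z1])
      fix e assume "e \<in> gens"
      then have "e \<in> {Longitude 1, Meridian 1}" using 1 by auto
      then have "u (c e) = coboundary G (vt 1) (c e)" using vt[of 1 e] 1 by simp
      then show "u (c e) = twist_comb (vt 1) (\<lambda>_. 0) (c e)" by (simp add: twist_comb_def)
    qed
    then have "u = twist_comb (vt 1) (\<lambda>_. 0)" by blast
    moreover have "(\<lambda>_. 0) \<in> coord_space (cutting_loops g b)" by (simp add: coord_space_def)
    ultimately show thesis using that by blast
  next
    case n: True
    have "\<forall>k\<in>{1..n - 2}. \<exists>v. u (hp (k - 1)) = coboundary G v (hp (k - 1)) \<and> u (hol k) = coboundary G v (hol k)"
    proof
      fix k assume k: "k \<in> {1..n - 2}"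
      then have "k < n" "k - 1 \<le> n - 2" by auto
      then have "margulis u (hol k) = 0" using m[OF hole_in_loops[of k]] n by simp
      then show "\<exists>v. u (hp (k - 1)) = coboundary G v (hp (k - 1)) \<and> u (hol k) = coboundary G v (hol k)"
        using pants_coboundary[OF u k] hp_margulis_zero[OF u m n, of "k - 1"] hp_margulis_zero[OF u m n, of k] k
          \<open>k - 1 \<le> n - 2\<close>
        by (simp add: margulis_def)
    qed
    then obtain vp where vp: "\<And>k. k \<in> {1..n - 2} \<Longrightarrow> u (hp (k - 1)) = coboundary G (vp k) (hp (k - 1))"
      "\<And>k. k \<in> {1..n - 2} \<Longrightarrow> u (hol k) = coboundary G (vp k) (hol k)" by metis
    \<comment> \<open>Subtracting the coboundary of \<open>vp k\<close> leaves a cocycle that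
      vanishes on two boundary elements of the pants, hence on their product.\<close>
    have vp': "u (hp k) = coboundary G (vp k) (hp k)" if k: "k \<in> {1..n - 2}" for k
    proof -
      let ?d = "\<lambda>h. u h - coboundary G (vp k) h"
      have "?d \<in> Z1 G" by (intro Z1_diff u coboundary_Z1)
      moreover have "k - 1 < n - 1" using k n by auto
      ultimately have "?d (hp k) = 0"
        using cocycle_hp_ascend[of ?d "k - 1"] vp[OF k] k by (simp del: hole_product.simps)
      then show ?thesis by simp
    qed
    have "\<forall>k\<in>{1..n - 3}. \<exists>r. vp (Suc k) = vp k + r *\<^sub>R X_zero (c (Cut k))"
    proof
      fix k assume k: "k \<in> {1..n - 3}"
      then have "k \<in> {1..n - 2}" "Suc k \<in> {1..n - 2}" by auto
      then have "coboundary G (vp k) (hp k) = coboundary G (vp (Suc k)) (hp k)"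
        using vp'[of k] vp(1)[of "Suc k"] by (simp del: hole_product.simps)
      then show "\<exists>r. vp (Suc k) = vp k + r *\<^sub>R X_zero (c (Cut k))"
        using coboundary_eq_fixed[OF hp_in_G hp_hyperbolic] Cut_range[OF k] Cut_hp[OF k] by metis
    qed
    then obtain s where s: "\<And>k. k \<in> {1..n - 3} \<Longrightarrow> vp (Suc k) = vp k + s k *\<^sub>R X_zero (c (Cut k))" by metis
    \<comment> \<open>Hole i lies on the pair of pants number \<open>min i (n - 2)\<close>, as the
      last one carries the holes \<open>n - 2\<close> and \<open>n - 1\<close>.\<close>
    have hol: "u (hol i) = coboundary G (vp (min i (n - 2))) (hol i)" if i: "i \<in> {1..<n}" for i
    proof (cases "i \<le> n - 2")
      case True
      then show ?thesis using vp(2)[of i] i by simp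
    next
      case False
      then have i': "i = Suc (n - 2)" using i by auto
      let ?d = "\<lambda>h. u h - coboundary G (vp (n - 2)) h"
      have d: "?d \<in> Z1 G" by (intro Z1_diff u coboundary_Z1)
      have "?d (hp (n - 2)) = 0" using vp'[of "n - 2"] n by simp
      moreover have "?d (hp (Suc (n - 2))) = 0"
      proof -
        have "Suc (n - 2) = n - 1" using n by linarith
        then show ?thesis using cocycle_hp_last[OF d] by (simp only:)
      qed
      ultimately have "?d (hol (Suc (n - 2))) = 0" using cocycle_hp_ascend[OF d, of "n - 2"] n by simp
      then show ?thesis unfolding i' by simp
    qed
    \<comment> \<open>The torus vector and the vector of the adjacent pants have the same coboundary
      on g^j, so they differ along its axis; the multiple becomes the twist coefficient at
      \<open>Sep j\<close>.\<close>
    have "\<forall>j\<in>{1..g}. \<exists>r. vt j = vp (min (b + j - 1) (n - 2)) + r *\<^sub>R X_zero (c (Sep j))"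
    proof
      fix j assume j: "j \<in> {1..g}"
      let ?i = "b + j - 1"
      have "u (hol ?i) = coboundary G (vt j) (hol ?i)"
        using hole_coboundary[OF u handle_hole(1)[OF j]] vt[OF j] handle_hole(3)[OF j] by blast
      then have "coboundary G (vp (min ?i (n - 2))) (hol ?i) = coboundary G (vt j) (hol ?i)"
        using hol[OF handle_hole(1)[OF j]] by simp
      then obtain r where "vt j = vp (min ?i (n - 2)) + r *\<^sub>R X_zero (hol ?i)"
        using coboundary_eq_fixed[OF hol_in_G hol_hyperbolic] handle_hole(1)[OF j]
        by (metis atLeastLessThan_iff)
      then show "\<exists>r. vt j = vp (min ?i (n - 2)) + r *\<^sub>R X_zero (c (Sep j))"
        using handle_hole(2)[OF j] by auto
    qed
    then obtain r where r: "\<And>j. j \<in> {1..g} \<Longrightarrow> vt j = vp (min (b + j - 1) (n - 2)) + r j *\<^sub>R X_zero (c (Sep j))"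
      by metis
    define t where "t l = (case l of Cut k \<Rightarrow> if k \<in> {1..n - 3} then s k else 0
       | Sep j \<Rightarrow> if j \<in> {1..g} then r j else 0 | _ \<Rightarrow> 0)" for l
    have t_Cut: "t (Cut k) = s k" if "k \<in> {1..n - 3}" for k using that unfolding t_def by simp
    have t_Sep: "t (Sep j) = r j" if "j \<in> {1..g}" for j using that unfolding t_def by simp
    have t: "t \<in> coord_space (cutting_loops g b)"
      unfolding coord_space_def
    proof clarify
      fix l assume "l \<notin> cutting_loops g b"
      then show "t l = 0" using cutting_loopsI[OF n] unfolding t_def by (cases l) auto
    qed
    have V: "pants_vector (vp 1) t (Suc i) = vp (min (Suc i) (n - 2))" if "Suc i < n" for i
      using that
    proof (induction i)
      case 0
      have "min (Suc 0) (n - 2) = 1" using n by simp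
      then show ?case by (simp add: pants_vector_1)
    next
      case (Suc i)
      show ?case
      proof (cases "Suc i \<in> {1..n - 3}")
        case True
        then have "min (Suc (Suc i)) (n - 2) = Suc (Suc i)" "min (Suc i) (n - 2) = Suc i" by auto
        then show ?thesis
          using Suc s[OF True] True pants_vector_Suc[of "vp 1" t "Suc i"] t_Cut[OF True] by simp
      next
        case False
        then have "min (Suc (Suc i)) (n - 2) = min (Suc i) (n - 2)" by auto
        then show ?thesis
          using Suc False pants_vector_Suc[of "vp 1" t "Suc i"] by (simp only: if_False) simp
      qed
    qed
    have "u h = twist_comb (vp 1) t h" for h
    proof (rule cocycle_eq_on_gens[OF u twist_comb_Z1])
      fix e assume "e \<in> gens"
      then obtain i where i: "i \<in> {1..<n}" "e \<in> hole_generators b i" unfolding gens_holes by blast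
      have Vi: "pants_vector (vp 1) t i = vp (min i (n - 2))" using V[of "i - 1"] i by simp
      show "u (c e) = twist_comb (vp 1) t (c e)"
        unfolding twist_comb_hole_gens[OF n i] hole_vector_def Vi
      proof (cases "i < b")
        case True
        then show "u (c e) = coboundary G (vp (min i (n - 2)) + (if i < b then 0 else t (hole b i) *\<^sub>R X_zero (hol i))) (c e)"
          using hol[OF i(1)] i(2) by (simp add: hole_generators_def)
      next
        case False
        define j where "j = i + 1 - b"
        have j: "j \<in> {1..g}" "i = b + j - 1" using False i unfolding j_def by auto
        have "e \<in> {Longitude j, Meridian j}" using i(2) False by (simp add: hole_generators_def j_def)
        then have "u (c e) = coboundary G (vt j) (c e)" using vt[OF j(1)] by blast
        moreover have "hole b i = Sep j" using False by (simp add: hole_Sep j_def)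
        ultimately show "u (c e) = coboundary G (vp (min i (n - 2)) + (if i < b then 0 else t (hole b i) *\<^sub>R X_zero (hol i))) (c e)"
          using r[OF j(1)] t_Sep[OF j(1)] False j by simp
      qed
    qed
    then show thesis using that t by blast
  qed
qed

section \<open>Cocycles with prescribed Margulis invariants\<close>

text \<open>The value that a cocycle with values \<open>p i\<close> on the holes must take on the
  partial product \<open>hp k\<close>.\<close>

primrec product_value :: "(nat \<Rightarrow> vec3) \<Rightarrow> nat \<Rightarrow> vec3" where
  "product_value p 0 = p 0"
| "product_value p (Suc k) = product_value p k + hp k *v p (Suc k)"

lemma product_value_cong: "(\<And>i. i \<le> k \<Longrightarrow> p i = p' i) \<Longrightarrow> product_value p k = product_value p' k"
  by (induction k) auto

text \<open>Each new pair of pants contributes one free vector, the value on its hole, and imposes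
  two conditions, one at that hole and one at the new product. Hole 0 starts the chain and is
  governed by \<open>T 0\<close>.\<close>

lemma prescribe_chain:
  assumes "K \<le> n - 2"
  shows "\<exists>p. (\<forall>i\<in>{1..K}. lorentz (p i) (X_zero (hol i)) = H i) \<and>
    (\<forall>k\<le>K. lorentz (product_value p k) (X_zero (hp k)) = T k)"
  using assms
proof (induction K)
  case 0
  have "lorentz (T 0 *\<^sub>R X_zero (hp 0)) (X_zero (hp 0)) = T 0"
    using hyperbolic_X_zero(2)[OF hp_hyperbolic[of 0]] by (simp add: lorentz_bilinear)
  then show ?case by (intro exI[of _ "\<lambda>_. T 0 *\<^sub>R X_zero (hp 0)"]) simp
next
  case (Suc K)
  then obtain p where p: "\<And>i. i \<in> {1..K} \<Longrightarrow> lorentz (p i) (X_zero (hol i)) = H i"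
    "\<And>k. k \<le> K \<Longrightarrow> lorentz (product_value p k) (X_zero (hp k)) = T k" by (meson Suc_leD)
  have lt: "Suc K < n" "Suc K \<in> {1..n - 2}" using Suc.prems n_ge_2 by auto
  obtain x where x: "lorentz x (X_zero (hol (Suc K))) = H (Suc K)"
    "lorentz (product_value p K + hp K *v x) (X_zero (hp K ** hol (Suc K))) = T (Suc K)"
    using pants_extend[OF hp_hyperbolic[of K] hol_hyperbolic[OF lt(1)], where s = "H (Suc K)" and t = "T (Suc K)"
        and q = "product_value p K"]
      hp_hyperbolic[of "Suc K"] pants_noncommuting[OF lt(2)] Suc.prems by auto
  let ?p = "p(Suc K := x)"
  have eq: "product_value ?p k = product_value p k" if "k \<le> K" for k
    using that by (intro product_value_cong) auto
  have "lorentz (?p i) (X_zero (hol i)) = H i" if "i \<in> {1..Suc K}" for i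
    using p(1)[of i] x(1) that by (cases "i = Suc K") auto
  moreover have "lorentz (product_value ?p k) (X_zero (hp k)) = T k" if "k \<le> Suc K" for k
    using p(2)[of k] x(2) that eq[of k] eq[of K] by (cases "k = Suc K") auto
  ultimately show ?case by blast
qed

lemma prescribe_margulis:
  shows "\<exists>u\<in>Z1 G. \<forall>l\<in>loops g b. margulis u (c l) = m l"
proof -
  \<comment> \<open>The product \<open>hp (n - 2)\<close> is inverse to the last hole and must share
    its invariant. This case comes first because on the once-holed torus \<open>n - 2\<close> is 0,
    while \<open>hole b 0\<close> is \<open>Boundary 1\<close>, which is not a listed loop.\<close>
  define T where "T k = (if k = n - 2 then m (hole b (n - 1)) else if k = 0 then m (hole b 0) else m (Cut k))" for k
  obtain p where p: "\<And>i. i \<in> {1..n - 2} \<Longrightarrow> lorentz (p i) (X_zero (hol i)) = m (hole b i)"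
    "\<And>k. k \<le> n - 2 \<Longrightarrow> lorentz (product_value p k) (X_zero (hp k)) = T k"
    using prescribe_chain[of "n - 2" "\<lambda>i. m (hole b i)" T] by blast
  \<comment> \<open>The value on the last hole is not free: it must make the value on the trivial
    full product 0.\<close>
  define z where "z = - (hol (n - 1) *v product_value p (n - 2))"
  let ?p = "p(n - 1 := z)"
  have n1: "n - 1 = Suc (n - 2)" using n_ge_2 by linarith
  have eq: "product_value ?p k = product_value p k" if "k \<le> n - 2" for k
    using that n1 by (intro product_value_cong) auto
  have "hp (n - 2) ** hol (n - 1) = mat 1" using hp_last_inverse matrix_left_right_inverse by blast
  then have z: "hp (n - 2) *v z = - product_value p (n - 2)"
    by (simp add: z_def matvec_neg matrix_vector_mul_assoc)
  have last: "product_value ?p (n - 1) = 0"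
    using z eq[of "n - 2"] n1 by (metis add.right_inverse fun_upd_same order_refl product_value.simps(2))
  have ph: "lorentz (?p i) (X_zero (hol i)) = m (hole b i)" if "i \<in> {1..<n}" for i
  proof (cases "i = n - 1")
    case True
    then show ?thesis using lorentz_last[OF z] p(2)[of "n - 2"] by (simp add: T_def)
  next
    case False
    then have "i \<le> n - 2" using that by auto
    then show ?thesis using p(1)[of i] that False by simp
  qed
  have "\<exists>q r. lorentz q (X_zero (c (Longitude j))) = m (Longitude j)
      \<and> lorentz r (X_zero (c (Meridian j))) = m (Meridian j)
      \<and> comm_value (c (Longitude j)) (c (Meridian j)) (inv\<^bsub>GL3\<^esub> (c (Longitude j))) (inv\<^bsub>GL3\<^esub> (c (Meridian j))) q r
        = ?p (b + j - 1)" if j: "j \<in> {1..g}" for j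
    using once_holed_torus.torus_extend[OF torus[OF j]] by metis
  then obtain q r where qr: "\<And>j. j \<in> {1..g} \<Longrightarrow> lorentz (q j) (X_zero (c (Longitude j))) = m (Longitude j)"
    "\<And>j. j \<in> {1..g} \<Longrightarrow> lorentz (r j) (X_zero (c (Meridian j))) = m (Meridian j)"
    "\<And>j. j \<in> {1..g} \<Longrightarrow> comm_value (c (Longitude j)) (c (Meridian j)) (inv\<^bsub>GL3\<^esub> (c (Longitude j)))
       (inv\<^bsub>GL3\<^esub> (c (Meridian j))) (q j) (r j) = ?p (b + j - 1)"
    by metis
  define U where "U e = (case e of Boundary i \<Rightarrow> ?p i | Longitude j \<Rightarrow> q j | Meridian j \<Rightarrow> r j | _ \<Rightarrow> 0)" for e
  obtain u where u: "u \<in> Z1 G" and uU: "\<And>e. e \<in> gens \<Longrightarrow> u (c e) = U e"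
    using free_cocycle[OF free gens_in_carrier, of U] by blast
  have hol: "u (hol i) = ?p i" if i: "i \<in> {1..<n}" for i
  proof (cases "i < b")
    case True
    then show ?thesis using i uU[of "Boundary i"] by (simp add: hole_def U_def)
  next
    case False
    define j where "j = i + 1 - b"
    have j: "j \<in> {1..g}" "i = b + j - 1" using False i unfolding j_def by auto
    have "u (c (Longitude j)) = q j" "u (c (Meridian j)) = r j"
      using uU[of "Longitude j"] uU[of "Meridian j"] j by (simp_all add: U_def)
    then show ?thesis
      using cocycle_commutator[OF j(1) u] qr(3)[OF j(1)] handle_hole(2)[OF j(1)] j(2) by simp
  qed
  \<comment> \<open>The induction runs downwards from the full product because the value of
    \<open>u\<close> on hole 0 is known only through the relation.\<close>
  have hp: "u (hp k) = product_value ?p k" if "k \<le> n - 1" for k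
    using that
  proof (induction k rule: inc_induct)
    case base
    show ?case unfolding last by (rule cocycle_hp_last[OF u])
  next
    case (step k)
    then have "Suc k < n" by simp
    then have "hp k *v u (hol (Suc k)) + u (hp k) = product_value ?p (Suc k)"
      using cocycle_hp_Suc[OF u] step by metis
    then show ?case using hol[of "Suc k"] step by (simp del: fun_upd_apply)
  qed
  have hpT: "lorentz (u (hp k)) (X_zero (hp k)) = T k" if "k \<le> n - 2" for k
    using that hp[of k] eq p(2) n1 by simp
  have "margulis u (c l) = m l" if l: "l \<in> loops g b" for l
  proof (cases "\<exists>i\<in>{1..<n}. l = hole b i")
    case True
    then show ?thesis using ph hol by (auto simp: margulis_def)
  next
    case nohole: False
    show ?thesis
      using l
    proof (cases rule: loops_cases)
      case gen
      then consider i where "l = Boundary i" "i \<in> {1..<b}" | j where "l = Longitude j" "j \<in> {1..g}"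
        | j where "l = Meridian j" "j \<in> {1..g}" by blast
      then show ?thesis
      proof cases
        case (1 i)
        then have "l = hole b i" "i \<in> {1..<n}" by (auto simp: hole_def)
        then show ?thesis using nohole by blast
      next
        case (2 j)
        then show ?thesis using uU[of l] qr(1) by (simp add: margulis_def U_def)
      next
        case (3 j)
        then show ?thesis using uU[of l] qr(2) by (simp add: margulis_def U_def)
      qed
    next
      case (hol i)
      then show ?thesis using nohole by blast
    next
      case first
      then show ?thesis using hpT[of 0] by (simp add: margulis_def T_def)
    next
      case (cut k)
      then have "k \<le> n - 2" "k \<noteq> n - 2" "k \<noteq> 0" by auto
      then show ?thesis using hpT[of k] cut by (simp add: margulis_def T_def)
    qed
  qed
  then show ?thesis using u by blast
qed


section \<open>Affine twist parameters\<close>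

lemma holes_group_subset:
  assumes "I \<subseteq> {..<n}"
  shows "c ` (\<Union>i\<in>I. hole_generators b i) \<subseteq> G" "holes_group b c I \<subseteq> G"
proof -
  have "c e \<in> G" if "i \<in> I" "e \<in> hole_generators b i" for i e
  proof (cases "i = 0")
    case True
    then show ?thesis using that hol_in_G[OF n_pos] b_pos by (simp add: hole_generators_def)
  next
    case False
    then have "i \<in> {1..<n}" using that assms by auto
    then show ?thesis using that hole_generators_gens gens_in_G by blast
  qed
  then show 1: "c ` (\<Union>i\<in>I. hole_generators b i) \<subseteq> G" by blast
  show "holes_group b c I \<subseteq> G" unfolding holes_group_def by (rule generate_closed[OF 1])
qed

text \<open>Extends the defining values from generators to both side groups. Hole 0 lies on the
  second side but is no generator, so its value comes from \<open>twist_hp\<close>.\<close>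

lemma twist_on_sides:
  assumes l: "l \<in> cutting_loops g b"
  shows "h \<in> holes_group b c (holes_beyond g b l) \<Longrightarrow> twist l h = coboundary G (X_zero (c l)) h"
    and "h \<in> holes_group b c ({..<n} - holes_beyond g b l) \<Longrightarrow> twist l h = 0"
proof -
  note range = holes_beyond_range[OF l]
  have sub: "holes_beyond g b l \<subseteq> {..<n}" using range by auto
  show "twist l h = coboundary G (X_zero (c l)) h" if "h \<in> holes_group b c (holes_beyond g b l)"
  proof (rule cocycle_eq_on_generate[OF twist_Z1 coboundary_Z1 holes_group_subset(1)[OF sub]])
    fix k assume "k \<in> c ` (\<Union>i\<in>holes_beyond g b l. hole_generators b i)"
    then show "twist l k = coboundary G (X_zero (c l)) k" using twist_hole_gens[OF l] range by auto
  qed (use that in \<open>simp add: holes_group_def\<close>)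
  show "twist l h = 0" if "h \<in> holes_group b c ({..<n} - holes_beyond g b l)"
  proof (rule cocycle_zero_on_generate[OF twist_Z1 holes_group_subset(1)])
    fix k assume "k \<in> c ` (\<Union>i\<in>{..<n} - holes_beyond g b l. hole_generators b i)"
    then obtain i e where i: "i < n" "i \<notin> holes_beyond g b l" "e \<in> hole_generators b i" "k = c e" by blast
    show "twist l k = 0"
    proof (cases "i = 0")
      case True
      then show ?thesis using i twist_hp(2)[OF l n_pos] b_pos by (simp add: hole_generators_def)
    next
      case False
      then show ?thesis using twist_hole_gens[OF l, of i e] i by (simp add: coboundary_zero)
    qed
  qed (use that in \<open>auto simp: holes_group_def\<close>)
qed

lemma gens_in_sides:
  "e \<in> gens \<Longrightarrow> c e \<in> holes_group b c I \<union> holes_group b c ({..<n} - I)"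
proof -
  assume "e \<in> gens"
  then obtain i where "i < n" "e \<in> hole_generators b i" unfolding gens_holes by auto
  then show ?thesis
    unfolding holes_group_def by (cases "i \<in> I") (auto intro!: generate.incl)
qed

text \<open>The sides together contain all free generators, so a cocycle is determined by its
  restrictions to them and the definite description denotes.\<close>

lemma affine_twist_eq:
  assumes w: "w \<in> Z1 G" and 0: "\<And>h. h \<in> S1 \<Longrightarrow> w h = 0"
    and X: "\<And>h. h \<in> S2 \<Longrightarrow> w h = X_zero k - h *v X_zero k"
    and cover: "\<And>e. e \<in> gens \<Longrightarrow> c e \<in> S1 \<union> S2"
  shows "affine_twist G S1 S2 k = w"
  unfolding affine_twist_def
proof (rule the_equality)
  show "w \<in> Z1 G \<and> (\<forall>h\<in>S1. w h = 0) \<and> (\<forall>h\<in>S2. w h = X_zero k - h *v X_zero k)"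
    using w 0 X by blast
  fix u assume u: "u \<in> Z1 G \<and> (\<forall>h\<in>S1. u h = 0) \<and> (\<forall>h\<in>S2. u h = X_zero k - h *v X_zero k)"
  have "u h = w h" for h
  proof (rule cocycle_eq_on_gens)
    fix e assume "e \<in> gens"
    then have "c e \<in> S1 \<or> c e \<in> S2" using cover by blast
    then show "u (c e) = w (c e)"
    proof
      assume "c e \<in> S1"
      then show ?thesis using u 0 by simp
    next
      assume "c e \<in> S2"
      then show ?thesis using u X by simp
    qed
  qed (use u w in auto)
  then show "u = w" by blast
qed

text \<open>Exchanging the sides replaces the twist by the coboundary of X_c minus the twist. The
  sign is recorded as \<open>\<sigma> * \<sigma> = 1\<close>, the form in which it is later
  inverted.\<close>

lemma affine_twist_twist:
  assumes l: "l \<in> cutting_loops g b" and sides: "{S1, S2} = side_groups g b c l"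
  shows "\<exists>\<sigma> w. \<sigma> * \<sigma> = 1 \<and> (\<forall>h. affine_twist G S1 S2 (c l) h = \<sigma> *\<^sub>R twist l h + coboundary G w h)"
proof -
  let ?B = "holes_group b c (holes_beyond g b l)" and ?R = "holes_group b c ({..<n} - holes_beyond g b l)"
  have "holes_beyond g b l \<subseteq> {..<n}" using holes_beyond_range[OF l] by auto
  then have sub: "?B \<subseteq> G" "?R \<subseteq> G" by (auto intro!: holes_group_subset(2))
  have "S1 = ?R \<and> S2 = ?B \<or> S1 = ?B \<and> S2 = ?R"
    using sides unfolding side_groups_def by (auto simp: doubleton_eq_iff)
  then show ?thesis
  proof
    assume S: "S1 = ?R \<and> S2 = ?B"
    have "affine_twist G S1 S2 (c l) = twist l"
    proof (rule affine_twist_eq[OF twist_Z1])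
      show "twist l h = 0" if "h \<in> S1" for h using that S twist_on_sides(2)[OF l] by blast
      show "twist l h = X_zero (c l) - h *v X_zero (c l)" if "h \<in> S2" for h
        using that S twist_on_sides(1)[OF l, of h] sub by (auto simp: coboundary_def)
      show "c e \<in> S1 \<union> S2" if "e \<in> gens" for e using gens_in_sides[OF that] S by blast
    qed
    then show ?thesis by (intro exI[of _ 1] exI[of _ 0]) (simp add: coboundary_zero)
  next
    assume S: "S1 = ?B \<and> S2 = ?R"
    have "affine_twist G S1 S2 (c l) = (\<lambda>h. coboundary G (X_zero (c l)) h - twist l h)"
    proof (rule affine_twist_eq[OF Z1_diff[OF coboundary_Z1 twist_Z1]])
      show "coboundary G (X_zero (c l)) h - twist l h = 0" if "h \<in> S1" for h
        using that S twist_on_sides(1)[OF l, of h] by simp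
      show "coboundary G (X_zero (c l)) h - twist l h = X_zero (c l) - h *v X_zero (c l)" if "h \<in> S2" for h
        using that S twist_on_sides(2)[OF l, of h] sub by (auto simp: coboundary_def)
      show "c e \<in> S1 \<union> S2" if "e \<in> gens" for e using gens_in_sides[OF that] S by blast
    qed
    then show ?thesis by (intro exI[of _ "-1"] exI[of _ "X_zero (c l)"]) simp
  qed
qed

lemma finite_loops: "finite (loops g b)"
  by (simp add: loops_def)

lemma margulis_linear:
  "margulis (\<lambda>h. u h + u' h) k = margulis u k + margulis u' k"
  "margulis (\<lambda>h. a *\<^sub>R u h) k = a * margulis u k"
  "margulis (\<lambda>h. u h - u' h) k = margulis u k - margulis u' k"
  "margulis (\<lambda>h. \<Sum>i\<in>I. f i h) k = (\<Sum>i\<in>I. margulis (f i) k)"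
  by (simp_all add: margulis_def lorentz_bilinear lorentz_sum_left)

text \<open>Cocycles \<open>E i\<close> dual to the loops are chosen once and combined linearly, so
  the reference cocycle depends linearly on \<open>m\<close>.\<close>

lemma normalization_exists: "\<exists>s. normalization g b G c s"
proof -
  have "\<forall>i. \<exists>u\<in>Z1 G. \<forall>l\<in>loops g b. margulis u (c l) = (if l = i then 1 else 0)"
    by (intro allI prescribe_margulis)
  then obtain E where E: "\<And>i. E i \<in> Z1 G" "\<And>i l. l \<in> loops g b \<Longrightarrow> margulis (E i) (c l) = (if l = i then 1 else 0)"
    by metis
  define s where "s m h = (\<Sum>i\<in>loops g b. m i *\<^sub>R E i h)" for m h
  have sZ: "s m \<in> Z1 G" for m unfolding s_def by (intro Z1_sum Z1_scale E)
  have sM: "margulis (s m) (c l) = m l" if "l \<in> loops g b" for m l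
  proof -
    have "margulis (s m) (c l) = (\<Sum>i\<in>loops g b. if l = i then m i else 0)"
      unfolding s_def margulis_linear using E(2)[OF that] by (intro sum.cong) auto
    then show ?thesis using that finite_loops by simp
  qed
  have "normalization g b G c s"
    unfolding normalization_def
    using sZ sM by (auto simp: s_def scaleR_add_left sum.distrib scaleR_sum_right)
  then show ?thesis by blast
qed

end

section \<open>Coordinates on the first cohomology\<close>

locale twisted_surface = surface +
  fixes \<Sigma>1 \<Sigma>2 :: "loop \<Rightarrow> mat3 set" and s
  assumes sides: "\<And>l. l \<in> cutting_loops g b \<Longrightarrow> {\<Sigma>1 l, \<Sigma>2 l} = side_groups g b c l"
    and norm: "normalization g b G c s"
begin

abbreviation "twists \<equiv> cutting_loops g b"
abbreviation "AT l \<equiv> affine_twist G (\<Sigma>1 l) (\<Sigma>2 l) (c l)"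

definition "combine m t = (\<lambda>h. s m h + (\<Sum>l\<in>twists. t l *\<^sub>R AT l h))"

lemma reference_cocycle: "m \<in> coord_space (loops g b) \<Longrightarrow> s m \<in> Z1 G"
  "m \<in> coord_space (loops g b) \<Longrightarrow> l \<in> loops g b \<Longrightarrow> margulis (s m) (c l) = m l"
  using norm by (auto simp: normalization_def)

lemma AT_sign:
  obtains \<sigma> w where "\<And>l. l \<in> twists \<Longrightarrow> \<sigma> l * \<sigma> l = 1"
    "\<And>l h. l \<in> twists \<Longrightarrow> AT l h = \<sigma> l *\<^sub>R twist l h + coboundary G (w l) h"
proof -
  have "\<forall>l\<in>twists. \<exists>\<sigma> w. \<sigma> * \<sigma> = 1 \<and> (\<forall>h. AT l h = \<sigma> *\<^sub>R twist l h + coboundary G w h)"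
    using affine_twist_twist[OF _ sides] by blast
  from bchoice[OF this] obtain \<sigma> where
    "\<forall>l\<in>twists. \<exists>w. \<sigma> l * \<sigma> l = 1 \<and> (\<forall>h. AT l h = \<sigma> l *\<^sub>R twist l h + coboundary G w h)" by blast
  from bchoice[OF this] obtain w where
    "\<forall>l\<in>twists. \<sigma> l * \<sigma> l = 1 \<and> (\<forall>h. AT l h = \<sigma> l *\<^sub>R twist l h + coboundary G (w l) h)" by blast
  then show thesis using that by blast
qed

lemma AT_Z1:
  assumes "l \<in> twists" shows "AT l \<in> Z1 G"
proof -
  obtain \<sigma> w where "\<And>h. AT l h = \<sigma> *\<^sub>R twist l h + coboundary G w h"
    using affine_twist_twist[OF assms sides[OF assms]] by blast
  then have "AT l = (\<lambda>h. \<sigma> *\<^sub>R twist l h + coboundary G w h)" by blast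
  then show ?thesis by (metis Z1_add Z1_scale twist_Z1 coboundary_Z1)
qed

lemma AT_sum_Z1: "(\<lambda>h. \<Sum>l\<in>twists. t l *\<^sub>R AT l h) \<in> Z1 G"
  by (intro Z1_sum Z1_scale AT_Z1)

lemma combine_Z1: "m \<in> coord_space (loops g b) \<Longrightarrow> combine m t \<in> Z1 G"
  unfolding combine_def by (intro Z1_add reference_cocycle AT_sum_Z1)

lemma margulis_AT:
  assumes "l \<in> twists" "k \<in> loops g b" shows "margulis (AT l) (c k) = 0"
proof -
  obtain \<sigma> w where "\<And>h. AT l h = \<sigma> *\<^sub>R twist l h + coboundary G w h"
    using affine_twist_twist[OF assms(1) sides[OF assms(1)]] by blast
  then have "margulis (AT l) (c k) = \<sigma> * margulis (twist l) (c k) + margulis (coboundary G w) (c k)"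
    by (simp add: margulis_def lorentz_bilinear)
  then show ?thesis using margulis_twist margulis_coboundary assms by simp
qed

lemma margulis_combine:
  assumes "m \<in> coord_space (loops g b)" "k \<in> loops g b"
  shows "margulis (combine m t) (c k) = m k"
  unfolding combine_def margulis_linear using assms margulis_AT reference_cocycle(2) by simp

text \<open>Each \<sigma> is its own inverse, so passing between model twists and affine twists only
  changes the signs of coefficients, up to one collected coboundary.\<close>

lemma twist_sum_to_AT:
  assumes \<sigma>: "\<And>l. l \<in> twists \<Longrightarrow> \<sigma> l * \<sigma> l = 1"
    "\<And>l h. l \<in> twists \<Longrightarrow> AT l h = \<sigma> l *\<^sub>R twist l h + coboundary G (w l) h"
  shows "\<exists>v. \<forall>h. (\<Sum>l\<in>twists. t l *\<^sub>R twist l h) = (\<Sum>l\<in>twists. (\<sigma> l * t l) *\<^sub>R AT l h) + coboundary G v h"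
proof (intro exI allI)
  fix h
  have "(\<Sum>l\<in>twists. (\<sigma> l * t l) *\<^sub>R AT l h) = (\<Sum>l\<in>twists. t l *\<^sub>R twist l h + coboundary G ((\<sigma> l * t l) *\<^sub>R w l) h)"
  proof (rule sum.cong[OF refl])
    fix l assume l: "l \<in> twists"
    have "(\<sigma> l * t l) *\<^sub>R AT l h = (\<sigma> l * \<sigma> l * t l) *\<^sub>R twist l h + (\<sigma> l * t l) *\<^sub>R coboundary G (w l) h"
      by (simp add: \<sigma>(2)[OF l] scaleR_add_right mult_ac)
    then show "(\<sigma> l * t l) *\<^sub>R AT l h = t l *\<^sub>R twist l h + coboundary G ((\<sigma> l * t l) *\<^sub>R w l) h"
      by (simp add: \<sigma>(1)[OF l] coboundary_scale)
  qed
  also have "\<dots> = (\<Sum>l\<in>twists. t l *\<^sub>R twist l h) + coboundary G (\<Sum>l\<in>twists. (\<sigma> l * t l) *\<^sub>R w l) h"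
    by (simp add: sum.distrib coboundary_sum)
  finally show "(\<Sum>l\<in>twists. t l *\<^sub>R twist l h)
      = (\<Sum>l\<in>twists. (\<sigma> l * t l) *\<^sub>R AT l h) + coboundary G (- (\<Sum>l\<in>twists. (\<sigma> l * t l) *\<^sub>R w l)) h"
    using coboundary_diff[of G 0] by (simp add: coboundary_zero)
qed

lemma margulis_zero_imp_AT:
  assumes u: "u \<in> Z1 G" and m: "\<And>l. l \<in> loops g b \<Longrightarrow> margulis u (c l) = 0"
  obtains v t where "t \<in> coord_space twists" "\<And>h. u h = (\<Sum>l\<in>twists. t l *\<^sub>R AT l h) + coboundary G v h"
proof -
  obtain \<sigma> w where \<sigma>: "\<And>l. l \<in> twists \<Longrightarrow> \<sigma> l * \<sigma> l = 1"
    "\<And>l h. l \<in> twists \<Longrightarrow> AT l h = \<sigma> l *\<^sub>R twist l h + coboundary G (w l) h"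
    using AT_sign by metis
  obtain v t where t: "t \<in> coord_space twists" and ut: "u = twist_comb v t"
    using margulis_zero_imp_twist_comb[OF u m] by metis
  obtain v' where v': "\<And>h. (\<Sum>l\<in>twists. t l *\<^sub>R twist l h) = (\<Sum>l\<in>twists. (\<sigma> l * t l) *\<^sub>R AT l h) + coboundary G v' h"
    using twist_sum_to_AT[where t = t, OF \<sigma>] by auto
  show thesis
  proof
    show "(\<lambda>l. \<sigma> l * t l) \<in> coord_space twists" using t by (simp add: coord_space_def)
    show "u h = (\<Sum>l\<in>twists. (\<sigma> l * t l) *\<^sub>R AT l h) + coboundary G (v + v') h" for h
      unfolding ut twist_comb_def v' coboundary_add by simp
  qed
qed

lemma AT_sum_coboundary:
  assumes t: "t \<in> coord_space twists" and eq: "\<And>h. (\<Sum>l\<in>twists. t l *\<^sub>R AT l h) = coboundary G v h"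
  shows "t = (\<lambda>_. 0)"
proof -
  obtain \<sigma> w where \<sigma>: "\<And>l. l \<in> twists \<Longrightarrow> \<sigma> l * \<sigma> l = 1"
    "\<And>l h. l \<in> twists \<Longrightarrow> AT l h = \<sigma> l *\<^sub>R twist l h + coboundary G (w l) h"
    using AT_sign by metis
  let ?t = "\<lambda>l. \<sigma> l * t l"
  obtain v' where v': "\<And>h. (\<Sum>l\<in>twists. ?t l *\<^sub>R twist l h) = (\<Sum>l\<in>twists. (\<sigma> l * ?t l) *\<^sub>R AT l h) + coboundary G v' h"
    using twist_sum_to_AT[where t = ?t, OF \<sigma>] by auto
  have "(\<Sum>l\<in>twists. (\<sigma> l * ?t l) *\<^sub>R AT l h) = coboundary G v h" for h
    unfolding eq[symmetric]
  proof (rule sum.cong[OF refl])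
    fix l assume "l \<in> twists"
    then have "\<sigma> l * ?t l = t l" using \<sigma>(1) by (metis mult.assoc mult_1)
    then show "(\<sigma> l * ?t l) *\<^sub>R AT l h = t l *\<^sub>R AT l h" by simp
  qed
  then have zero: "twist_comb (- v - v') ?t h = 0" for h
    unfolding twist_comb_def v' using coboundary_diff[of G "- v" v'] coboundary_diff[of G 0 v]
    by (simp add: coboundary_zero)
  have "?t \<in> coord_space twists" using t by (simp add: coord_space_def)
  then have "?t = (\<lambda>_. 0)" by (rule twist_comb_zero_imp[OF _ zero])
  have "t l = 0" for l
  proof (cases "l \<in> twists")
    case True
    then have "t l = \<sigma> l * ?t l" using \<sigma>(1) by (metis mult.assoc mult_1)
    then show ?thesis using fun_cong[OF \<open>?t = (\<lambda>_. 0)\<close>, of l] by simp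
  qed (use t in \<open>simp add: coord_space_def\<close>)
  then show ?thesis by blast
qed

lemma margulis_vector_coord: "margulis_vector g b c u \<in> coord_space (loops g b)"
  by (simp add: coord_space_def margulis_vector_def)

lemma has_twist_params_iff:
  "has_twist_params g b G c \<Sigma>1 \<Sigma>2 s u t \<longleftrightarrow>
     t \<in> coord_space twists \<and> coh_class G u = coh_class G (combine (margulis_vector g b c u) t)"
  by (simp add: has_twist_params_def combine_def)

text \<open>Subtracting the reference cocycle with the same invariants leaves a cocycle with
  vanishing invariants, a combination of twists up to a coboundary. Independence of the twists makes
  the coefficients unique.\<close>

lemma twist_params_unique:
  assumes u: "u \<in> Z1 G"
  shows "\<exists>!t. has_twist_params g b G c \<Sigma>1 \<Sigma>2 s u t"
proof -
  let ?m = "margulis_vector g b c u"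
  note m = margulis_vector_coord[of u]
  have su: "(\<lambda>h. u h - s ?m h) \<in> Z1 G" by (intro Z1_diff u reference_cocycle m)
  have m0: "margulis (\<lambda>h. u h - s ?m h) (c l) = 0" if "l \<in> loops g b" for l
    using reference_cocycle(2)[OF m that] that by (simp add: margulis_linear margulis_vector_def)
  obtain v t where t: "t \<in> coord_space twists"
    and ut: "\<And>h. u h - s ?m h = (\<Sum>l\<in>twists. t l *\<^sub>R AT l h) + coboundary G v h"
    using margulis_zero_imp_AT[OF su m0] by blast
  have "u h = combine ?m t h + coboundary G v h" for h
    using ut[of h] by (simp add: combine_def algebra_simps)
  then have "coh_class G (combine ?m t) = coh_class G u"
    using coh_class_eq_iff[OF combine_Z1[OF m] u] by blast
  then have "has_twist_params g b G c \<Sigma>1 \<Sigma>2 s u t" using t by (simp add: has_twist_params_iff)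
  moreover have "t1 = t2"
    if "has_twist_params g b G c \<Sigma>1 \<Sigma>2 s u t1" "has_twist_params g b G c \<Sigma>1 \<Sigma>2 s u t2" for t1 t2
  proof -
    have t12: "t1 \<in> coord_space twists" "t2 \<in> coord_space twists"
      "coh_class G (combine ?m t1) = coh_class G (combine ?m t2)"
      using that by (auto simp: has_twist_params_iff)
    then obtain v where v: "\<And>h. combine ?m t2 h = combine ?m t1 h + coboundary G v h"
      using coh_class_eq_iff[OF combine_Z1[OF m] combine_Z1[OF m]] by blast
    have diff: "(\<Sum>l\<in>twists. (t2 l - t1 l) *\<^sub>R AT l h) = coboundary G v h" for h
      using v[of h] by (simp add: combine_def scaleR_diff_left sum_subtractf)
    have "(\<lambda>l. t2 l - t1 l) \<in> coord_space twists" using t12 by (simp add: coord_space_def)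
    then have zero: "(\<lambda>l. t2 l - t1 l) = (\<lambda>_. 0)" by (rule AT_sum_coboundary[OF _ diff])
    show ?thesis
    proof
      show "t1 l = t2 l" for l using fun_cong[OF zero, of l] by simp
    qed
  qed
  ultimately show ?thesis by blast
qed

lemma AfT:
  assumes "u \<in> Z1 G"
  shows "has_twist_params g b G c \<Sigma>1 \<Sigma>2 s u t \<longleftrightarrow> AfT g b G c \<Sigma>1 \<Sigma>2 s u = t"
proof -
  have "has_twist_params g b G c \<Sigma>1 \<Sigma>2 s u (AfT g b G c \<Sigma>1 \<Sigma>2 s u)"
    unfolding AfT_def by (rule theI'[OF twist_params_unique[OF assms]])
  then show ?thesis using twist_params_unique[OF assms] by blast
qed

text \<open>Margulis invariants depend on the class only and fix the reference cocycle; uniqueness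
  of the twist parameters then identifies \<open>t\<close>. Equality of the coordinate functions may
  be tested on loops because all of them vanish elsewhere.\<close>

lemma class_of_combine:
  assumes m: "m \<in> coord_space (loops g b)" and t: "t \<in> coord_space twists"
  shows "coh_class G (combine m t) = {u \<in> Z1 G. (\<forall>l\<in>loops g b. margulis u (c l) = m l) \<and>
    (\<forall>l\<in>twists. AfT g b G c \<Sigma>1 \<Sigma>2 s u l = t l)}" (is "_ = ?R")
proof (rule Set.set_eqI)
  fix u
  note cm = combine_Z1[OF m]
  have "u \<in> coh_class G (combine m t) \<longleftrightarrow> u \<in> Z1 G \<and> coh_class G u = coh_class G (combine m t)"
    using mem_coh_class[OF cm] by auto
  also have "\<dots> \<longleftrightarrow> u \<in> Z1 G \<and> margulis_vector g b c u = m \<and> has_twist_params g b G c \<Sigma>1 \<Sigma>2 s u t"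
  proof -
    have "margulis_vector g b c u = m" if u: "u \<in> Z1 G" "coh_class G u = coh_class G (combine m t)"
    proof -
      obtain v where v: "\<And>h. u h = combine m t h + coboundary G v h"
        using coh_class_eq_iff[OF cm u(1), THEN iffD1, OF u(2)[symmetric]] by blast
      have "margulis u (c l) = m l" if "l \<in> loops g b" for l
      proof -
        have "u = (\<lambda>h. combine m t h + coboundary G v h)" using v by blast
        then have "margulis u (c l) = margulis (combine m t) (c l) + margulis (coboundary G v) (c l)"
          by (metis margulis_linear(1))
        then show ?thesis using margulis_combine[OF m that] margulis_coboundary[OF that] by simp
      qed
      then show ?thesis using m by (auto simp: margulis_vector_def coord_space_def)
    qed
    then show ?thesis using t by (auto simp: has_twist_params_iff)
  qed
  also have "\<dots> \<longleftrightarrow> u \<in> ?R"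
  proof (cases "u \<in> Z1 G")
    case True
    have "margulis_vector g b c u = m \<longleftrightarrow> (\<forall>l\<in>loops g b. margulis u (c l) = m l)"
      using m by (auto simp: margulis_vector_def coord_space_def fun_eq_iff)
    moreover have "AfT g b G c \<Sigma>1 \<Sigma>2 s u \<in> coord_space twists"
      using AfT[OF True, of "AfT g b G c \<Sigma>1 \<Sigma>2 s u"] has_twist_params_iff by blast
    then have "AfT g b G c \<Sigma>1 \<Sigma>2 s u = t \<longleftrightarrow> (\<forall>l\<in>twists. AfT g b G c \<Sigma>1 \<Sigma>2 s u l = t l)"
      using t by (auto simp: coord_space_def fun_eq_iff)
    ultimately show ?thesis using AfT[OF True] True by simp
  qed simp
  finally show "u \<in> coh_class G (combine m t) \<longleftrightarrow> u \<in> ?R" .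
qed

definition "param x = coh_class G (combine (\<lambda>l. x (MarC l)) (\<lambda>l. x (TwistC l)))"

lemma coord_parts:
  assumes "x \<in> coord_space (coords g b)"
  shows "(\<lambda>l. x (MarC l)) \<in> coord_space (loops g b)" "(\<lambda>l. x (TwistC l)) \<in> coord_space twists"
  using assms by (auto simp: coord_space_def coords_def)

lemma param_eq:
  assumes "x \<in> coord_space (coords g b)"
  shows "param x = {u \<in> Z1 G. (\<forall>l\<in>loops g b. margulis u (c l) = x (MarC l)) \<and>
    (\<forall>l\<in>twists. AfT g b G c \<Sigma>1 \<Sigma>2 s u l = x (TwistC l))}"
  unfolding param_def by (rule class_of_combine[OF coord_parts[OF assms]])

lemma combine_mem_param: "x \<in> coord_space (coords g b) \<Longrightarrow> combine (\<lambda>l. x (MarC l)) (\<lambda>l. x (TwistC l)) \<in> param x"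
  unfolding param_def mem_coh_class[OF combine_Z1[OF coord_parts(1)]] using combine_Z1[OF coord_parts(1)] by blast

lemma param_linear_iso: "linear_iso_H1 G (coords g b) param"
  unfolding linear_iso_H1_def
proof (intro conjI ballI allI)
  show "bij_betw param (coord_space (coords g b)) (H1 G)"
    unfolding bij_betw_def
  proof
    show "inj_on param (coord_space (coords g b))"
    proof (rule inj_onI)
      fix x y assume x: "x \<in> coord_space (coords g b)" and y: "y \<in> coord_space (coords g b)" and eq: "param x = param y"
      let ?u = "combine (\<lambda>l. x (MarC l)) (\<lambda>l. x (TwistC l))"
      have u: "?u \<in> param x" "?u \<in> param y" using combine_mem_param[OF x] eq by auto
      have M: "x (MarC l) = y (MarC l)" if "l \<in> loops g b" for l
        using u that unfolding param_eq[OF x] param_eq[OF y] by simp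
      have T: "x (TwistC l) = y (TwistC l)" if "l \<in> twists" for l
        using u that unfolding param_eq[OF x] param_eq[OF y] by simp
      show "x = y"
      proof
        fix i show "x i = y i"
          using M T x y by (cases "i \<in> coords g b") (auto simp: coords_def coord_space_def)
      qed
    qed
    show "param ` coord_space (coords g b) = H1 G"
    proof
      show "param ` coord_space (coords g b) \<subseteq> H1 G"
        unfolding param_def H1_def coh_class_def using quotientI[OF combine_Z1[OF coord_parts(1)]] by blast
      show "H1 G \<subseteq> param ` coord_space (coords g b)"
      proof
        fix X assume "X \<in> H1 G"
        then obtain u where u: "u \<in> Z1 G" "X = coh_class G u"
          unfolding H1_def coh_class_def by (auto elim: quotientE)
        obtain t where t: "t \<in> coord_space twists" "coh_class G u = coh_class G (combine (margulis_vector g b c u) t)"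
          using twist_params_unique[OF u(1)] unfolding has_twist_params_iff by blast
        let ?x = "\<lambda>i. case i of MarC l \<Rightarrow> margulis_vector g b c u l | TwistC l \<Rightarrow> t l"
        have "?x \<in> coord_space (coords g b)"
          using t(1) margulis_vector_coord[of u]
          by (auto simp: coord_space_def coords_def split: coord.split)
        moreover have "param ?x = X" using t(2) u(2) by (simp add: param_def)
        ultimately show "X \<in> param ` coord_space (coords g b)" by blast
      qed
    qed
  qed
next
  fix x y assume x: "x \<in> coord_space (coords g b)" and y: "y \<in> coord_space (coords g b)"
  have "s (\<lambda>l. x (MarC l) + y (MarC l)) = (\<lambda>h. s (\<lambda>l. x (MarC l)) h + s (\<lambda>l. y (MarC l)) h)"
    using norm coord_parts(1)[OF x] coord_parts(1)[OF y] by (simp add: normalization_def)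
  then show "param (\<lambda>i. x i + y i) = H1_add G (param x) (param y)"
    unfolding param_def using combine_Z1 coord_parts(1) x y
    by (simp add: H1_add_class combine_def scaleR_add_left sum.distrib add_ac)
next
  fix a x assume x: "x \<in> coord_space (coords g b)"
  have "s (\<lambda>l. a * x (MarC l)) = (\<lambda>h. a *\<^sub>R s (\<lambda>l. x (MarC l)) h)"
    using norm coord_parts(1)[OF x] by (simp add: normalization_def)
  then show "param (\<lambda>i. a * x i) = H1_scale G a (param x)"
    unfolding param_def using combine_Z1 coord_parts(1) x
    by (simp add: H1_scale_class combine_def scaleR_add_right scaleR_sum_right)
qed

end

theorem theorem1p1:
  fixes g b :: nat and G :: "mat3 set" and c :: "loop \<Rightarrow> mat3"
    and \<Sigma>1 \<Sigma>2 :: "loop \<Rightarrow> mat3 set"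
  assumes "b \<ge> 1"
    and "decomposed_surface g b G c"
    and "\<And>l. l \<in> cutting_loops g b \<Longrightarrow> {\<Sigma>1 l, \<Sigma>2 l} = side_groups g b c l"
    and "\<And>j p. j \<in> {1..g} \<Longrightarrow> p \<in> geod_axis (c (Longitude j)) \<inter> geod_axis (c (Meridian j)) \<Longrightarrow>
           crossing_angle (c (Longitude j)) (c (Meridian j)) p \<noteq> pi / 2"
  shows "card (coords g b) = 6 * g + 3 * b - 6 \<and>
    (\<exists>s. normalization g b G c s \<and>
         (\<forall>u\<in>Z1 G. \<exists>!t. has_twist_params g b G c \<Sigma>1 \<Sigma>2 s u t) \<and>
         (\<exists>\<Phi>. linear_iso_H1 G (coords g b) \<Phi> \<and>
              (\<forall>x\<in>coord_space (coords g b).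
                 \<Phi> x = {u \<in> Z1 G. (\<forall>l\<in>loops g b. margulis u (c l) = x (MarC l)) \<and>
                                  (\<forall>l\<in>cutting_loops g b.
                                     AfT g b G c \<Sigma>1 \<Sigma>2 s u l = x (TwistC l))})))"
proof -
  have marked: "marked_surface g b G c" using assms(2) by (simp add: decomposed_surface_def)
  \<comment> \<open>The curves w_1 and w_2 do cross, and B-orthogonal axis vectors would make them
    cross at a right angle.\<close>
  have angle: "lorentz (X_zero (c (Longitude j))) (X_zero (c (Meridian j))) \<noteq> 0" if j: "j \<in> {1..g}" for j
  proof
    assume orth: "lorentz (X_zero (c (Longitude j))) (X_zero (c (Meridian j))) = 0"
    have "hyperbolic (c (Longitude j))" "hyperbolic (c (Meridian j))"
      and "meet_once G (c (Longitude j)) (c (Meridian j))"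
      using assms(2) j by (auto simp: decomposed_surface_def simple_closed_geodesic_def)
    moreover from this obtain p where "p \<in> geod_axis (c (Longitude j)) \<inter> geod_axis (c (Meridian j))"
      by (auto simp: meet_once_def)
    ultimately show False using orthogonal_axes_crossing_angle orth assms(4)[OF j] by blast
  qed
  interpret surface G g b c
  proof (intro surface.intro surface_axioms.intro matrix_group.intro)
    show "subgroup G GL3" using marked by (simp add: marked_surface_def fuchsian_group_def)
  qed (use marked assms(1,2) angle in \<open>auto simp: marked_surface_def decomposed_surface_def\<close>)
  obtain s where s: "normalization g b G c s" using normalization_exists by blast
  interpret twisted_surface G g b c \<Sigma>1 \<Sigma>2 s
    by unfold_locales (use assms(3) s in auto)
  have "card (coords g b) = 6 * g + 3 * b - 6" by (rule card_coords[OF b_pos nonsporadic])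
  then show ?thesis
    by (intro conjI exI[of _ s] exI[of _ param] ballI norm twist_params_unique param_linear_iso param_eq)
qed

end
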